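(* Let $k$ be a field with $\operatorname{char} k\neq 2$, let $n$ be an even non-negative integer, and let $A=Cl(\alpha,\beta_i,\gamma_i,\lambda_{ij})$ be a $2^{n+1}$-dimensional Clifford algebra over $k$. Assume that $A$ is semisimple. Let $z$ denote its pseudoscalar and $\sigma$ the main involution of $A$. Then the right $E(n)$-coactions on $A$ are exactly the $k$-linear maps $\rho:A\to A\otimes E(n)$ of one of the following two forms. Either \[\rho(a)=\sum_{P\subseteq\{1,\ldots,n\}}(-1)^{\lfloor\frac{|P|+1}{2}\rfloor}\left[d_P(a)\otimes\frac{x_P+(-1)^{|P|}gx_P}{2}+c^{-1}d_P(a)c\otimes\frac{x_P+(-1)^{|P|+1}gx_P}{2}\right]\quad(a\in A),\] where (1) $c$ is an invertible element of $A$ such that $c^2\in k\oplus kz$; (2) $d_\emptyset=\mathrm{Id}_A$ and $d_P=d_{i_1}\cdots d_{i_s}$ (composition) for $P=\{i_1<\cdots<i_s\}$, where $d_i:A\to A$ is defined by $d_i(a)=u_ia-c^{-1}acu_i$ for elements $u_1,\ldots,u_n\in A$ such that $u_ic+cu_i=0$, $u_i^2\in k\oplus kz$ and $u_iu_j+u_ju_i\in k\oplus kz$ for all $i,j=1,\ldots,n$; or \[\rho(a)=\sum_{P\subseteq\{1,\ldots,n\}}(-1)^{\lfloor\frac{|P|+1}{2}\rfloor}\left[d_P(a)\otimes\frac{x_P+(-1)^{|P|}gx_P}{2}+\sigma(c^{-1}d_P(a)c)\otimes\frac{x_P+(-1)^{|P|+1}gx_P}{2}\right]\quad(a\in A),\]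 where (1) $c$ is an invertible element of $A$ such that $c\,\sigma(c)\in k\oplus kz$; (2) $d_\emptyset=\mathrm{Id}_A$ and $d_P=d_{i_1}\cdots d_{i_s}$ (composition) for $P=\{i_1<\cdots<i_s\}$, where $d_i:A\to A$ is defined by $d_i(a)=u_ia-\sigma(c^{-1}ac)u_i$ for elements $u_1,\ldots,u_n\in A$ such that $u_ic+c\sigma(u_i)=0$, $u_i^2\in k\oplus kz$ and $u_iu_j+u_ju_i\in k\oplus kz$ for all $i,j=1,\ldots,n$.
   Context: Algebras are associative and unital; $\otimes=\otimes_k$; $k$ is identified with $k1_A\subseteq A$. Given scalars $\alpha,\beta_i,\gamma_i\in k$ ($1\le i\le n$) and $\lambda_{ij}\in k$ ($1\le i<j\le n$), $Cl(\alpha,\beta_i,\gamma_i,\lambda_{ij})$ is the unital associative $k$-algebra generated by $G,X_1,\ldots,X_n$ with relations $G^2=\alpha$, $X_i^2=\beta_i$, $GX_i+X_iG=\gamma_i$, and $X_iX_j+X_jX_i=\lambda_{ij}$ for $i<j$. It has dimension $2^{n+1}$. The generating space $V=\mathrm{span}_k(G,X_1,\ldots,X_n)\subseteq A$ carries the quadratic form $q$ with $v^2=q(v)1_A$ for $v\in V$, with bilinear form $\beta_q(u,v)=q(u+v)-q(u)-q(v)$. Pseudoscalar: $z=e_1e_2\cdots e_{n+1}$, where $(e_1,\ldots,e_{n+1})$ is an orthogonal basis of $V$ with respect to $\beta_q$. Main involution: $A=A_0\oplus A_1$ is $\mathbb{Z}_2$-graded, with $A_0$ (resp. $A_1$) the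 span of products of an even (resp. odd) number of elements of $V$, and $\sigma:A\to A$ is $\sigma(t+s)=t-s$ for $t\in A_0$, $s\in A_1$. $E(n)$ is the $2^{n+1}$-dimensional Hopf algebra over $k$ generated by $g,x_1,\ldots,x_n$ with relations $g^2=1$, $x_i^2=0$, $gx_i=-x_ig$, $x_ix_j=-x_jx_i$, and with $\Delta(g)=g\otimes g$, $\Delta(x_i)=x_i\otimes g+1\otimes x_i$, $\varepsilon(g)=1$, $\varepsilon(x_i)=0$, $S(g)=g$, $S(x_i)=gx_i$. For $P=\{i_1<\cdots<i_s\}\subseteq\{1,\ldots,n\}$ put $x_P=x_{i_1}\cdots x_{i_s}$, with $x_\emptyset=1$. A right $H$-coaction on an algebra $A$ (a right $H$-comodule algebra structure) is a $k$-linear map $\rho:A\to A\otimes H$, $\rho(a)=a_0\otimes a_1$, making $A$ a right $H$-comodule and satisfying $\rho(ab)=a_0b_0\otimes a_1b_1$ and $\rho(1_A)=1_A\otimes 1_H$. *)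

theory Defs
  imports
    "HOL-Library.Function_Algebras"
    "HOL-Library.Poly_Mapping"
    "HOL-Computational_Algebra.Computational_Algebra"
begin

section \<open>Algebras over a field\<close>

locale k_algebra = vector_space scale
  for scale :: "'k::field \<Rightarrow> 'a::ring_1 \<Rightarrow> 'a" +
  assumes scale_mult_left: "scale c x * y = scale c (x * y)"
    and scale_mult_right: "x * scale c y = scale c (x * y)"

definition left_ideal :: "'a::ring_1 set \<Rightarrow> bool" where
  "left_ideal I \<longleftrightarrow>
     0 \<in> I \<and> (\<forall>x\<in>I. \<forall>y\<in>I. x + y \<in> I) \<and> (\<forall>r. \<forall>x\<in>I. r * x \<in> I)"

text \<open>A ring is semisimple when it is a semisimple left module over itself, i.e.\ when every left
  ideal is a direct summand.\<close>

definition semisimple_ring :: "'a::ring_1 itself \<Rightarrow> bool" where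
  "semisimple_ring _ \<longleftrightarrow>
     (\<forall>I::'a set. left_ideal I \<longrightarrow>
        (\<exists>J. left_ideal J \<and> I \<inter> J = {0} \<and> (\<forall>a. \<exists>x\<in>I. \<exists>y\<in>J. a = x + y)))"


section \<open>Algebras given by generators and relations\<close>

text \<open>Words form the free monoid, written additively so that finitely supported functions
  \<open>'x word \<Rightarrow>\<^sub>0 'k\<close> with their convolution product are the free associative unital algebra on
  the letters \<open>'x\<close>.\<close>

datatype 'x word = Word (letters: "'x list")

instantiation word :: (type) monoid_add
begin
definition zero_word :: "'a word" where "zero_word = Word []"
definition plus_word :: "'a word \<Rightarrow> 'a word \<Rightarrow> 'a word" where
  "plus_word v w = Word (letters v @ letters w)"
instance by standard (simp_all add: zero_word_def plus_word_def)
end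

definition letter :: "'x \<Rightarrow> ('x word \<Rightarrow>\<^sub>0 'k::field)" where
  "letter i = Poly_Mapping.single (Word [i]) 1"

definition scalar :: "'k::field \<Rightarrow> ('x word \<Rightarrow>\<^sub>0 'k)" where
  "scalar c = Poly_Mapping.single 0 c"

definition free_algebra :: "'x set \<Rightarrow> ('x word \<Rightarrow>\<^sub>0 'k::field) set" where
  "free_algebra I = {p. \<forall>w\<in>Poly_Mapping.keys p. set (letters w) \<subseteq> I}"

inductive_set generated_ideal ::
  "'x set \<Rightarrow> ('x word \<Rightarrow>\<^sub>0 'k::field) set \<Rightarrow> ('x word \<Rightarrow>\<^sub>0 'k) set"
  for I R where
    zero: "0 \<in> generated_ideal I R"
  | relation: "r \<in> R \<Longrightarrow> r \<in> generated_ideal I R"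
  | add: "p \<in> generated_ideal I R \<Longrightarrow> p' \<in> generated_ideal I R \<Longrightarrow> p + p' \<in> generated_ideal I R"
  | mult_left: "f \<in> free_algebra I \<Longrightarrow> p \<in> generated_ideal I R \<Longrightarrow> f * p \<in> generated_ideal I R"
  | mult_right: "f \<in> free_algebra I \<Longrightarrow> p \<in> generated_ideal I R \<Longrightarrow> p * f \<in> generated_ideal I R"

definition evaluate ::
  "('k::field \<Rightarrow> 'a::ring_1 \<Rightarrow> 'a) \<Rightarrow> ('x \<Rightarrow> 'a) \<Rightarrow> ('x word \<Rightarrow>\<^sub>0 'k) \<Rightarrow> 'a" where
  "evaluate scale gen p =
     (\<Sum>w\<in>Poly_Mapping.keys p. scale (Poly_Mapping.lookup p w) (prod_list (map gen (letters w))))"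

text \<open>The algebra is (isomorphic, via the generators, to) the free algebra on \<open>I\<close> modulo the
  two-sided ideal generated by the relations \<open>R\<close>.\<close>

definition presented_by ::
  "('k::field \<Rightarrow> 'a::ring_1 \<Rightarrow> 'a) \<Rightarrow> ('x \<Rightarrow> 'a) \<Rightarrow> 'x set \<Rightarrow> ('x word \<Rightarrow>\<^sub>0 'k) set \<Rightarrow> bool" where
  "presented_by scale gen I R \<longleftrightarrow>
     k_algebra scale \<and>
     evaluate scale gen ` free_algebra I = UNIV \<and>
     {p \<in> free_algebra I. evaluate scale gen p = 0} = generated_ideal I R"

datatype generator = GenG | GenX nat

definition generators :: "nat \<Rightarrow> generator set" where
  "generators n = insert GenG (GenX ` {1..n})"


section \<open>Clifford algebras\<close>

definition clifford_relations ::
  "nat \<Rightarrow> 'k::field \<Rightarrow> (nat \<Rightarrow> 'k) \<Rightarrow> (nat \<Rightarrow> 'k) \<Rightarrow> (nat \<Rightarrow> nat \<Rightarrow> 'k) \<Rightarrow>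
     (generator word \<Rightarrow>\<^sub>0 'k) set" where
  "clifford_relations n \<alpha> \<beta> \<gamma> lam =
     (let G = letter GenG; X = (\<lambda>i. letter (GenX i)) in
       {G * G - scalar \<alpha>} \<union>
       {X i * X i - scalar (\<beta> i) | i. i \<in> {1..n}} \<union>
       {G * X i + X i * G - scalar (\<gamma> i) | i. i \<in> {1..n}} \<union>
       {X i * X j + X j * X i - scalar (lam i j) | i j. 1 \<le> i \<and> i < j \<and> j \<le> n})"

definition is_clifford_algebra ::
  "('k::field \<Rightarrow> 'a::ring_1 \<Rightarrow> 'a) \<Rightarrow> nat \<Rightarrow> 'k \<Rightarrow> (nat \<Rightarrow> 'k) \<Rightarrow> (nat \<Rightarrow> 'k) \<Rightarrow>
     (nat \<Rightarrow> nat \<Rightarrow> 'k) \<Rightarrow> 'a \<Rightarrow> (nat \<Rightarrow> 'a) \<Rightarrow> bool" where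
  "is_clifford_algebra scale n \<alpha> \<beta> \<gamma> lam G X \<longleftrightarrow>
     presented_by scale (case_generator G X) (generators n) (clifford_relations n \<alpha> \<beta> \<gamma> lam)"

definition generating_space ::
  "('k::field \<Rightarrow> 'a::ring_1 \<Rightarrow> 'a) \<Rightarrow> nat \<Rightarrow> 'a \<Rightarrow> (nat \<Rightarrow> 'a) \<Rightarrow> 'a set" where
  "generating_space scale n G X = module.span scale (insert G (X ` {1..n}))"

definition quad_form :: "('k::field \<Rightarrow> 'a::ring_1 \<Rightarrow> 'a) \<Rightarrow> 'a \<Rightarrow> 'k" where
  "quad_form scale v = (THE c. v * v = scale c 1)"

definition polar_form :: "('k::field \<Rightarrow> 'a::ring_1 \<Rightarrow> 'a) \<Rightarrow> 'a \<Rightarrow> 'a \<Rightarrow> 'k" where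
  "polar_form scale u v = quad_form scale (u + v) - quad_form scale u - quad_form scale v"

definition is_orthogonal_basis ::
  "('k::field \<Rightarrow> 'a::ring_1 \<Rightarrow> 'a) \<Rightarrow> 'a set \<Rightarrow> 'a list \<Rightarrow> bool" where
  "is_orthogonal_basis scale V es \<longleftrightarrow>
     distinct es \<and> \<not> module.dependent scale (set es) \<and> module.span scale (set es) = V \<and>
     (\<forall>i<length es. \<forall>j<length es. i \<noteq> j \<longrightarrow> polar_form scale (es ! i) (es ! j) = 0)"

definition is_pseudoscalar ::
  "('k::field \<Rightarrow> 'a::ring_1 \<Rightarrow> 'a) \<Rightarrow> 'a set \<Rightarrow> 'a \<Rightarrow> bool" where
  "is_pseudoscalar scale V z \<longleftrightarrow> (\<exists>es. is_orthogonal_basis scale V es \<and> z = prod_list es)"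

definition even_part :: "('k::field \<Rightarrow> 'a::ring_1 \<Rightarrow> 'a) \<Rightarrow> 'a set \<Rightarrow> 'a set" where
  "even_part scale V = module.span scale {prod_list vs | vs. set vs \<subseteq> V \<and> even (length vs)}"

definition odd_part :: "('k::field \<Rightarrow> 'a::ring_1 \<Rightarrow> 'a) \<Rightarrow> 'a set \<Rightarrow> 'a set" where
  "odd_part scale V = module.span scale {prod_list vs | vs. set vs \<subseteq> V \<and> odd (length vs)}"

definition main_involution :: "('k::field \<Rightarrow> 'a::ring_1 \<Rightarrow> 'a) \<Rightarrow> 'a set \<Rightarrow> 'a \<Rightarrow> 'a" where
  "main_involution scale V a =
     (THE b. \<exists>t\<in>even_part scale V. \<exists>s\<in>odd_part scale V. a = t + s \<and> b = t - s)"


section \<open>Tensor products\<close>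

text \<open>The tensor product of two vector spaces over \<open>'k\<close> is realised inside the dual of the space
  of bilinear forms: \<open>a \<otimes> b\<close> is evaluation of bilinear forms at \<open>(a, b)\<close>, and the tensor product is
  the span of these functionals.  The universal property is proved below
  (\<open>tensor_universal\<close>, \<open>tensor_linear_unique\<close>), so the choice of realisation is immaterial.\<close>

type_synonym ('a, 'b, 'k) tensor = "('a \<Rightarrow> 'b \<Rightarrow> 'k) \<Rightarrow> 'k"

definition is_bilinear ::
  "('k::field \<Rightarrow> 'a::ab_group_add \<Rightarrow> 'a) \<Rightarrow> ('k \<Rightarrow> 'b::ab_group_add \<Rightarrow> 'b) \<Rightarrow>
     ('k \<Rightarrow> 'c::ab_group_add \<Rightarrow> 'c) \<Rightarrow> ('a \<Rightarrow> 'b \<Rightarrow> 'c) \<Rightarrow> bool" where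
  "is_bilinear sA sB sC f \<longleftrightarrow>
     (\<forall>a. Vector_Spaces.linear sB sC (f a)) \<and> (\<forall>b. Vector_Spaces.linear sA sC (\<lambda>a. f a b))"

definition tensor_scale :: "'k::field \<Rightarrow> ('a, 'b, 'k) tensor \<Rightarrow> ('a, 'b, 'k) tensor" where
  "tensor_scale c t = (\<lambda>\<beta>. c * t \<beta>)"

definition tensor ::
  "('k::field \<Rightarrow> 'a::ab_group_add \<Rightarrow> 'a) \<Rightarrow> ('k \<Rightarrow> 'b::ab_group_add \<Rightarrow> 'b) \<Rightarrow>
     'a \<Rightarrow> 'b \<Rightarrow> ('a, 'b, 'k) tensor" where
  "tensor sA sB a b = (\<lambda>\<beta>. if is_bilinear sA sB (*) \<beta> then \<beta> a b else 0)"

definition tensor_space ::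
  "('k::field \<Rightarrow> 'a::ab_group_add \<Rightarrow> 'a) \<Rightarrow> ('k \<Rightarrow> 'b::ab_group_add \<Rightarrow> 'b) \<Rightarrow>
     ('a, 'b, 'k) tensor set" where
  "tensor_space sA sB = module.span tensor_scale {tensor sA sB a b | a b. True}"

text \<open>The linear map induced by a bilinear map \<open>f\<close>; only its values on \<open>tensor_space sA sB\<close>, where it
  is unique, are meaningful.\<close>

definition tensor_lift ::
  "('k::field \<Rightarrow> 'a::ab_group_add \<Rightarrow> 'a) \<Rightarrow> ('k \<Rightarrow> 'b::ab_group_add \<Rightarrow> 'b) \<Rightarrow>
     ('k \<Rightarrow> 'c::ab_group_add \<Rightarrow> 'c) \<Rightarrow> ('a \<Rightarrow> 'b \<Rightarrow> 'c) \<Rightarrow> ('a, 'b, 'k) tensor \<Rightarrow> 'c" where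
  "tensor_lift sA sB sC f =
     (SOME F. Vector_Spaces.linear tensor_scale sC F \<and> (\<forall>a b. F (tensor sA sB a b) = f a b))"

lemma vector_space_tensor_scale: "vector_space tensor_scale"
  by unfold_locales (auto simp: tensor_scale_def fun_eq_iff algebra_simps)

lemma vector_space_mult: "vector_space ((*) :: 'k::field \<Rightarrow> 'k \<Rightarrow> 'k)"
  by unfold_locales (auto simp: algebra_simps)

lemma is_bilinear_iff:
  assumes "vector_space sA" "vector_space sB" "vector_space sC"
  shows "is_bilinear sA sB sC f \<longleftrightarrow>
    (\<forall>a b b'. f a (b + b') = f a b + f a b') \<and> (\<forall>a r b. f a (sB r b) = sC r (f a b)) \<and>
    (\<forall>a a' b. f (a + a') b = f a b + f a' b) \<and> (\<forall>r a b. f (sA r a) b = sC r (f a b))"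
  using assms
  by (auto simp: is_bilinear_def Vector_Spaces.linear_def module_hom_def module_hom_axioms_def
      module_iff_vector_space)

lemma is_bilinear_tensor:
  assumes "vector_space sA" "vector_space sB"
  shows "is_bilinear sA sB tensor_scale (tensor sA sB)"
  unfolding is_bilinear_iff[OF assms vector_space_tensor_scale]
  by (auto simp: tensor_def tensor_scale_def fun_eq_iff
      is_bilinear_iff[OF assms vector_space_mult])

lemma tensor_universal:
  fixes sA :: "'k::field \<Rightarrow> 'a::ab_group_add \<Rightarrow> 'a" and sB :: "'k \<Rightarrow> 'b::ab_group_add \<Rightarrow> 'b"
    and sC :: "'k \<Rightarrow> 'c::ab_group_add \<Rightarrow> 'c"
  assumes A: "vector_space sA" and B: "vector_space sB" and C: "vector_space sC"
    and f: "is_bilinear sA sB sC f"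
  shows "\<exists>F. Vector_Spaces.linear tensor_scale sC F \<and> (\<forall>a b. F (tensor sA sB a b) = f a b)"
proof -
  let ?T = "tensor_scale :: 'k \<Rightarrow> ('a, 'b, 'k) tensor \<Rightarrow> ('a, 'b, 'k) tensor"
  let ?K = "(*) :: 'k \<Rightarrow> 'k \<Rightarrow> 'k"
  interpret C: vector_space sC by fact
  interpret T: vector_space ?T by (rule vector_space_tensor_scale)
  interpret K: vector_space ?K by (rule vector_space_mult)
  interpret TC: vector_space_pair ?T sC ..
  interpret TK: vector_space_pair ?T ?K ..
  interpret CK: vector_space_pair sC ?K ..
  define R where "R = {tensor sA sB a b | a b. True}"
  obtain S where S: "S \<subseteq> R" "T.independent S" "R \<subseteq> T.span S"
    by (rule T.maximal_independent_subset[of R])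
  define g where "g t = (SOME y. \<exists>a b. t = tensor sA sB a b \<and> y = f a b)" for t
  have g: "\<exists>a b. t = tensor sA sB a b \<and> g t = f a b" if "t \<in> R" for t
  proof -
    from that obtain a b where "t = tensor sA sB a b" unfolding R_def by blast
    then have "\<exists>y a b. t = tensor sA sB a b \<and> y = f a b" by blast
    then show ?thesis unfolding g_def by (rule someI_ex)
  qed
  define F where "F = TC.construct S g"
  have F: "Vector_Spaces.linear ?T sC F"
    unfolding F_def by (rule TC.linear_construct[OF S(2)])
  have FS: "F t = g t" if "t \<in> S" for t
    unfolding F_def by (rule TC.construct_basis[OF S(2) that])
  have bil: "is_bilinear sA sB ?K (\<lambda>a b. \<phi> (f a b))"
    if "Vector_Spaces.linear sC ?K \<phi>" for \<phi>
  proof -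
    interpret \<phi>: Vector_Spaces.linear sC ?K \<phi> by fact
    from f show ?thesis
      unfolding is_bilinear_iff[OF A B C] is_bilinear_iff[OF A B vector_space_mult]
      by (simp add: \<phi>.add \<phi>.scale)
  qed
  have eq: "\<phi> (F t) = t (\<lambda>a b. \<phi> (f a b))"
    if \<phi>: "Vector_Spaces.linear sC ?K \<phi>" and t: "t \<in> T.span S" for \<phi> t
  proof (rule TK.linear_eq_on[OF _ _ t])
    show "Vector_Spaces.linear ?T ?K (\<lambda>t. \<phi> (F t))"
      using Vector_Spaces.linear_compose[OF F \<phi>] by (simp add: o_def)
    show "Vector_Spaces.linear ?T ?K (\<lambda>t. t (\<lambda>a b. \<phi> (f a b)))"
      by unfold_locales (auto simp: tensor_scale_def)
  next
    fix t assume t: "t \<in> S"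
    with S(1) g obtain a b where "t = tensor sA sB a b" "g t = f a b" by blast
    then show "\<phi> (F t) = t (\<lambda>a b. \<phi> (f a b))"
      using FS[OF t] bil[OF \<phi>] by (simp add: tensor_def)
  qed
  have "F (tensor sA sB a b) = f a b" for a b
  proof (rule ccontr)
    assume neq: "F (tensor sA sB a b) \<noteq> f a b"
    define w where "w = F (tensor sA sB a b) - f a b"
    have "C.independent {w}" using neq by (simp add: w_def)
    then obtain \<phi> where \<phi>: "Vector_Spaces.linear sC ?K \<phi>" "\<phi> w = 1"
      using CK.linear_independent_extend[of "{w}" "\<lambda>_. 1"] by auto
    interpret \<phi>: Vector_Spaces.linear sC ?K \<phi> by fact
    have "tensor sA sB a b \<in> T.span S" using S(3) unfolding R_def by blast
    from eq[OF \<phi>(1) this] bil[OF \<phi>(1)] have "\<phi> (F (tensor sA sB a b)) = \<phi> (f a b)"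
      by (simp add: tensor_def)
    with \<phi>(2) show False by (simp add: w_def \<phi>.diff)
  qed
  with F show ?thesis by blast
qed

lemma tensor_linear_unique:
  assumes F: "Vector_Spaces.linear tensor_scale sC F"
    and F': "Vector_Spaces.linear tensor_scale sC F'"
    and eq: "\<And>a b. F (tensor sA sB a b) = F' (tensor sA sB a b)"
    and t: "t \<in> tensor_space sA sB"
  shows "F t = F' t"
proof -
  interpret F: Vector_Spaces.linear tensor_scale sC F by fact
  interpret vector_space_pair tensor_scale sC
    by (intro vector_space_pair.intro vector_space_tensor_scale F.vs2.vector_space_axioms)
  show ?thesis
    by (rule linear_eq_on[OF F F' t[unfolded tensor_space_def]]) (use eq in blast)
qed

lemma tensor_lift:
  assumes "vector_space sA" "vector_space sB" "vector_space sC" "is_bilinear sA sB sC f"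
  shows "Vector_Spaces.linear tensor_scale sC (tensor_lift sA sB sC f)"
    and "tensor_lift sA sB sC f (tensor sA sB a b) = f a b"
  using someI_ex[OF tensor_universal[OF assms]] unfolding tensor_lift_def by blast+

definition tensor_mult ::
  "('k::field \<Rightarrow> 'a::ring_1 \<Rightarrow> 'a) \<Rightarrow> ('k \<Rightarrow> 'b::ring_1 \<Rightarrow> 'b) \<Rightarrow>
     ('a, 'b, 'k) tensor \<Rightarrow> ('a, 'b, 'k) tensor \<Rightarrow> ('a, 'b, 'k) tensor" where
  "tensor_mult sA sB t t' =
     tensor_lift sA sB tensor_scale
       (\<lambda>a b. tensor_lift sA sB tensor_scale (\<lambda>a' b'. tensor sA sB (a * a') (b * b')) t') t"

text \<open>\<open>tensor_assoc sA sB sC a t\<close> is \<open>a \<otimes> t\<close>, for \<open>a\<close> in \<open>A\<close> and \<open>t\<close> in \<open>B \<otimes> C\<close>, seen as an element of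
  \<open>(A \<otimes> B) \<otimes> C\<close>.\<close>

definition tensor_assoc ::
  "('k::field \<Rightarrow> 'a::ab_group_add \<Rightarrow> 'a) \<Rightarrow> ('k \<Rightarrow> 'b::ab_group_add \<Rightarrow> 'b) \<Rightarrow>
     ('k \<Rightarrow> 'c::ab_group_add \<Rightarrow> 'c) \<Rightarrow>
     'a \<Rightarrow> ('b, 'c, 'k) tensor \<Rightarrow> (('a, 'b, 'k) tensor, 'c, 'k) tensor" where
  "tensor_assoc sA sB sC a =
     tensor_lift sB sC tensor_scale (\<lambda>b c. tensor tensor_scale sC (tensor sA sB a b) c)"

lemma tensor_lift_add:
  assumes V: "vector_space sA" "vector_space sB" "vector_space sC"
    and f: "is_bilinear sA sB sC f" and g: "is_bilinear sA sB sC g"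
    and t: "t \<in> tensor_space sA sB"
  shows "tensor_lift sA sB sC (\<lambda>a b. f a b + g a b) t =
    tensor_lift sA sB sC f t + tensor_lift sA sB sC g t"
proof -
  interpret C: vector_space sC by fact
  interpret P: vector_space_pair tensor_scale sC
    by (intro vector_space_pair.intro vector_space_tensor_scale V(3))
  have fg: "is_bilinear sA sB sC (\<lambda>a b. f a b + g a b)"
    using f g unfolding is_bilinear_iff[OF V] by (simp add: C.scale_right_distrib algebra_simps)
  show ?thesis
    by (rule tensor_linear_unique[OF tensor_lift(1)[OF V fg] _ _ t])
      (intro P.linear_compose_add tensor_lift(1)[OF V] f g,
       simp add: tensor_lift(2)[OF V] f g fg)
qed

lemma tensor_lift_scale:
  assumes V: "vector_space sA" "vector_space sB" "vector_space sC"
    and f: "is_bilinear sA sB sC f" and t: "t \<in> tensor_space sA sB"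
  shows "tensor_lift sA sB sC (\<lambda>a b. sC r (f a b)) t = sC r (tensor_lift sA sB sC f t)"
proof -
  interpret C: vector_space sC by fact
  interpret P: vector_space_pair tensor_scale sC
    by (intro vector_space_pair.intro vector_space_tensor_scale V(3))
  have rf: "is_bilinear sA sB sC (\<lambda>a b. sC r (f a b))"
    using f unfolding is_bilinear_iff[OF V] by (simp add: C.scale_right_distrib mult.commute)
  show ?thesis
    by (rule tensor_linear_unique[OF tensor_lift(1)[OF V rf] _ _ t])
      (intro P.linear_compose_scale_right tensor_lift(1)[OF V] f,
       simp add: tensor_lift(2)[OF V] f rf)
qed

lemma tensor_add_scale:
  assumes "vector_space sA" "vector_space sB"
  shows "tensor sA sB a (b + b') = tensor sA sB a b + tensor sA sB a b'"
    and "tensor sA sB (a + a') b = tensor sA sB a b + tensor sA sB a' b"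
    and "tensor sA sB a (sB r b) = tensor_scale r (tensor sA sB a b)"
    and "tensor sA sB (sA r a) b = tensor_scale r (tensor sA sB a b)"
  using is_bilinear_tensor[OF assms]
  unfolding is_bilinear_iff[OF assms vector_space_tensor_scale] by blast+

text \<open>\<open>tensor_lift\<close> is only ever used on bilinear maps; in particular \<open>tensor_mult\<close> is the usual
  product on \<open>A \<otimes> B\<close> and \<open>tensor_assoc\<close> the usual reassociation.\<close>

lemma
  fixes sA :: "'k::field \<Rightarrow> 'a::ring_1 \<Rightarrow> 'a" and sB :: "'k \<Rightarrow> 'b::ring_1 \<Rightarrow> 'b"
  assumes A: "k_algebra sA" and B: "k_algebra sB" and t': "t' \<in> tensor_space sA sB"
  shows linear_tensor_mult_left:
      "Vector_Spaces.linear tensor_scale tensor_scale (\<lambda>t. tensor_mult sA sB t t')"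
    and tensor_mult_tensor_left: "tensor_mult sA sB (tensor sA sB a b) t' =
      tensor_lift sA sB tensor_scale (\<lambda>a' b'. tensor sA sB (a * a') (b * b')) t'"
    and tensor_mult_tensor: "tensor_mult sA sB (tensor sA sB a b) (tensor sA sB a' b') =
      tensor sA sB (a * a') (b * b')"
proof -
  interpret A: k_algebra sA by fact
  interpret B: k_algebra sB by fact
  note T = vector_space_tensor_scale
  note V = A.vector_space_axioms B.vector_space_axioms
  note ts = tensor_add_scale[OF V]
  let ?f = "\<lambda>a b a' b'. tensor sA sB (a * a') (b * b')"
  have inner: "is_bilinear sA sB tensor_scale (?f a b)" for a b
    unfolding is_bilinear_iff[OF V T]
    by (simp add: distrib_left A.scale_mult_right B.scale_mult_right ts)
  have outer: "is_bilinear sA sB tensor_scale (\<lambda>a b. tensor_lift sA sB tensor_scale (?f a b) t')"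
    if t': "t' \<in> tensor_space sA sB" for t'
    unfolding is_bilinear_iff[OF V T]
    by (simp add: distrib_right A.scale_mult_left B.scale_mult_left ts inner
        tensor_lift_add[OF V T inner inner t'] tensor_lift_scale[OF V T inner t'])
  have mem: "tensor sA sB a' b' \<in> tensor_space sA sB" for a' b'
  proof -
    interpret vector_space "tensor_scale :: 'k \<Rightarrow> ('a, 'b, 'k) tensor \<Rightarrow> _" by (rule T)
    show ?thesis unfolding tensor_space_def by (rule span_base) blast
  qed
  show "Vector_Spaces.linear tensor_scale tensor_scale (\<lambda>t. tensor_mult sA sB t t')"
    unfolding tensor_mult_def by (rule tensor_lift(1)[OF V T outer[OF t']])
  have right: "tensor_mult sA sB (tensor sA sB a b) t = tensor_lift sA sB tensor_scale (?f a b) t"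
    if "t \<in> tensor_space sA sB" for t
    unfolding tensor_mult_def by (rule tensor_lift(2)[OF V T outer[OF that]])
  show "tensor_mult sA sB (tensor sA sB a b) t' = tensor_lift sA sB tensor_scale (?f a b) t'"
    by (rule right[OF t'])
  show "tensor_mult sA sB (tensor sA sB a b) (tensor sA sB a' b') = ?f a b a' b'"
    unfolding right[OF mem] by (rule tensor_lift(2)[OF V T inner])
qed

lemma
  assumes A: "vector_space sA" and B: "vector_space sB" and C: "vector_space sC"
  shows linear_tensor_assoc_right:
      "Vector_Spaces.linear tensor_scale tensor_scale (tensor_assoc sA sB sC a)"
    and tensor_assoc_tensor: "tensor_assoc sA sB sC a (tensor sB sC b c) =
      tensor tensor_scale sC (tensor sA sB a b) c"
    and linear_tensor_assoc_left: "t \<in> tensor_space sB sC \<Longrightarrow>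
      Vector_Spaces.linear sA tensor_scale (\<lambda>a. tensor_assoc sA sB sC a t)"
proof -
  note T = vector_space_tensor_scale
  let ?f = "\<lambda>a b c. tensor tensor_scale sC (tensor sA sB a b) c"
  note ts = tensor_add_scale[OF A B] tensor_add_scale[OF T C]
  have bil: "is_bilinear sB sC tensor_scale (?f a)" for a
    unfolding is_bilinear_iff[OF B C T] by (simp add: ts)
  show "Vector_Spaces.linear tensor_scale tensor_scale (tensor_assoc sA sB sC a)"
    unfolding tensor_assoc_def by (rule tensor_lift(1)[OF B C T bil])
  show "tensor_assoc sA sB sC a (tensor sB sC b c) = ?f a b c"
    unfolding tensor_assoc_def by (rule tensor_lift(2)[OF B C T bil])
  show "Vector_Spaces.linear sA tensor_scale (\<lambda>a. tensor_assoc sA sB sC a t)"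
    if t: "t \<in> tensor_space sB sC"
  proof -
    have "tensor_assoc sA sB sC (a + a') t = tensor_assoc sA sB sC a t + tensor_assoc sA sB sC a' t"
      and "tensor_assoc sA sB sC (sA r a) t = tensor_scale r (tensor_assoc sA sB sC a t)" for a a' r
      using tensor_lift_add[OF B C T bil bil t] tensor_lift_scale[OF B C T bil t]
      by (simp_all add: tensor_assoc_def ts)
    then show ?thesis
      using A T by (simp add: Vector_Spaces.linear_def module_hom_def module_hom_axioms_def
          module_iff_vector_space)
  qed
qed


section \<open>Hopf algebras and comodule algebras\<close>

definition is_coassociative ::
  "('k::field \<Rightarrow> 'a::ab_group_add \<Rightarrow> 'a) \<Rightarrow> ('k \<Rightarrow> 'h::ab_group_add \<Rightarrow> 'h) \<Rightarrow>
     ('h \<Rightarrow> ('h, 'h, 'k) tensor) \<Rightarrow> ('a \<Rightarrow> ('a, 'h, 'k) tensor) \<Rightarrow> bool" where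
  "is_coassociative sA sH \<Delta> \<rho> \<longleftrightarrow>
     (\<forall>a. tensor_lift sA sH tensor_scale (\<lambda>b h. tensor tensor_scale sH (\<rho> b) h) (\<rho> a) =
          tensor_lift sA sH tensor_scale (\<lambda>b h. tensor_assoc sA sH sH b (\<Delta> h)) (\<rho> a))"

definition is_right_comodule ::
  "('k::field \<Rightarrow> 'a::ab_group_add \<Rightarrow> 'a) \<Rightarrow> ('k \<Rightarrow> 'h::ab_group_add \<Rightarrow> 'h) \<Rightarrow>
     ('h \<Rightarrow> ('h, 'h, 'k) tensor) \<Rightarrow> ('h \<Rightarrow> 'k) \<Rightarrow> ('a \<Rightarrow> ('a, 'h, 'k) tensor) \<Rightarrow> bool" where
  "is_right_comodule sA sH \<Delta> \<epsilon> \<rho> \<longleftrightarrow>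
     range \<rho> \<subseteq> tensor_space sA sH \<and>
     Vector_Spaces.linear sA tensor_scale \<rho> \<and>
     is_coassociative sA sH \<Delta> \<rho> \<and>
     (\<forall>a. tensor_lift sA sH sA (\<lambda>b h. sA (\<epsilon> h) b) (\<rho> a) = a)"

text \<open>For a Hopf algebra with comultiplication \<open>\<Delta>\<close> and counit \<open>\<epsilon>\<close>: right coactions on an algebra.\<close>

definition is_right_coaction ::
  "('k::field \<Rightarrow> 'a::ring_1 \<Rightarrow> 'a) \<Rightarrow> ('k \<Rightarrow> 'h::ring_1 \<Rightarrow> 'h) \<Rightarrow>
     ('h \<Rightarrow> ('h, 'h, 'k) tensor) \<Rightarrow> ('h \<Rightarrow> 'k) \<Rightarrow> ('a \<Rightarrow> ('a, 'h, 'k) tensor) \<Rightarrow> bool" where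
  "is_right_coaction sA sH \<Delta> \<epsilon> \<rho> \<longleftrightarrow>
     is_right_comodule sA sH \<Delta> \<epsilon> \<rho> \<and>
     (\<forall>a b. \<rho> (a * b) = tensor_mult sA sH (\<rho> a) (\<rho> b)) \<and>
     \<rho> 1 = tensor sA sH 1 1"

text \<open>A coalgebra is a right comodule over itself that is counital also on the left, and a bialgebra
  is a comodule algebra over itself via \<open>\<Delta>\<close>.\<close>

definition is_hopf_algebra ::
  "('k::field \<Rightarrow> 'h::ring_1 \<Rightarrow> 'h) \<Rightarrow> ('h \<Rightarrow> ('h, 'h, 'k) tensor) \<Rightarrow> ('h \<Rightarrow> 'k) \<Rightarrow>
     ('h \<Rightarrow> 'h) \<Rightarrow> bool" where
  "is_hopf_algebra sH \<Delta> \<epsilon> S \<longleftrightarrow>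
     k_algebra sH \<and>
     is_right_coaction sH sH \<Delta> \<epsilon> \<Delta> \<and>
     (\<forall>h. tensor_lift sH sH sH (\<lambda>h' h''. sH (\<epsilon> h') h'') (\<Delta> h) = h) \<and>
     Vector_Spaces.linear sH (*) \<epsilon> \<and> (\<forall>h h'. \<epsilon> (h * h') = \<epsilon> h * \<epsilon> h') \<and> \<epsilon> 1 = 1 \<and>
     Vector_Spaces.linear sH sH S \<and>
     (\<forall>h. tensor_lift sH sH sH (\<lambda>h' h''. S h' * h'') (\<Delta> h) = sH (\<epsilon> h) 1) \<and>
     (\<forall>h. tensor_lift sH sH sH (\<lambda>h' h''. h' * S h'') (\<Delta> h) = sH (\<epsilon> h) 1)"


section \<open>The Hopf algebra E(n)\<close>

definition E_relations :: "nat \<Rightarrow> (generator word \<Rightarrow>\<^sub>0 'k::field) set" where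
  "E_relations n =
     (let g = letter GenG; x = (\<lambda>i. letter (GenX i)) in
       {g * g - 1} \<union>
       {x i * x i | i. i \<in> {1..n}} \<union>
       {g * x i + x i * g | i. i \<in> {1..n}} \<union>
       {x i * x j + x j * x i | i j. i \<in> {1..n} \<and> j \<in> {1..n}})"

definition is_E ::
  "('k::field \<Rightarrow> 'h::ring_1 \<Rightarrow> 'h) \<Rightarrow> nat \<Rightarrow> 'h \<Rightarrow> (nat \<Rightarrow> 'h) \<Rightarrow>
     ('h \<Rightarrow> ('h, 'h, 'k) tensor) \<Rightarrow> ('h \<Rightarrow> 'k) \<Rightarrow> ('h \<Rightarrow> 'h) \<Rightarrow> bool" where
  "is_E sH n g x \<Delta> \<epsilon> S \<longleftrightarrow>
     presented_by sH (case_generator g x) (generators n) (E_relations n) \<and>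
     vector_space.dim sH UNIV = 2 ^ (n + 1) \<and>
     is_hopf_algebra sH \<Delta> \<epsilon> S \<and>
     \<Delta> g = tensor sH sH g g \<and> \<epsilon> g = 1 \<and> S g = g \<and>
     (\<forall>i\<in>{1..n}. \<Delta> (x i) = tensor sH sH (x i) g + tensor sH sH 1 (x i) \<and>
                  \<epsilon> (x i) = 0 \<and> S (x i) = g * x i)"

definition ordered_prod :: "(nat \<Rightarrow> 'h::ring_1) \<Rightarrow> nat set \<Rightarrow> 'h" where
  "ordered_prod x P = prod_list (map x (sorted_list_of_set P))"

definition ordered_comp :: "(nat \<Rightarrow> 'a \<Rightarrow> 'a) \<Rightarrow> nat set \<Rightarrow> 'a \<Rightarrow> 'a" where
  "ordered_comp d P = foldr (\<lambda>i f. d i \<circ> f) (sorted_list_of_set P) id"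

text \<open>The map
  \[ a \mapsto \sum_P (-1)^{\lfloor (|P|+1)/2 \rfloor} \Big[ d_P(a) \otimes \frac{x_P + (-1)^{|P|} g x_P}{2}
      + \varphi(d_P(a)) \otimes \frac{x_P + (-1)^{|P|+1} g x_P}{2} \Big]
      \quad\text{with } d_i(a) = u_i a - \varphi(a) u_i. \]\<close>

definition E_coaction_map ::
  "('k::field \<Rightarrow> 'a::ring_1 \<Rightarrow> 'a) \<Rightarrow> ('k \<Rightarrow> 'h::ring_1 \<Rightarrow> 'h) \<Rightarrow> nat \<Rightarrow> 'h \<Rightarrow> (nat \<Rightarrow> 'h) \<Rightarrow>
     ('a \<Rightarrow> 'a) \<Rightarrow> (nat \<Rightarrow> 'a) \<Rightarrow> 'a \<Rightarrow> ('a, 'h, 'k) tensor" where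
  "E_coaction_map sA sH n g x \<phi> u a =
     (\<Sum>P\<in>Pow {1..n}.
        let xP = ordered_prod x P;
            dPa = ordered_comp (\<lambda>i b. u i * b - \<phi> b * u i) P a
        in tensor_scale ((-1) ^ ((card P + 1) div 2))
             (tensor sA sH dPa (sH (1 / 2) (xP + (-1) ^ card P * (g * xP))) +
              tensor sA sH (\<phi> dPa) (sH (1 / 2) (xP + (-1) ^ (card P + 1) * (g * xP)))))"

end

theory Submission
  imports Defs
begin

text \<open>
  A coaction of \<open>H = E(n)\<close> on \<open>A\<close> is an action of the dual Hopf algebra, and the latter amounts to an
  involutive automorphism \<open>\<phi>\<close> of \<open>A\<close> and \<open>\<phi>\<close>-skew derivations \<open>d\<^sub>1, ..., d\<^sub>n\<close> that anticommute with
  \<open>\<phi>\<close> and with each other: \<open>\<phi> = (id \<otimes> \<gamma>)\<rho>\<close> and \<open>d\<^sub>i = (id \<otimes> \<xi>\<^sub>i)\<rho>\<close> for a character \<open>\<gamma>\<close> and skew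
  derivations \<open>\<xi>\<^sub>i\<close> of \<open>H\<close> into the field.  On \<open>H\<close> itself these functionals act on the left tensor
  factor of \<open>\<Delta>\<close> by an automorphism \<open>\<Gamma>\<close> and \<open>\<Gamma>\<close>-skew derivations \<open>R\<^sub>i\<close>.

  The bridge between the two descriptions is the notion of an invariant tensor \<open>t\<close> in \<open>A \<otimes> H\<close>, one
  with \<open>(\<phi> \<otimes> id)t = (id \<otimes> \<Gamma>)t\<close> and \<open>(d\<^sub>i \<otimes> id)t = (id \<otimes> R\<^sub>i)t\<close>.  Coassociativity makes
  every \<open>\<rho>(a)\<close> invariant.  The monomials \<open>x\<^sub>P\<close>, \<open>g x\<^sub>P\<close> give a Taylor formula in \<open>H\<close>
  (\<open>taylor_expansion\<close>) that recovers an element from the counits of its iterated \<open>R\<^sub>i\<close>-derivatives.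
  Hence an invariant \<open>t\<close> is determined by \<open>(id \<otimes> \<epsilon>)t\<close>, and it is the sum over \<open>P\<close> in the statement
  (\<open>invariant_eq_taylor\<close>); this proves that each coaction has the stated shape
  (\<open>coaction_skew_action\<close>).  Conversely a computation with signs shows that the sum is invariant
  (\<open>taylor_invariant\<close>).  Products of invariant tensors are invariant, and so are their images under
  the right coaction of \<open>H\<close>, so the uniqueness just mentioned gives multiplicativity and
  coassociativity of the sum without expanding it (\<open>skew_action_coaction\<close>).

  It remains to describe the pairs \<open>(\<phi>, d)\<close>.  Semisimplicity forces an orthogonal basis
  \<open>e\<^sub>1, ..., e\<^sub>m\<close> of \<open>V\<close> to consist of invertible elements, since \<open>e\<^sup>2 = 0\<close> would make \<open>A e\<close> a nonzero
  nilpotent ideal; the dimension of \<open>A\<close> forces \<open>m = n + 1\<close>, which is odd.  The operators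
  \<open>a \<mapsto> \<phi>(e\<^sub>i) a e\<^sub>i\<^sup>-\<^sup>1\<close> are commuting involutions, and averaging over them produces common fixed points.
  With this one device the centre of \<open>A\<close> is computed to be \<open>k \<oplus> k z\<close> (\<open>central_span\<close>), every
  \<open>\<phi>\<close>-skew derivation is found to be inner (\<open>skew_derivation_inner\<close>), and every automorphism fixing \<open>z\<close>
  is found to be a conjugation (\<open>skolem_noether\<close>).  As \<open>\<phi>\<close> is an involution, \<open>\<phi>(z) = z\<close> or
  \<open>\<phi>(z) = -z\<close>; in the second case \<open>\<sigma> \<phi>\<close> fixes \<open>z\<close>.  These are the two forms of the statement.  The
  elements \<open>u\<^sub>i\<close> with \<open>d\<^sub>i(a) = u\<^sub>i a - \<phi>(a) u\<^sub>i\<close> can be normalised to \<open>\<phi>(u\<^sub>i) = -u\<^sub>i\<close>, and then the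
  relations for \<open>\<phi>\<close> and \<open>d\<close> become the conditions on \<open>c\<close> and \<open>u\<close>.
\<close>

section \<open>Algebras given by generators and relations\<close>

definition algebra_hom ::
  "('k::field \<Rightarrow> 'a::ring_1 \<Rightarrow> 'a) \<Rightarrow> ('k \<Rightarrow> 'b::ring_1 \<Rightarrow> 'b) \<Rightarrow> ('a \<Rightarrow> 'b) \<Rightarrow> bool" where
  "algebra_hom sA sB f \<longleftrightarrow>
     (\<forall>a b. f (a + b) = f a + f b) \<and> (\<forall>r a. f (sA r a) = sB r (f a)) \<and>
     f 1 = 1 \<and> (\<forall>a b. f (a * b) = f a * f b)"

lemma algebra_homD:
  assumes "algebra_hom sA sB f"
  shows "f (a + b) = f a + f b" "f (sA r a) = sB r (f a)" "f 1 = 1" "f (a * b) = f a * f b"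
    "f 0 = 0" "f (- a) = - f a" "f (a - b) = f a - f b"
proof -
  show *: "f (a + b) = f a + f b" "f (sA r a) = sB r (f a)" "f 1 = 1" "f (a * b) = f a * f b"
    for a b r using assms by (auto simp: algebra_hom_def)
  show 0: "f 0 = 0" using *(1)[of 0 0] by simp
  show minus: "f (- a) = - f a" for a using *(1)[of a "- a"] 0 by (simp add: add_eq_0_iff)
  show "f (a - b) = f a - f b" using *(1)[of a "- b"] minus[of b] by simp
qed

lemma poly_mapping_sum_single:
  "(p :: 'x \<Rightarrow>\<^sub>0 'b::comm_monoid_add) =
    (\<Sum>w\<in>Poly_Mapping.keys p. Poly_Mapping.single w (Poly_Mapping.lookup p w))"
  by (rule poly_mapping_eqI) (simp add: lookup_sum lookup_single when_def in_keys_iff)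

lemma poly_mapping_single_induct [case_names zero add]:
  assumes "P 0"
    and "\<And>w (c::'b::comm_monoid_add) p. P p \<Longrightarrow> P (Poly_Mapping.single w c + p)"
  shows "P p"
proof -
  have "P (\<Sum>w\<in>W. Poly_Mapping.single w (f w))" if "finite W" for W and f :: "'a \<Rightarrow> 'b"
    using that by induction (simp_all add: assms)
  from this[OF finite_keys] show ?thesis
    by (subst poly_mapping_sum_single)
qed

context k_algebra
begin

lemma evaluate_superset:
  assumes "finite W" "Poly_Mapping.keys p \<subseteq> W"
  shows "evaluate scale gen p =
    (\<Sum>w\<in>W. scale (Poly_Mapping.lookup p w) (prod_list (map gen (letters w))))"
  unfolding evaluate_def
  by (rule sum.mono_neutral_left) (use assms in \<open>auto simp: in_keys_iff\<close>)

lemma evaluate_zero [simp]: "evaluate scale gen 0 = 0"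
  by (simp add: evaluate_def)

lemma evaluate_single [simp]:
  "evaluate scale gen (Poly_Mapping.single w c) = scale c (prod_list (map gen (letters w)))"
  by (simp add: evaluate_def)

lemma evaluate_add [simp]:
  "evaluate scale gen (p + q) = evaluate scale gen p + evaluate scale gen q"
proof -
  let ?W = "Poly_Mapping.keys p \<union> Poly_Mapping.keys q"
  have "Poly_Mapping.keys (p + q) \<subseteq> ?W" by (rule keys_add)
  then show ?thesis
    by (simp add: evaluate_superset[of ?W] lookup_add scale_left_distrib sum.distrib)
qed

lemma evaluate_mult [simp]:
  "evaluate scale gen (p * q) = evaluate scale gen p * evaluate scale gen q"
proof (induction p rule: poly_mapping_single_induct)
  case (add v c p)
  have "evaluate scale gen (Poly_Mapping.single v c * q) =
      evaluate scale gen (Poly_Mapping.single v c) * evaluate scale gen q"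
  proof (induction q rule: poly_mapping_single_induct)
    case (add w d q)
    then show ?case
      by (simp add: distrib_left mult_single plus_word_def scale_mult_left scale_mult_right)
  qed simp
  with add show ?case by (simp add: distrib_right)
qed simp

lemma evaluate_diff [simp]:
  "evaluate scale gen (p - q) = evaluate scale gen p - evaluate scale gen q"
  using evaluate_add[of gen "p - q" q] by (simp add: algebra_simps)

lemma evaluate_letter [simp]: "evaluate scale gen (letter i) = gen i"
  by (simp add: letter_def)

lemma evaluate_scalar [simp]: "evaluate scale gen (scalar c) = scale c 1"
  by (simp add: scalar_def zero_word_def)

lemma evaluate_one [simp]: "evaluate scale gen 1 = 1"
  using evaluate_scalar[of gen 1] by (simp add: scalar_def)

lemma evaluate_generated_ideal:
  assumes "p \<in> generated_ideal I R" "\<And>r. r \<in> R \<Longrightarrow> evaluate scale gen r = 0"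
  shows "evaluate scale gen p = 0"
  using assms(1) by induction (auto simp: assms(2))

end

lemma free_algebra_closed:
  "scalar c \<in> free_algebra I"
  "i \<in> I \<Longrightarrow> letter i \<in> free_algebra I"
  "p \<in> free_algebra I \<Longrightarrow> q \<in> free_algebra I \<Longrightarrow> p + q \<in> free_algebra I"
  "p \<in> free_algebra I \<Longrightarrow> q \<in> free_algebra I \<Longrightarrow> p - q \<in> free_algebra I"
  "p \<in> free_algebra I \<Longrightarrow> q \<in> free_algebra I \<Longrightarrow> p * q \<in> free_algebra I"
proof -
  show "scalar c \<in> free_algebra I"
    by (auto simp: free_algebra_def scalar_def zero_word_def keys_single split: if_splits)
  show "i \<in> I \<Longrightarrow> letter i \<in> free_algebra I"
    by (auto simp: free_algebra_def letter_def keys_single)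
  show "p + q \<in> free_algebra I" if "p \<in> free_algebra I" "q \<in> free_algebra I"
    using that keys_add[of p q] by (auto simp: free_algebra_def)
  show "p - q \<in> free_algebra I" if "p \<in> free_algebra I" "q \<in> free_algebra I"
    using that keys_diff[of p q] by (auto simp: free_algebra_def)
  show "p * q \<in> free_algebra I" if "p \<in> free_algebra I" "q \<in> free_algebra I"
  proof -
    have "set (letters w) \<subseteq> I" if w: "w \<in> Poly_Mapping.keys (p * q)" for w
    proof -
      from w keys_mult[of p q] obtain a b where "w = a + b"
        "a \<in> Poly_Mapping.keys p" "b \<in> Poly_Mapping.keys q" by blast
      with \<open>p \<in> _\<close> \<open>q \<in> _\<close> show ?thesis by (auto simp: free_algebra_def plus_word_def)
    qed
    then show ?thesis by (auto simp: free_algebra_def)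
  qed
qed

lemma presented_induct:
  assumes pres: "presented_by scale gen I R"
    and one: "P 1" and add: "\<And>a b. P a \<Longrightarrow> P b \<Longrightarrow> P (a + b)"
    and scale: "\<And>c a. P a \<Longrightarrow> P (scale c a)"
    and gen: "\<And>i a. i \<in> I \<Longrightarrow> P a \<Longrightarrow> P (gen i * a)"
  shows "P a"
proof -
  interpret k_algebra scale using pres by (simp add: presented_by_def)
  from pres have "a \<in> evaluate scale gen ` free_algebra I" by (simp add: presented_by_def)
  then obtain p where a: "a = evaluate scale gen p" and p: "p \<in> free_algebra I" by blast
  have "P 0" using scale[OF one, of 0] by simp
  have "P (prod_list (map gen ws))" if "set ws \<subseteq> I" for ws
    using that by (induction ws) (auto intro: one gen)
  then have mono: "P (scale c (prod_list (map gen (letters w))))" if "w \<in> Poly_Mapping.keys p" for w c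
    using p that by (intro scale) (auto simp: free_algebra_def)
  have "P (\<Sum>w\<in>W. scale (Poly_Mapping.lookup p w) (prod_list (map gen (letters w))))"
    if "W \<subseteq> Poly_Mapping.keys p" for W
    using finite_subset[OF that finite_keys] that
    by (induction rule: finite_induct) (auto intro: add mono \<open>P 0\<close>)
  then show ?thesis unfolding a evaluate_def by blast
qed

lemma presented_relations:
  assumes "presented_by scale gen I R" "r \<in> R"
  shows "evaluate scale gen r = 0"
  using assms generated_ideal.relation[of r R I] unfolding presented_by_def by blast

text \<open>The universal property of a presented algebra: evaluation at the new generators kills the relations,
  hence the ideal they generate, which is the kernel of evaluation at the old ones.\<close>

lemma presented_lift:
  fixes sA :: "'k::field \<Rightarrow> 'a::ring_1 \<Rightarrow> 'a" and sB :: "'k \<Rightarrow> 'b::ring_1 \<Rightarrow> 'b"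
  assumes pres: "presented_by sA gen I R" and B: "k_algebra sB"
    and rel: "\<And>r. r \<in> R \<Longrightarrow> evaluate sB gen' r = 0"
  shows "\<exists>f. algebra_hom sA sB f \<and> (\<forall>i\<in>I. f (gen i) = gen' i)"
proof -
  interpret A: k_algebra sA using pres by (simp add: presented_by_def)
  interpret B: k_algebra sB by fact
  note free = free_algebra_closed
  define f where
    "f a = evaluate sB gen' (SOME p. p \<in> free_algebra I \<and> evaluate sA gen p = a)" for a
  have f: "f (evaluate sA gen p) = evaluate sB gen' p" if p: "p \<in> free_algebra I" for p
  proof -
    define q where
      "q = (SOME q. q \<in> free_algebra I \<and> evaluate sA gen q = evaluate sA gen p)"
    have q: "q \<in> free_algebra I \<and> evaluate sA gen q = evaluate sA gen p"
      unfolding q_def by (rule someI[of _ p]) (simp add: p)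
    have "q - p \<in> {p \<in> free_algebra I. evaluate sA gen p = 0}"
      using p q by (simp add: free)
    then have "q - p \<in> generated_ideal I R" using pres unfolding presented_by_def by blast
    from B.evaluate_generated_ideal[OF this rel] show ?thesis by (simp add: f_def q_def)
  qed
  have ex: "\<exists>p\<in>free_algebra I. evaluate sA gen p = a" for a
  proof -
    have "a \<in> evaluate sA gen ` free_algebra I" using pres by (simp add: presented_by_def)
    then show ?thesis by blast
  qed
  have "f (a + b) = f a + f b" "f (a * b) = f a * f b" for a b
  proof -
    obtain p q where pq: "p \<in> free_algebra I" "evaluate sA gen p = a"
      "q \<in> free_algebra I" "evaluate sA gen q = b" using ex by blast
    show "f (a + b) = f a + f b" "f (a * b) = f a * f b"
      using f[of p] f[of q] f[of "p + q"] f[of "p * q"] pq by (simp_all add: free)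
  qed
  moreover have "f (sA c a) = sB c (f a)" for c a
  proof -
    obtain p where p: "p \<in> free_algebra I" "evaluate sA gen p = a" using ex by blast
    show ?thesis
      using f[of p] f[of "scalar c * p"] p
      by (simp add: free A.scale_mult_left B.scale_mult_left)
  qed
  moreover have "f 1 = 1"
    using f[of "scalar 1"] by (simp add: free)
  moreover have "f (gen i) = gen' i" if "i \<in> I" for i
    using f[of "letter i"] that by (simp add: free)
  ultimately show ?thesis unfolding algebra_hom_def by blast
qed

section \<open>Averaging over commuting involutions\<close>

context k_algebra
begin

lemma span_mult:
  assumes "t \<in> span B" "subspace U"
  shows "(\<And>b. b \<in> B \<Longrightarrow> a * b \<in> U) \<Longrightarrow> a * t \<in> U"
    and "(\<And>b. b \<in> B \<Longrightarrow> b * a \<in> U) \<Longrightarrow> t * a \<in> U"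
proof -
  show "a * t \<in> U" if "\<And>b. b \<in> B \<Longrightarrow> a * b \<in> U"
    using assms(1)
    by (induction rule: span_induct_alt)
      (simp_all add: that assms(2) distrib_left scale_mult_right subspace_0 subspace_add subspace_scale)
  show "t * a \<in> U" if "\<And>b. b \<in> B \<Longrightarrow> b * a \<in> U"
    using assms(1)
    by (induction rule: span_induct_alt)
      (simp_all add: that assms(2) distrib_right scale_mult_left subspace_0 subspace_add subspace_scale)
qed

text \<open>If \<open>T e\<close> were the generators of an elementary abelian \<open>2\<close>-group acting linearly, this would be the mean
  over the group, i.e. the product of the operators \<open>(1 + T e) / 2\<close>.  The recursive form also makes
  sense for affine operators, which is how skew derivations are treated below.\<close>

fun average :: "('e \<Rightarrow> 'a \<Rightarrow> 'a) \<Rightarrow> 'e list \<Rightarrow> 'a \<Rightarrow> 'a" where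
  "average T [] y = y"
| "average T (e # L) y = scale (1 / 2) (average T L y + T e (average T L y))"

lemma half_double: "(2::'k) \<noteq> 0 \<Longrightarrow> scale (1 / 2) (a + a) = a"
  by (simp flip: scale_left_distrib add: scale_right_distrib)

text \<open>\<open>T e\<close> swaps the two points of which the step for \<open>e\<close> takes the midpoint, and it commutes with the
  steps for the other operators.\<close>

lemma average_fixed:
  assumes affine: "\<And>e x y. e \<in> set L \<Longrightarrow>
      T e (scale (1 / 2) (x + y)) = scale (1 / 2) (T e x + T e y)"
    and commute: "\<And>e f x. e \<in> set L \<Longrightarrow> f \<in> set L \<Longrightarrow> T e (T f x) = T f (T e x)"
    and involution: "\<And>e x. e \<in> set L \<Longrightarrow> T e (T e x) = x"
    and e: "e \<in> set L"
  shows "T e (average T L y) = average T L y"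
  using assms
proof (induction L)
  case (Cons f L)
  show ?case
  proof (cases "e \<in> set L")
    case True
    then have "T e (average T L y) = average T L y" using Cons.IH Cons.prems by simp
    moreover from this have "T e (T f (average T L y)) = T f (average T L y)"
      using True Cons.prems(2)[of e f] by simp
    ultimately show ?thesis using True Cons.prems(1) by simp
  next
    case False
    then show ?thesis using Cons.prems by (simp add: add.commute)
  qed
qed simp

lemma average_fixed_point:
  assumes "(2::'k) \<noteq> 0" "\<And>e. e \<in> set L \<Longrightarrow> T e y = y"
  shows "average T L y = y"
  using assms(2) by (induction L) (simp_all add: half_double[OF assms(1)])

lemma average_linear:
  assumes "\<And>e x y. T e (x + y) = T e x + T e y" "\<And>e r x. T e (scale r x) = scale r (T e x)"
  shows "average T L (x + y) = average T L x + average T L y"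
    and "average T L (scale r x) = scale r (average T L x)"
  by (induction L) (simp_all add: assms scale_right_distrib algebra_simps)

lemma average_intertwine:
  assumes "\<And>e x. e \<in> set L \<Longrightarrow> T e (F x) = F (T' e x)"
    and "\<And>x y. F (x + y) = F x + F y" "\<And>r x. F (scale r x) = scale r (F x)"
  shows "average T L (F y) = F (average T' L y)"
  using assms(1) by (induction L) (simp_all add: assms(2,3))

text \<open>On a common eigenvector the average acts by the product of the numbers \<open>(1 + c) / 2\<close>, one of which
  vanishes as soon as one eigenvalue \<open>c\<close> is \<open>-1\<close>.\<close>

lemma average_eigenvector_zero:
  assumes T0: "\<And>e. e \<in> set L \<Longrightarrow> T e 0 = 0"
    and lin: "\<And>e r x. e \<in> set L \<Longrightarrow> T e (scale r x) = scale r (T e x)"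
    and eig: "\<And>e. e \<in> set L \<Longrightarrow> \<exists>c. T e y = scale c y"
    and e: "e \<in> set L" "T e y = - y"
  shows "average T L y = 0"
proof -
  have ex: "\<exists>c. average T K y = scale c y" if "set K \<subseteq> set L" for K
    using that
  proof (induction K)
    case Nil
    show ?case by (metis average.simps(1) scale_one)
  next
    case (Cons f K)
    then obtain c where "average T K y = scale c y" by auto
    moreover obtain b where "T f y = scale b y" using eig Cons.prems by auto
    ultimately have "average T (f # K) y = scale (1 / 2 * (c + c * b)) y"
      using lin Cons.prems by (simp add: scale_right_distrib scale_left_distrib distrib_left)
    then show ?case by blast
  qed
  have "average T K y = 0" if "e \<in> set K" "set K \<subseteq> set L" for K
    using that
  proof (induction K)
    case (Cons f K)
    show ?case
    proof (cases "e \<in> set K")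
      case True
      then show ?thesis using Cons T0 by simp
    next
      case False
      then have "f = e" using Cons.prems by simp
      moreover obtain c where "average T K y = scale c y" using ex[of K] Cons.prems by auto
      ultimately show ?thesis using lin e by simp
    qed
  qed simp
  then show ?thesis using e(1) by blast
qed

definition central :: "'a \<Rightarrow> bool" where "central a \<longleftrightarrow> (\<forall>b. a * b = b * a)"

lemma central_closed:
  "central 1" "central a \<Longrightarrow> central b \<Longrightarrow> central (a + b)" "central a \<Longrightarrow> central (scale r a)"
  by (simp_all add: central_def scale_mult_left scale_mult_right distrib_left distrib_right)

end

section \<open>Clifford algebras with an orthogonal basis\<close>

text \<open>The generators \<open>es\<close> stand for an orthogonal basis of the generating space.  The assumption
  \<open>generated\<close> says that left multiplications by them produce the whole algebra from \<open>1\<close>.\<close>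

locale clifford_generators = k_algebra scale
  for scale :: "'k::field \<Rightarrow> 'a::ring_1 \<Rightarrow> 'a" +
  fixes es :: "'a list" and q :: "'a \<Rightarrow> 'k"
  assumes two: "(2::'k) \<noteq> 0"
    and distinct: "distinct es"
    and anticommute: "e \<in> set es \<Longrightarrow> f \<in> set es \<Longrightarrow> e \<noteq> f \<Longrightarrow> e * f = - (f * e)"
    and square: "e \<in> set es \<Longrightarrow> e * e = scale (q e) 1"
    and generated: "1 \<in> U \<Longrightarrow> subspace U \<Longrightarrow> (\<And>e a. e \<in> set es \<Longrightarrow> a \<in> U \<Longrightarrow> e * a \<in> U) \<Longrightarrow> a \<in> U"
begin

lemma induct [case_names one add scale mult]:
  assumes "P 1" "\<And>a b. P a \<Longrightarrow> P b \<Longrightarrow> P (a + b)" "\<And>r a. P a \<Longrightarrow> P (scale r a)"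
    "\<And>e a. e \<in> set es \<Longrightarrow> P a \<Longrightarrow> P (e * a)"
  shows "P a"
proof -
  have "P 0" using assms(3)[OF assms(1), of 0] by simp
  then have "subspace {a. P a}" by (auto intro: subspaceI simp: assms)
  then have "a \<in> {a. P a}" by (rule generated[rotated]) (auto simp: assms)
  then show ?thesis by simp
qed

lemma anticommute_prod_list:
  assumes "e \<in> set es" "set s \<subseteq> set es"
  shows "e * prod_list s = scale (\<Prod>f\<leftarrow>s. if f = e then 1 else - 1) (prod_list s * e)"
  using assms(2)
proof (induction s)
  case (Cons f s)
  have "e * (f * prod_list s) = scale (if f = e then 1 else - 1) (f * (e * prod_list s))"
    using anticommute[of e f] assms(1) Cons.prems
    by (auto simp flip: mult.assoc)
  with Cons show ?case by (simp add: scale_mult_right scale_left_commute mult.assoc)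
qed simp

lemma sign_notin: "e \<notin> set s \<Longrightarrow> (\<Prod>f\<leftarrow>s. if f = e then 1 else - 1 :: 'k) = (- 1) ^ length s"
  by (induction s) auto

lemma sign_in:
  "distinct s \<Longrightarrow> e \<in> set s \<Longrightarrow> (\<Prod>f\<leftarrow>s. if f = e then 1 else - 1 :: 'k) = - ((- 1) ^ length s)"
  by (induction s) (auto simp: sign_notin)

text \<open>Left multiplication by a generator maps an ordered product of distinct generators to a multiple of
  such a product: move the generator to its place, and use \<open>square\<close> if it is already there.\<close>

lemma monomials_span: "a \<in> span (prod_list ` set (subseqs es))"
proof -
  define B where "B L = span (prod_list ` set (subseqs L))" for L :: "'a list"
  have BC: "a * b \<in> B (a # L)" "b \<in> B (a # L)" if "b \<in> B L" for a b L
  proof -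
    show "b \<in> B (a # L)"
      using span_mono[of "prod_list ` set (subseqs L)" "prod_list ` set (subseqs (a # L))"] that
      by (auto simp: B_def Let_def)
    have "a * prod_list s \<in> B (a # L)" if "s \<in> set (subseqs L)" for s
      unfolding B_def
      by (rule span_base, rule image_eqI[of _ _ "a # s"]) (use that in \<open>simp_all add: Let_def\<close>)
    then have "a * m \<in> B (a # L)" if "m \<in> prod_list ` set (subseqs L)" for m
      using that by blast
    with that show "a * b \<in> B (a # L)"
      unfolding B_def by (rule span_mult(1)[OF _ subspace_span])
  qed
  have split: "\<exists>x\<in>B L. \<exists>y\<in>B L. b = x + a * y" if "b \<in> B (a # L)" for a b L
    using that unfolding B_def
  proof (induction rule: span_induct_alt)
    case base
    show ?case by (intro bexI[of _ 0]) (auto simp: span_zero)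
  next
    case (step c m b)
    then obtain x y where xy: "x \<in> span (prod_list ` set (subseqs L))"
      "y \<in> span (prod_list ` set (subseqs L))" "b = x + a * y" by blast
    from step(1) consider s where "s \<in> set (subseqs L)" "m = a * prod_list s"
      | s where "s \<in> set (subseqs L)" "m = prod_list s" by (auto simp: Let_def)
    then show ?case
    proof cases
      case 1
      show ?thesis
        by (rule bexI[of _ x], rule bexI[of _ "scale c (prod_list s) + y"])
          (use 1 xy in \<open>auto simp: distrib_left scale_mult_right intro!: span_add[OF span_scale[OF span_base]]\<close>)
    next
      case 2
      show ?thesis
        by (rule bexI[of _ "scale c (prod_list s) + x"], rule bexI[of _ y])
          (use 2 xy in \<open>auto intro!: span_add[OF span_scale[OF span_base]]\<close>)
    qed
  qed
  have B_mult: "e * b \<in> B L" if "e \<in> set L" "set L \<subseteq> set es" "b \<in> B L" for e b L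
    using that
  proof (induction L arbitrary: b)
    case (Cons a L)
    from split[OF Cons.prems(3)] obtain x y where xy: "x \<in> B L" "y \<in> B L" "b = x + a * y" by blast
    show ?case
    proof (cases "e = a")
      case True
      have "e * b = a * x + scale (q a) y"
        using xy True Cons.prems square[of a]
        by (simp add: distrib_left scale_mult_left flip: mult.assoc)
      then show ?thesis
        using BC[OF xy(1), of a] BC[OF xy(2), of a]
        unfolding B_def by (simp add: span_add span_scale)
    next
      case False
      then have "e * b = e * x - a * (e * y)"
        using xy Cons.prems anticommute[of e a] subsetD[of "set L" "set es" e]
        by (simp add: distrib_left flip: mult.assoc)
      moreover have "e * x \<in> B L" "e * y \<in> B L" using Cons xy False by auto
      ultimately show ?thesis using BC[of _ L a] unfolding B_def by (simp add: span_diff)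
    qed
  qed simp
  have "[] \<in> set (subseqs L)" for L :: "'a list" by (induction L) (auto simp: Let_def)
  then have one: "1 \<in> B es" unfolding B_def by (metis prod_list.Nil image_eqI span_base)
  show ?thesis
    unfolding B_def[symmetric]
  proof (induction a rule: induct)
    case one show ?case by fact
  next
    case (mult e a) then show ?case by (intro B_mult) auto
  qed (auto simp: B_def span_add span_scale)
qed

lemma subseqs_full: "s \<in> set (subseqs L) \<Longrightarrow> length s \<le> length L \<and> (length s = length L \<longrightarrow> s = L)"
  by (induction L arbitrary: s) (auto simp: Let_def, fastforce+)

end

locale nondegenerate_clifford = clifford_generators scale es q
  for scale :: "'k::field \<Rightarrow> 'a::ring_1 \<Rightarrow> 'a" and es :: "'a list" and q :: "'a \<Rightarrow> 'k" +
  assumes q_nonzero: "e \<in> set es \<Longrightarrow> q e \<noteq> 0"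
begin

definition recip :: "'a \<Rightarrow> 'a" where "recip e = scale (inverse (q e)) e"

lemma recip: "e \<in> set es \<Longrightarrow> e * recip e = 1" "e \<in> set es \<Longrightarrow> recip e * e = 1"
  by (simp_all add: recip_def scale_mult_right scale_mult_left square q_nonzero)

lemma recip2: "e \<in> set es \<Longrightarrow> e * (recip e * a) = a" "e \<in> set es \<Longrightarrow> recip e * (e * a) = a"
  by (metis recip mult.assoc mult_1)+

lemma anticommute_recip:
  assumes "e \<in> set es" "f \<in> set es" "e \<noteq> f"
  shows "recip e * recip f = - (recip f * recip e)" "e * recip f = - (recip f * e)"
  using anticommute[OF assms]
  by (simp_all add: recip_def scale_mult_left scale_mult_right scale_left_commute)

lemma prod_list_invertible:
  assumes "set L \<subseteq> set es"
  shows "\<exists>r. prod_list L * r = 1 \<and> r * prod_list L = 1"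
  using assms
proof (induction L)
  case (Cons e L)
  then obtain r where "prod_list L * r = 1" "r * prod_list L = 1" by auto
  then have "prod_list (e # L) * (r * recip e) = 1 \<and> (r * recip e) * prod_list (e # L) = 1"
    using Cons.prems recip2[of e] recip[of e]
    by (auto simp: mult.assoc) (metis mult.assoc mult_1)
  then show ?case by blast
qed (auto intro: exI[of _ 1])

end

section \<open>Clifford algebras in an odd number of generators\<close>

locale odd_clifford = nondegenerate_clifford scale es q
  for scale :: "'k::field \<Rightarrow> 'a::ring_1 \<Rightarrow> 'a" and es :: "'a list" and q :: "'a \<Rightarrow> 'k" +
  assumes odd: "odd (length es)"
    and pseudoscalar_nonscalar: "prod_list es \<noteq> scale c 1"
begin

abbreviation "z \<equiv> prod_list es"

text \<open>Moving \<open>e\<close> through \<open>z\<close> costs a sign for each of the other generators, and these are even in number.\<close>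

lemma central_pseudoscalar: "central z"
  unfolding central_def
proof
  fix a show "z * a = a * z"
  proof (induction a rule: induct)
    case (mult e a)
    have "e * z = z * e"
      using anticommute_prod_list[OF mult(1) order_refl] sign_in[OF distinct mult(1)] odd by simp
    with mult show ?case by (metis mult.assoc)
  qed (simp_all add: distrib_left distrib_right scale_mult_left scale_mult_right)
qed

text \<open>The average of \<open>a \<mapsto> e a e\<^sup>-\<^sup>1\<close> over the generators fixes central elements.  It kills every monomial
  except \<open>1\<close> and \<open>z\<close>: a generator that occurs in the monomial and one that does not occur in it commute
  with it up to opposite signs, so one of the two signs is \<open>-1\<close>.\<close>

lemma central_span:
  assumes "central a"
  shows "a \<in> span {1, z}"
proof -
  define T where "T e x = e * x * recip e" for e x
  have Tlin: "T e (x + y) = T e x + T e y" "T e (scale r x) = scale r (T e x)" for e x y r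
    by (simp_all add: T_def distrib_left distrib_right scale_mult_left scale_mult_right)
  note M = average_linear[of T, OF Tlin]
  have mono: "average T es (prod_list s) \<in> span {1, z}" if s: "s \<in> set (subseqs es)" for s
  proof -
    have sub: "set s \<subseteq> set es" using s subseqs_powset[of es] by blast
    have dist: "distinct s" using s distinct by (rule subseqs_distinctD)
    have T: "T e (prod_list s) = scale (\<Prod>f\<leftarrow>s. if f = e then 1 else - 1) (prod_list s)"
      if "e \<in> set es" for e
      using anticommute_prod_list[OF that sub] recip[OF that]
      by (simp add: T_def scale_mult_left mult.assoc)
    show ?thesis
    proof (cases "s = [] \<or> s = es")
      case True
      then have "central (prod_list s)" using central_pseudoscalar central_closed(1) by auto
      then have "e * prod_list s = prod_list s * e" for e by (simp add: central_def)
      then have "T e (prod_list s) = prod_list s" if "e \<in> set es" for e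
        using recip[OF that] by (simp add: T_def mult.assoc)
      then have "average T es (prod_list s) = prod_list s"
        by (intro average_fixed_point two)
      with True show ?thesis by (auto intro: span_base)
    next
      case False
      then have "set s \<noteq> set es"
        using subseqs_full[OF s] distinct_card[OF dist] distinct_card[OF distinct] by auto
      then obtain f where f: "f \<in> set es" "f \<notin> set s" using sub by blast
      obtain e where e: "e \<in> set s" using False by (cases s) auto
      have "\<exists>e\<in>set es. T e (prod_list s) = - prod_list s"
        using T[of e] T[of f] sign_in[OF dist e] sign_notin[OF f(2)] e f sub
        by (cases "even (length s)") auto
      then obtain e where "e \<in> set es" "T e (prod_list s) = - prod_list s" by blast
      then have "average T es (prod_list s) = 0"
        using T by (intro average_eigenvector_zero[of es T]) (auto simp: Tlin, simp add: T_def)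
      then show ?thesis by (simp add: span_zero)
    qed
  qed
  have "average T es a \<in> span {1, z}" for a
    using monomials_span[of a]
  proof (induction rule: span_induct_alt)
    case base
    then show ?case using M(2)[of es 0 0] by (simp add: span_zero)
  next
    case (step c x y)
    then show ?case using mono by (auto simp: M intro!: span_add span_scale)
  qed
  moreover have "e * a = a * e" for e using assms by (simp add: central_def)
  then have "average T es a = a"
    using recip by (intro average_fixed_point two) (simp add: T_def mult.assoc)
  ultimately show ?thesis by metis
qed

lemma span_1z: "a \<in> span {1, z} \<longleftrightarrow> (\<exists>r s. a = scale r 1 + scale s z)"
proof
  assume "a \<in> span {1, z}"
  then obtain r s where "a - scale r 1 = scale s z"
    by (auto simp: span_insert span_singleton)
  then have "a = scale r 1 + scale s z" by (simp add: diff_eq_eq add.commute)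
  then show "\<exists>r s. a = scale r 1 + scale s z" by blast
next
  assume "\<exists>r s. a = scale r 1 + scale s z"
  then show "a \<in> span {1, z}"
    using span_base[of 1 "{1, z}"] span_base[of z "{1, z}"] by (auto intro: span_add span_scale)
qed

lemma central_iff: "central a \<longleftrightarrow> a \<in> span {1, z}"
  using central_span central_closed central_pseudoscalar by (metis span_1z)

lemma pseudoscalar_square: "\<exists>\<delta>. \<delta> \<noteq> 0 \<and> z * z = scale \<delta> 1"
proof -
  have "\<exists>\<delta>. \<delta> \<noteq> 0 \<and> prod_list s * prod_list s = scale \<delta> 1" if "set s \<subseteq> set es" for s
    using that
  proof (induction s)
    case Nil
    show ?case by (auto intro: exI[of _ 1])
  next
    case (Cons e s)
    define c where "c = (\<Prod>f\<leftarrow>s. if f = e then 1 else - 1 :: 'k)"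
    have "c \<noteq> 0" by (auto simp: c_def prod_list_zero_iff)
    obtain \<delta> where \<delta>: "\<delta> \<noteq> 0" "prod_list s * prod_list s = scale \<delta> 1" using Cons by auto
    have e: "e * prod_list s = scale c (prod_list s * e)"
      unfolding c_def using Cons.prems by (intro anticommute_prod_list) auto
    have c2: "c * c = 1"
      unfolding c_def by (induction s) (auto simp: algebra_simps)
    have "(prod_list s * e) * (e * prod_list s) = scale (q e * \<delta>) 1"
      using square[of e] Cons.prems \<delta>
      by (simp add: mult.assoc) (simp add: scale_mult_left scale_mult_right flip: mult.assoc)
    then have "(e * prod_list s) * (e * prod_list s) = scale (c * (q e * \<delta>)) 1"
      by (subst (1) e) (simp add: scale_mult_left)
    then show ?case
      using \<open>c \<noteq> 0\<close> \<delta> q_nonzero[of e] Cons.prems by (intro exI[of _ "c * (q e * \<delta>)"]) simp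
  qed
  then show ?thesis by blast
qed

lemma pseudoscalar_coordinates:
  assumes "scale r 1 + scale s z = 0"
  shows "r = 0 \<and> s = 0"
proof -
  have "s = 0"
  proof (rule ccontr)
    assume s: "s \<noteq> 0"
    have "scale s z = scale (- r) 1" using assms by (simp add: add_eq_0_iff)
    then have "z = scale (inverse s * - r) 1"
      using s by (metis scale_scale scale_one left_inverse)
    then show False using pseudoscalar_nonscalar by blast
  qed
  moreover from this have "r = 0" using assms by simp
  ultimately show ?thesis by simp
qed

text \<open>\<open>\<phi>\<close> preserves the centre \<open>k \<oplus> k z\<close>, and the only elements of it with the same square as \<open>z\<close> are
  \<open>\<plusminus> z\<close> and possibly scalars, which are not images of \<open>z\<close>.\<close>

lemma involution_pseudoscalar:
  assumes \<phi>: "algebra_hom scale scale \<phi>" and inv: "\<And>a. \<phi> (\<phi> a) = a"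
  shows "\<phi> z = z \<or> \<phi> z = - z"
proof -
  note h = algebra_homD[OF \<phi>]
  have "\<phi> z * \<phi> (\<phi> b) = \<phi> (\<phi> b) * \<phi> z" for b
    using central_pseudoscalar by (simp add: central_def flip: h(4))
  then have "central (\<phi> z)" by (simp add: central_def inv)
  then obtain r s where rs: "\<phi> z = scale r 1 + scale s z" using central_iff span_1z by auto
  obtain \<delta> where \<delta>: "\<delta> \<noteq> 0" "z * z = scale \<delta> 1" using pseudoscalar_square by blast
  have "\<phi> z * \<phi> z = scale \<delta> 1" using \<delta> by (metis h(2,3,4))
  then have "scale (r * r + s * s * \<delta> - \<delta>) 1 + scale (2 * r * s) z = 0"
  proof -
    have "(scale r 1 + scale s z) * (scale r 1 + scale s z) =
        scale (r * r) 1 + scale (s * s) (z * z) + scale (r * s + r * s) z"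
      by (simp only: scale_left_distrib)
        (simp add: distrib_left distrib_right scale_mult_left scale_mult_right scale_right_distrib
          mult.commute add_ac)
    also have "r * s + r * s = 2 * r * s" by simp
    finally show ?thesis
      using \<open>\<phi> z * \<phi> z = _\<close> \<delta>(2)
      by (simp add: rs scale_left_distrib scale_left_diff_distrib algebra_simps)
  qed
  from pseudoscalar_coordinates[OF this] two
  have eq: "r * r + s * s * \<delta> - \<delta> = 0" and "r = 0 \<or> s = 0" by auto
  have "s \<noteq> 0"
  proof
    assume "s = 0"
    then have "\<phi> z = scale r 1" by (simp add: rs)
    then have "z = scale r 1" by (metis inv h(2,3))
    then show False using pseudoscalar_nonscalar by blast
  qed
  with \<open>r = 0 \<or> s = 0\<close> have "r = 0" by simp
  with eq \<delta> have "s * s = 1" by simp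
  then have "s = 1 \<or> s = - 1" by (simp add: square_eq_1_iff)
  with rs \<open>r = 0\<close> show ?thesis by auto
qed

text \<open>For a generator \<open>e\<close> the equation \<open>d e = u e - \<phi>(e) u\<close> says that \<open>u\<close> is fixed by the affine map
  \<open>u \<mapsto> \<phi>(e) u e\<^sup>-\<^sup>1 + d(e) e\<^sup>-\<^sup>1\<close>.  The skew Leibniz rule makes these maps commuting involutions, so the
  average of \<open>0\<close> is a common fixed point; both sides of the equation are skew derivations, so it
  extends from the generators to the algebra.\<close>

lemma skew_derivation_inner:
  assumes \<phi>: "algebra_hom scale scale \<phi>"
    and add: "\<And>a b. d (a + b) = d a + d b" and sc: "\<And>r a. d (scale r a) = scale r (d a)"
    and der: "\<And>a b. d (a * b) = d a * b + \<phi> a * d b"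
  shows "\<exists>u. \<forall>a. d a = u * a - \<phi> a * u"
proof -
  note h = algebra_homD[OF \<phi>]
  have d1: "d 1 = 0" using der[of 1 1] h by simp
  define T where "T e u = \<phi> e * u * recip e + d e * recip e" for e u
  have inv: "T e (T e x) = x" if e: "e \<in> set es" for e x
  proof -
    have "\<phi> e * d e = - (d e * e)"
      using der[of e e] square[OF e] d1 by (simp add: sc add_eq_0_iff2)
    moreover have "\<phi> e * \<phi> e = scale (q e) 1" using square[OF e] h by (metis h(2,3,4))
    moreover have "T e (T e x) =
        (\<phi> e * \<phi> e) * x * (recip e * recip e) + (\<phi> e * d e) * (recip e * recip e) + d e * recip e"
      by (simp add: T_def algebra_simps)
    moreover have "recip e * recip e = scale (inverse (q e)) 1"
      using square[OF e] q_nonzero[OF e] by (simp add: recip_def scale_mult_left scale_mult_right)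
    moreover have "d e * e * (recip e * recip e) = d e * recip e"
      using recip2[OF e] by (simp add: mult.assoc)
    ultimately show ?thesis
      using q_nonzero[OF e] by (simp add: scale_mult_left scale_mult_right)
  qed
  have com: "T e (T f x) = T f (T e x)" if e: "e \<in> set es" and f: "f \<in> set es" for e f x
  proof (cases "e = f")
    case False
    have T: "T e (T f x) = \<phi> (e * f) * x * (recip f * recip e) + d (e * f) * (recip f * recip e)"
      if "e \<in> set es" "f \<in> set es" for e f
    proof -
      have "d e * (f * (recip f * recip e)) = d e * recip e"
        using recip2[OF that(2)] by simp
      then show ?thesis by (simp add: T_def der h(4) distrib_left distrib_right mult.assoc)
    qed
    have "d (- (f * e)) = - d (f * e)" using sc[of "- 1" "f * e"] by simp
    then show ?thesis
      unfolding T[OF e f] T[OF f e] anticommute[OF e f False] anticommute_recip(1)[OF e f False]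
      by (simp add: h)
  qed simp
  have half: "scale (1 / 2) (x + x) = x" for x by (rule half_double[OF two])
  define u where "u = average T es 0"
  have fixed: "T e u = u" if "e \<in> set es" for e
    unfolding u_def
  proof (rule average_fixed[OF _ com inv that])
    fix e x y
    have "d e * recip e = scale (1 / 2) (d e * recip e + d e * recip e)" by (simp only: half)
    then show "T e (scale (1 / 2) (x + y)) = scale (1 / 2) (T e x + T e y)"
      unfolding T_def
      by (simp add: distrib_left distrib_right scale_mult_left scale_mult_right scale_right_distrib
          add_ac)
  qed
  have gen: "d e = u * e - \<phi> e * u" if e: "e \<in> set es" for e
  proof -
    have "u * e = T e u * e" using fixed[OF e] by simp
    also have "\<dots> = \<phi> e * u + d e" using recip(2)[OF e] by (simp add: T_def distrib_right mult.assoc)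
    finally show ?thesis by simp
  qed
  have "d a = u * a - \<phi> a * u" for a
  proof (induction a rule: induct)
    case (mult e a)
    have "d (e * a) = (u * e - \<phi> e * u) * a + \<phi> e * (u * a - \<phi> a * u)"
      using gen[OF mult(1)] mult(2) by (simp add: der)
    then show ?case by (simp add: h(4) left_diff_distrib right_diff_distrib mult.assoc)
  next
    case (scale r a)
    then show ?case by (simp add: h sc scale_mult_left scale_mult_right scale_right_diff_distrib)
  qed (simp_all add: d1 h add algebra_simps)
  then show ?thesis by blast
qed


text \<open>Let \<open>W\<close> be the space of intertwiners \<open>c\<close>, with \<open>\<phi>(a) c = c a\<close>, and \<open>W'\<close> that of intertwiners in the
  other direction.  Averages of \<open>x \<mapsto> \<phi>(e) x e\<^sup>-\<^sup>1\<close> lie in \<open>W\<close>, and there are enough of them for the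
  right ideal \<open>J\<close> generated by \<open>W\<close> to contain \<open>1\<close>.  A second average turns this into an expression of
  \<open>1\<close> as a combination of products \<open>c c'\<close>, which are central.  If \<open>k \<oplus> k z\<close> is a field, one of these
  products is invertible.  If none is, then \<open>k \<oplus> k z\<close> splits into two copies of \<open>k\<close>, and intertwiners
  that are invertible on one component each are glued.\<close>

lemma skolem_noether:
  assumes \<phi>: "algebra_hom scale scale \<phi>" and surj: "surj \<phi>" and \<phi>z: "\<phi> z = z"
  shows "\<exists>c c_inv. c * c_inv = 1 \<and> c_inv * c = 1 \<and> (\<forall>a. \<phi> a = c_inv * a * c)"
proof -
  note h = algebra_homD[OF \<phi>]
  define W where "W = {c. \<forall>a. \<phi> a * c = c * a}"
  define W' where "W' = {c. \<forall>a. c * \<phi> a = a * c}"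
  define J where "J = span {c * b | c b. c \<in> W}"
  obtain e0 L where es: "es = e0 # L" using odd by (cases es) auto
  have e0: "e0 \<in> set es" and L: "set L \<subseteq> set es" "e0 \<notin> set L" using es distinct by auto
  have half: "scale (1 / 2) (x + x) = x" for x by (rule half_double[OF two])
  have \<phi>_recip: "\<phi> e * (\<phi> (recip e) * x) = x" if "e \<in> set es" for e x
    using recip[OF that] h(3) by (simp flip: mult.assoc h(4))
  have \<phi>_anti: "\<phi> e * \<phi> f = - (\<phi> f * \<phi> e)" if "e \<in> set es" "f \<in> set es" "e \<noteq> f" for e f
    using anticommute[OF that] by (metis h(4,6))
  have \<phi>_square: "\<phi> e * \<phi> e = scale (q e) 1" if "e \<in> set es" for e
    using square[OF that] by (metis h(2,3,4))
  have recip_square: "recip e * recip e = scale (inverse (q e)) 1" if "e \<in> set es" for e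
    using square[OF that] q_nonzero[OF that] by (simp add: recip_def scale_mult_left scale_mult_right)

  define T where "T e x = \<phi> e * x * recip e" for e x
  have T_inv: "T e (T e x) = x" if "e \<in> set es" for e x
  proof -
    have "T e (T e x) = (\<phi> e * \<phi> e) * x * (recip e * recip e)" by (simp add: T_def mult.assoc)
    then show ?thesis
      using q_nonzero[OF that]
      by (simp add: \<phi>_square[OF that] recip_square[OF that] scale_mult_left scale_mult_right)
  qed
  have T_com: "T e (T f x) = T f (T e x)" if "e \<in> set es" "f \<in> set es" for e f x
  proof (cases "e = f")
    case False
    have "T e (T f x) = (\<phi> e * \<phi> f) * x * (recip f * recip e)" for e f
      by (simp add: T_def mult.assoc)
    then show ?thesis using \<phi>_anti[OF that False] anticommute_recip(1)[OF that False] by simp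
  qed simp
  have T_lin: "T e (x + y) = T e x + T e y" "T e (scale r x) = scale r (T e x)" for e x y r
    by (simp_all add: T_def distrib_left distrib_right scale_mult_left scale_mult_right)

  \<comment> \<open>The average runs over \<open>L\<close> only; that \<open>e0\<close> is intertwined too follows from \<open>\<phi>(z) = z\<close>.\<close>
  have W_avg: "average T L y \<in> W" for y
  proof -
    define c where "c = average T L y"
    have gen: "\<phi> e * c = c * e" if "e \<in> set L" for e
    proof -
      have "T e c = c"
        unfolding c_def using that L(1)
        by (intro average_fixed) (auto simp: T_lin scale_right_distrib T_inv intro: T_com)
      then have "c * e = \<phi> e * c * recip e * e" by (simp add: T_def)
      also have "\<dots> = \<phi> e * c" using recip(2)[of e] that L by (auto simp: mult.assoc)
      finally show ?thesis by simp
    qed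
    have genL: "\<phi> (prod_list K) * c = c * prod_list K" if "set K \<subseteq> set L" for K
      using that
    proof (induction K)
      case (Cons k K)
      have "\<phi> (k * prod_list K) * c = \<phi> k * (\<phi> (prod_list K) * c)" by (simp add: h mult.assoc)
      also have "\<dots> = c * (k * prod_list K)"
        using Cons gen[of k] by (simp flip: mult.assoc)
      finally show ?case by simp
    qed (simp add: h)
    obtain r where r: "prod_list L * r = 1" using prod_list_invertible[OF L(1)] by blast
    have "\<phi> z * c = c * z" using \<phi>z central_pseudoscalar by (simp add: central_def)
    then have "\<phi> e0 * (\<phi> (prod_list L) * c) = c * e0 * prod_list L"
      by (simp add: es h mult.assoc)
    then have "\<phi> e0 * c * prod_list L * r = c * e0 * prod_list L * r"
      by (simp add: genL mult.assoc)
    then have gen0: "\<phi> e0 * c = c * e0" using r by (simp add: mult.assoc)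
    have "\<phi> a * c = c * a" for a
    proof (induction a rule: induct)
      case (mult e a)
      then have "\<phi> e * c = c * e" using gen gen0 es by auto
      then show ?case using mult by (metis h(4) mult.assoc)
    qed (simp_all add: h distrib_left distrib_right scale_mult_left scale_mult_right)
    then show ?thesis by (simp add: W_def c_def)
  qed
  have J_right: "x * b \<in> J" if "x \<in> J" for x b
    using that unfolding J_def
  proof (rule span_mult(2)[OF _ subspace_span])
    fix m assume "m \<in> {c * b |c b. c \<in> W}"
    then obtain c b' where "m = c * b'" "c \<in> W" by blast
    then have "m * b = c * (b' * b) \<and> c \<in> W" by (simp add: mult.assoc)
    then show "m * b \<in> span {c * b |c b. c \<in> W}" by (intro span_base) blast
  qed
  \<comment> \<open>Right conjugation by \<open>e0 k\<close> flips the sign of \<open>T k\<close> and commutes with the other \<open>T f\<close> for \<open>f\<close> in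
    \<open>L\<close>.  Adding the average and its conjugate therefore removes the factor for \<open>k\<close>.\<close>
  have strip: "y \<in> J" if "\<And>y. average T K y \<in> J" "distinct K" "set K \<subseteq> set L" for K y
    using that
  proof (induction K arbitrary: y)
    case (Cons k K)
    have k: "k \<in> set es" "k \<noteq> e0" "k \<notin> set K" using Cons.prems L by auto
    define r s where "r = e0 * k" and "s = recip k * recip e0"
    have rs: "x * r * s = x" for x
      using recip2(1)[OF k(1)] recip[OF e0] by (simp add: r_def s_def mult.assoc)
    have com: "r * recip f = recip f * r" if "f \<in> set K" for f
    proof -
      have f: "f \<in> set es" "k \<noteq> f" "e0 \<noteq> f" using that Cons.prems k L by auto
      show ?thesis
        using anticommute_recip(2)[OF k(1) f(1) f(2)] anticommute_recip(2)[OF e0 f(1) f(3)]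
        by (simp add: r_def mult.assoc) (simp flip: mult.assoc)
    qed
    have anti: "r * recip k = - (recip k * r)"
    proof -
      have "recip k * r = recip k * e0 * k" by (simp add: r_def mult.assoc)
      also have "recip k * e0 = - (e0 * recip k)"
        using anticommute_recip(2)[OF e0 k(1)] k(2) by simp
      also have "- (e0 * recip k) * k = - e0" using recip[OF k(1)] by (simp add: mult.assoc)
      finally show ?thesis using recip[OF k(1)] by (simp add: r_def mult.assoc)
    qed
    have "average T K y \<in> J" for y
    proof -
      define w where "w = average T K y"
      have "average T K (y * r) = average T K y * r"
        by (rule average_intertwine)
          (simp_all add: T_def com mult.assoc distrib_right scale_mult_left)
      then have "average T (k # K) y + average T (k # K) (y * r) * s =
          scale (1 / 2) (w + T k w) + scale (1 / 2) (w * r + T k (w * r)) * s"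
        by (simp add: w_def)
      also have "T k (w * r) = - (T k w * r)"
        using anti by (simp add: T_def mult.assoc)
      also have "scale (1 / 2) (w * r + - (T k w * r)) * s = scale (1 / 2) (w - T k w)"
        by (simp add: scale_mult_left rs left_diff_distrib)
      also have "scale (1 / 2) (w + T k w) + scale (1 / 2) (w - T k w) = scale (1 / 2) (w + w)"
        by (simp flip: scale_right_distrib)
      finally have "w = average T (k # K) y + average T (k # K) (y * r) * s"
        by (simp add: half)
      also have "\<dots> \<in> J"
        using Cons.prems(1) J_right unfolding J_def by (intro span_add) blast+
      finally show ?thesis by (simp add: w_def)
    qed
    then show ?case using Cons by simp
  qed simp
  have "1 \<in> J"
  proof (rule strip)
    show "average T L y \<in> J" for y
    proof -
      have "average T L y * 1 \<in> J" unfolding J_def using W_avg[of y] by (intro span_base) blast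
      then show ?thesis by simp
    qed
  qed (use es distinct in auto)

  define U where "U e x = e * x * \<phi> (recip e)" for e x
  define S0 where "S0 = {c * c' | c c'. c \<in> W \<and> c' \<in> W'}"
  have U_lin: "U e (x + y) = U e x + U e y" "U e (scale r x) = scale r (U e x)" for e x y r
    by (simp_all add: U_def distrib_left distrib_right scale_mult_left scale_mult_right)
  have U_inv: "U e (U e x) = x" if "e \<in> set es" for e x
  proof -
    have "U e (U e x) = (e * e) * x * \<phi> (recip e * recip e)" by (simp add: U_def h mult.assoc)
    then show ?thesis
      using q_nonzero[OF that]
      by (simp add: square[OF that] recip_square[OF that] h scale_mult_left scale_mult_right)
  qed
  have U_com: "U e (U f x) = U f (U e x)" if "e \<in> set es" "f \<in> set es" for e f x
  proof (cases "e = f")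
    case False
    have UU: "U e (U f x) = (e * f) * x * \<phi> (recip f * recip e)" for e f
      by (simp add: U_def h mult.assoc)
    show ?thesis
      unfolding UU[of e f] UU[of f e] anticommute[OF that False] anticommute_recip(1)[OF that False]
      by (simp add: h(6))
  qed simp
  have W'_avg: "average U es b \<in> W'" for b
  proof -
    define c where "c = average U es b"
    have gen: "c * \<phi> e = e * c" if "e \<in> set es" for e
    proof -
      have "U e c = c"
        unfolding c_def using that
        by (intro average_fixed) (auto simp: U_lin scale_right_distrib U_inv intro: U_com)
      then have "c * \<phi> e = e * c * \<phi> (recip e) * \<phi> e" by (simp add: U_def)
      then have "c * \<phi> e = e * c * \<phi> (recip e * e)" by (simp only: h(4) mult.assoc)
      then show ?thesis by (simp add: recip[OF that] h)
    qed
    have "c * \<phi> a = a * c" for a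
    proof (induction a rule: induct)
      case (mult e a)
      then show ?case using gen[OF mult(1)] by (metis h(4) mult.assoc)
    qed (simp_all add: h distrib_left distrib_right scale_mult_left scale_mult_right)
    then show ?thesis by (simp add: W'_def c_def)
  qed
  define V where "V e x = \<phi> e * x * \<phi> (recip e)" for e x
  have V_lin: "V e (x + y) = V e x + V e y" "V e (scale r x) = scale r (V e x)" for e x y r
    by (simp_all add: V_def distrib_left distrib_right scale_mult_left scale_mult_right)
  have V_S0: "average V es x \<in> span S0" if "x \<in> J" for x
    using that unfolding J_def
  proof (induction rule: span_induct_alt)
    case base
    show ?case using average_linear(2)[of V es 0 0] by (simp add: V_lin span_zero)
  next
    case (step r x y)
    then obtain c b where cb: "x = c * b" "c \<in> W" by blast
    then have "V e (c * x) = c * U e x" for e x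
      by (simp add: V_def U_def W_def) (metis mult.assoc)
    then have "average V es (c * b) = c * average U es b"
      by (intro average_intertwine) (simp_all add: distrib_left scale_mult_right)
    then have "average V es x \<in> S0" using cb W'_avg by (auto simp: S0_def)
    with step show ?case by (simp add: average_linear V_lin span_add span_scale span_base)
  qed
  have "average V es 1 = 1"
    using \<phi>_recip[of _ 1] by (intro average_fixed_point two) (simp add: V_def)
  with V_S0[OF \<open>1 \<in> J\<close>] have one: "1 \<in> span S0" by simp
  have central_S0: "central x" if "x \<in> S0" for x
  proof -
    from that obtain c c' where x: "x = c * c'" "c \<in> W" "c' \<in> W'" by (auto simp: S0_def)
    have "x * b = b * x" for b
    proof -
      obtain a where b: "b = \<phi> a" using surj by (metis surjD)
      have "c * c' * \<phi> a = c * a * c'" using x by (simp add: W'_def mult.assoc)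
      also have "\<dots> = \<phi> a * (c * c')" using x by (simp add: W_def flip: mult.assoc)
      finally show ?thesis by (simp add: x(1) b)
    qed
    then show ?thesis by (simp add: central_def)
  qed
  have closed: "c * t \<in> W" if "c \<in> W" "central t" for c t
  proof -
    have "\<phi> a * (c * t) = c * t * a" for a
      using that unfolding W_def central_def mem_Collect_eq by (metis mult.assoc)
    then show ?thesis by (simp add: W_def)
  qed
  have closed': "c * t \<in> W'" if "c \<in> W'" "central t" for c t
  proof -
    have "c * t * \<phi> a = a * (c * t)" for a
      using that unfolding W'_def central_def mem_Collect_eq by (metis mult.assoc)
    then show ?thesis by (simp add: W'_def)
  qed
  have closed_add: "c + d \<in> W" if "c \<in> W" "d \<in> W" for c d
    using that by (simp add: W_def distrib_left distrib_right)
  have closed_add': "c + d \<in> W'" if "c \<in> W'" "d \<in> W'" for c d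
    using that by (simp add: W'_def distrib_left distrib_right)
  have "\<exists>c\<in>W. \<exists>c'\<in>W'. c * c' = 1"
  proof (cases "\<exists>x\<in>S0. \<exists>t. central t \<and> x * t = 1")
    case True
    then obtain c c' t where "c \<in> W" "c' \<in> W'" "central t" "c * c' * t = 1"
      by (auto simp: S0_def)
    then show ?thesis using closed'[of c' t] by (auto simp: mult.assoc)
  next
    case False
    obtain \<delta> where \<delta>: "\<delta> \<noteq> 0" "z * z = scale \<delta> 1" using pseudoscalar_square by blast
    have "\<exists>x\<in>S0. x \<noteq> 0"
    proof (rule ccontr)
      assume "\<not> ?thesis"
      then have "S0 \<subseteq> {0}" by blast
      then have "span S0 \<subseteq> span {0}" by (rule span_mono)
      with one have "(1::'a) \<in> {0}" by auto
      then show False by simp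
    qed
    then obtain x where x: "x \<in> S0" "x \<noteq> 0" by blast
    then obtain a b where ab: "x = scale a 1 + scale b z"
      using central_S0 central_iff span_1z by metis
    \<comment> \<open>The norm of a central element with no central inverse vanishes.\<close>
    have eq: "a * a - b * b * \<delta> = 0"
    proof (rule ccontr)
      define N where "N = a * a - b * b * \<delta>"
      assume "a * a - b * b * \<delta> \<noteq> 0"
      then have N: "N \<noteq> 0" by (simp add: N_def)
      define t where "t = scale (inverse N) (scale a 1 - scale b z)"
      have "x * (scale a 1 - scale b z) = scale N 1"
        using \<delta>(2) by (simp add: ab N_def distrib_left distrib_right right_diff_distrib
            scale_mult_left scale_mult_right scale_left_diff_distrib scale_right_distrib mult.commute)
      then have "x * t = 1" using N by (simp add: t_def scale_mult_right)
      moreover have "central t"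
        unfolding central_iff span_1z t_def
        by (rule exI[of _ "inverse N * a"], rule exI[of _ "- (inverse N * b)"])
          (simp add: scale_right_diff_distrib)
      ultimately show False using False x(1) by blast
    qed
    have b: "b \<noteq> 0" using eq x(2) ab by auto
    define r where "r = a / b"
    have r: "r * r = \<delta>" using eq b by (simp add: r_def field_simps)
    then have "r \<noteq> 0" using \<delta> by auto
    \<comment> \<open>The two idempotents of \<open>k \<oplus> k z\<close> are \<open>f r\<close> and \<open>f (- r)\<close>, where \<open>z\<^sup>2 = r\<^sup>2\<close>.\<close>
    define f where "f s = scale (1 / 2) (1 + scale (inverse s) z)" for s
    have zf: "z * f s = scale s (f s)" if "s = r \<or> s = - r" for s
    proof -
      have s: "s \<noteq> 0" "s * s = \<delta>" using that r \<open>r \<noteq> 0\<close> by auto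
      then have "inverse s * \<delta> = s" by (simp add: field_simps)
      then have "z * (1 + scale (inverse s) z) = scale s (1 + scale (inverse s) z)"
        using s \<delta> by (simp add: distrib_left scale_mult_right scale_right_distrib)
      then show ?thesis unfolding f_def by (simp add: scale_mult_right scale_left_commute)
    qed
    have f_central: "central (f s)" for s
      unfolding central_iff span_1z f_def
      by (intro exI[of _ "1 / 2"] exI[of _ "1 / 2 * inverse s"]) (simp add: scale_right_distrib)
    have f_sum: "f r + f (- r) = 1"
    proof -
      have "f r + f (- r) =
          scale (1 / 2) ((1 + scale (inverse r) z) + (1 - scale (inverse r) z))"
        unfolding f_def scale_right_distrib[symmetric] by simp
      also have "(1 + scale (inverse r) z) + (1 - scale (inverse r) z) = 1 + 1"
        by (simp only: add_diff_eq) simp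
      finally show ?thesis by (simp only: half)
    qed
    have f_nonzero: "f s \<noteq> 0" if "s = r \<or> s = - r" for s
    proof
      assume "f s = 0"
      then have "scale 1 1 + scale (inverse s) z = 0" using two by (simp add: f_def)
      from pseudoscalar_coordinates[OF this] show False by simp
    qed
    have ff: "f s * f s = f s" if "s = r \<or> s = - r" for s
    proof -
      have s: "s \<noteq> 0" using that \<open>r \<noteq> 0\<close> by auto
      have "f s * f s = scale (1 / 2) (f s + scale (inverse s) (z * f s))"
        by (subst (1) f_def) (simp add: scale_mult_left distrib_right)
      also have "\<dots> = f s" using s zf[OF that] half by simp
      finally show ?thesis .
    qed
    have ff0: "f r * f (- r) = 0"
    proof -
      have "f r * (f r + f (- r)) = f r" by (simp add: f_sum)
      then show ?thesis using ff[of r] by (simp add: distrib_left)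
    qed
    have "f (- r) * f r = f r * f (- r)" using f_central[of r] unfolding central_def by metis
    with ff0 have f0f: "f (- r) * f r = 0" by metis
    have nonzero: "\<exists>c\<in>W. \<exists>c'\<in>W'. c * c' * f s = f s" if s: "s = r \<or> s = - r" for s
    proof -
      have "\<exists>x\<in>S0. x * f s \<noteq> 0"
      proof (rule ccontr)
        assume "\<not> ?thesis"
        then have 0: "x * f s = 0" if "x \<in> S0" for x using that by blast
        have "x * f s = 0" if "x \<in> span S0" for x
          using that by (induction rule: span_induct_alt) (simp_all add: 0 distrib_right scale_mult_left)
        with one f_nonzero[OF s] show False by force
      qed
      then obtain c c' where c: "c \<in> W" "c' \<in> W'" "c * c' * f s \<noteq> 0" by (auto simp: S0_def)
      then have "central (c * c')" by (intro central_S0) (auto simp: S0_def)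
      then obtain a b where "c * c' = scale a 1 + scale b z" unfolding central_iff span_1z by blast
      then have eq: "c * c' * f s = scale (a + b * s) (f s)"
        using zf[OF s] by (simp add: distrib_right scale_mult_left scale_left_distrib)
      with c have "a + b * s \<noteq> 0" by auto
      then have "c * (c' * scale (inverse (a + b * s)) 1) * f s = f s"
        using eq by (simp add: scale_mult_right scale_mult_left flip: mult.assoc)
      moreover have "c' * scale (inverse (a + b * s)) 1 \<in> W'"
        using c(2) central_closed by (intro closed') auto
      ultimately show ?thesis using c(1) by blast
    qed
    obtain c1 c1' where 1: "c1 \<in> W" "c1' \<in> W'" "c1 * c1' * f r = f r" using nonzero by blast
    obtain c2 c2' where 2: "c2 \<in> W" "c2' \<in> W'" "c2 * c2' * f (- r) = f (- r)"
      using nonzero by blast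
    define c c' where "c = c1 * f r + c2 * f (- r)" and "c' = c1' * f r + c2' * f (- r)"
    have mult: "(x * f s) * (y * f t) = x * y * (f s * f t)" for x y s t
    proof -
      have "f s * y = y * f s" using f_central[of s] unfolding central_def by metis
      then have "x * (f s * y) * f t = x * (y * f s) * f t" by simp
      then show ?thesis by (simp only: mult.assoc)
    qed
    have "c * c' = c1 * c1' * f r + c2 * c2' * f (- r)"
      by (simp add: c_def c'_def distrib_left distrib_right mult ff ff0 f0f)
    then have "c * c' = 1" using 1 2 f_sum by simp
    moreover have "c \<in> W" "c' \<in> W'"
      unfolding c_def c'_def using 1 2 f_central by (auto intro!: closed closed' closed_add closed_add')
    ultimately show ?thesis by blast
  qed
  then obtain c c' where c: "c \<in> W" "c' \<in> W'" "c * c' = 1" by blast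
  have "c * a = \<phi> a * c" "c' * \<phi> a = a * c'" for a using c by (simp_all add: W_def W'_def)
  note cW = this
  have com: "c' * c * a = a * (c' * c)" for a
  proof -
    have "c' * (c * a) = c' * \<phi> a * c" by (simp add: cW(1) mult.assoc)
    then show ?thesis by (simp add: cW(2) mult.assoc)
  qed
  \<comment> \<open>A right inverse is a left inverse, since \<open>c' c\<close> is central.\<close>
  have "c' * c = (c' * c) * (c * c')" by (simp add: c(3))
  also have "\<dots> = (c' * c * c) * c'" by (simp only: mult.assoc)
  also have "\<dots> = c * c' * (c * c')" by (simp only: com) (simp only: mult.assoc)
  finally have "c' * c = 1" by (simp add: c(3))
  moreover have "\<phi> a = c * a * c'" for a
  proof -
    have "\<phi> a = \<phi> a * (c * c')" by (simp add: c(3))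
    also have "\<dots> = c * a * c'" by (simp only: cW(1)[of a] mult.assoc[symmetric])
    finally show ?thesis .
  qed
  ultimately show ?thesis using c(3) by blast
qed

end

section \<open>Semisimple Clifford algebras\<close>

text \<open>A generator \<open>e\<close> commutes up to sign with the other ones, so \<open>e a = b e\<close> for some \<open>b\<close>, and then
  \<open>e a e = b e\<^sup>2 = 0\<close>.\<close>

lemma (in clifford_generators) zero_square_nilpotent:
  assumes e: "e \<in> set es" and q: "q e = 0"
  shows "e * a * e = 0"
proof -
  have ee: "e * e = 0" using square[OF e] q by simp
  have "\<exists>b. e * a = b * e"
  proof (induction a rule: induct)
    case one show ?case by (rule exI[of _ 1]) simp
  next
    case (add a b)
    then obtain x y where "e * a = x * e" "e * b = y * e" by blast
    then show ?case by (intro exI[of _ "x + y"]) (simp add: distrib_left distrib_right)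
  next
    case (scale r a)
    then obtain x where "e * a = x * e" by blast
    then show ?case by (intro exI[of _ "scale r x"]) (simp add: scale_mult_left scale_mult_right)
  next
    case (mult f a)
    show ?case
    proof (cases "f = e")
      case True
      then have "e * (f * a) = 0 * e" by (simp add: ee flip: mult.assoc)
      then show ?thesis by blast
    next
      case False
      obtain b where "e * a = b * e" using mult by blast
      moreover have "e * f = - (f * e)" using anticommute[OF e mult(1)] False by auto
      ultimately have "e * (f * a) = - (f * b) * e"
        by (simp flip: mult.assoc) (simp add: mult.assoc)
      then show ?thesis by blast
    qed
  qed
  then obtain b where "e * a = b * e" by blast
  then show ?thesis by (simp add: mult.assoc ee)
qed

lemma semisimple_no_nilpotent:
  fixes e :: "'a::ring_1"
  assumes ss: "semisimple_ring TYPE('a)" and nil: "\<And>a. e * a * e = 0"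
  shows "e = 0"
proof -
  define I where "I = range (\<lambda>b. b * e)"
  have I: "left_ideal I"
    unfolding left_ideal_def
  proof (intro conjI ballI allI)
    show "0 \<in> I" unfolding I_def by (rule range_eqI[of _ _ 0]) simp
  next
    fix x y assume "x \<in> I" "y \<in> I"
    then obtain a b where "x = a * e" "y = b * e" by (auto simp: I_def)
    then show "x + y \<in> I" unfolding I_def by (intro range_eqI[of _ _ "a + b"]) (simp add: distrib_right)
  next
    fix r x assume "x \<in> I"
    then obtain a where "x = a * e" by (auto simp: I_def)
    then show "r * x \<in> I" unfolding I_def by (intro range_eqI[of _ _ "r * a"]) (simp add: mult.assoc)
  qed
  obtain J where J: "left_ideal J" "I \<inter> J = {0}" and sum: "\<forall>a. \<exists>x\<in>I. \<exists>y\<in>J. a = x + y"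
    using ss[unfolded semisimple_ring_def, rule_format, OF I] by (elim exE conjE)
  from spec[OF sum, of 1] obtain x y where xy: "x \<in> I" "y \<in> J" "1 = x + y" by blast
  obtain b where b: "x = b * e" using xy(1) by (auto simp: I_def)
  have "b * e * (b * e) = b * (e * b * e)" by (simp only: mult.assoc)
  then have "x * x = 0" by (simp add: b nil)
  moreover have "x * (x + y) = x" by (simp flip: xy(3))
  ultimately have "x * y = x" by (simp add: distrib_left)
  moreover have "x * y \<in> J" using J(1) xy(2) by (simp add: left_ideal_def)
  ultimately have "x = 0" using J(2) xy(1) by auto
  then have "1 \<in> J" using xy by simp
  then have "e * 1 \<in> J" using J(1) unfolding left_ideal_def by blast
  moreover have "1 * e \<in> I" unfolding I_def by (rule rangeI)
  ultimately show ?thesis using J(2) by auto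
qed

lemma clifford_relation_values:
  assumes "is_clifford_algebra sA n \<alpha> \<beta> \<gamma> lam G X"
    and u: "u \<in> insert G (X ` {1..n})" and v: "v \<in> insert G (X ` {1..n})"
  shows "\<exists>r. u * v + v * u = sA r 1"
proof -
  have pres: "presented_by sA (case_generator G X) (generators n) (clifford_relations n \<alpha> \<beta> \<gamma> lam)"
    using assms(1) by (simp add: is_clifford_algebra_def)
  interpret k_algebra sA using pres by (simp add: presented_by_def)
  note rel = presented_relations[OF pres]
  have G: "G * G = sA \<alpha> 1"
    using rel[of "letter GenG * letter GenG - scalar \<alpha>"]
    by (simp add: clifford_relations_def Let_def)
  have X: "X i * X i = sA (\<beta> i) 1" if "i \<in> {1..n}" for i
    using rel[of "letter (GenX i) * letter (GenX i) - scalar (\<beta> i)"] that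
    by (force simp: clifford_relations_def Let_def)
  have GX: "G * X i + X i * G = sA (\<gamma> i) 1" if "i \<in> {1..n}" for i
    using rel[of "letter GenG * letter (GenX i) + letter (GenX i) * letter GenG - scalar (\<gamma> i)"] that
    by (force simp: clifford_relations_def Let_def)
  have XX: "X i * X j + X j * X i = sA (lam i j) 1" if "1 \<le> i" "i < j" "j \<le> n" for i j
    using rel[of "letter (GenX i) * letter (GenX j) + letter (GenX j) * letter (GenX i) - scalar (lam i j)"] that
    by (force simp: clifford_relations_def Let_def)
  have XX': "\<exists>r. X i * X j + X j * X i = sA r 1" if "i \<in> {1..n}" "j \<in> {1..n}" for i j
  proof -
    consider "i = j" | "i < j" | "j < i" by linarith
    then show ?thesis
    proof cases
      case 1
      then show ?thesis using X[of i] that by (auto simp flip: scale_left_distrib)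
    next
      case 2
      then show ?thesis using XX[of i j] that by auto
    next
      case 3
      then show ?thesis using XX[of j i] that by (auto simp: add.commute)
    qed
  qed
  have "\<exists>r. G * G + G * G = sA r 1" using G by (auto simp flip: scale_left_distrib)
  then show ?thesis
    using u v XX' GX by (auto simp: add.commute)
qed

lemma clifford_grade_involution:
  assumes A: "is_clifford_algebra sA n \<alpha> \<beta> \<gamma> lam G X"
  shows "\<exists>\<sigma>. algebra_hom sA sA \<sigma> \<and> (\<forall>a\<in>insert G (X ` {1..n}). \<sigma> a = - a)"
proof -
  have pres: "presented_by sA (case_generator G X) (generators n) (clifford_relations n \<alpha> \<beta> \<gamma> lam)"
    using A by (simp add: is_clifford_algebra_def)
  interpret k_algebra sA using pres by (simp add: presented_by_def)
  note rel = presented_relations[OF pres]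
  have "evaluate sA (\<lambda>i. - case_generator G X i) r = 0" if r: "r \<in> clifford_relations n \<alpha> \<beta> \<gamma> lam" for r
  proof -
    have "evaluate sA (\<lambda>i. - case_generator G X i) r = evaluate sA (case_generator G X) r"
      using r by (auto simp: clifford_relations_def Let_def)
    then show ?thesis using rel[OF r] by simp
  qed
  from presented_lift[OF pres k_algebra_axioms this]
  obtain f where f: "algebra_hom sA sA f" "\<forall>i\<in>generators n. f (case_generator G X i) = - case_generator G X i"
    by blast
  have "f a = - a" if "a \<in> insert G (X ` {1..n})" for a
  proof -
    from that consider "a = G" | j where "j \<in> {1..n}" "a = X j" by blast
    then show ?thesis
    proof cases
      case 1
      then show ?thesis using bspec[OF f(2), of GenG] by (simp add: generators_def)
    next
      case 2
      then show ?thesis using bspec[OF f(2), of "GenX j"] by (simp add: generators_def)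
    qed
  qed
  with f(1) show ?thesis by blast
qed

text \<open>The assumptions of the theorem on \<open>A\<close> put it into the locale \<open>odd_clifford\<close>.  The involution \<open>\<sigma>\<close>
  is compared with the automorphism negating the generators, which exists because the defining
  relations involve only words of even length and scalars.\<close>

lemma clifford_structure:
  fixes sA :: "'k::field \<Rightarrow> 'a::ring_1 \<Rightarrow> 'a"
  assumes two: "(2::'k) \<noteq> 0"
    and n: "even n"
    and A: "is_clifford_algebra sA n \<alpha> \<beta> \<gamma> lam G X"
    and dim_A: "vector_space.dim sA (UNIV :: 'a set) = 2 ^ (n + 1)"
    and semisimple: "semisimple_ring TYPE('a)"
    and V: "V = generating_space sA n G X"
    and z: "is_pseudoscalar sA V z"
    and \<sigma>: "\<sigma> = main_involution sA V"
  shows "\<exists>es q. odd_clifford sA es q \<and> z = prod_list es \<and> algebra_hom sA sA \<sigma> \<and>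
    (\<forall>a. \<sigma> (\<sigma> a) = a) \<and> \<sigma> z = - z"
proof -
  have pres: "presented_by sA (case_generator G X) (generators n) (clifford_relations n \<alpha> \<beta> \<gamma> lam)"
    using A by (simp add: is_clifford_algebra_def)
  interpret k_algebra sA using pres by (simp add: presented_by_def)
  define C where "C = insert G (X ` {1..n})"
  have V_C: "V = span C" by (simp add: V generating_space_def C_def)
  have gen_C: "case_generator G X i \<in> C" if "i \<in> generators n" for i
    using that by (auto simp: generators_def C_def)
  have gen_induct: "P a" if "P 1" "\<And>a b. P a \<Longrightarrow> P b \<Longrightarrow> P (a + b)" "\<And>c a. P a \<Longrightarrow> P (sA c a)"
    "\<And>v a. v \<in> C \<Longrightarrow> P a \<Longrightarrow> P (v * a)" for P a
    by (rule presented_induct[OF pres]) (use that gen_C in auto)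

  have anti1: "\<exists>r. u * v + v * u = sA r 1" if u: "u \<in> V" and v: "v \<in> C" for u v
    using u unfolding V_C
  proof (induction rule: span_induct_alt)
    case base show ?case by (intro exI[of _ 0]) simp
  next
    case (step c x y)
    obtain r where r: "x * v + v * x = sA r 1"
      using clifford_relation_values[OF A] step(1) v unfolding C_def by blast
    obtain s where s: "y * v + v * y = sA s 1" using step by blast
    have "(sA c x + y) * v + v * (sA c x + y) = sA c (x * v + v * x) + (y * v + v * y)"
      by (simp add: distrib_left distrib_right scale_mult_left scale_mult_right scale_right_distrib add_ac)
    also have "\<dots> = sA (c * r + s) 1" by (simp add: r s scale_left_distrib)
    finally show ?case by blast
  qed
  have anti2: "\<exists>r. u * v + v * u = sA r 1" if u: "u \<in> V" and v: "v \<in> V" for u v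
    using v unfolding V_C
  proof (induction rule: span_induct_alt)
    case base show ?case by (intro exI[of _ 0]) simp
  next
    case (step c x y)
    obtain r where r: "u * x + x * u = sA r 1" using anti1[OF u step(1)] by blast
    obtain s where s: "u * y + y * u = sA s 1" using step by blast
    have "u * (sA c x + y) + (sA c x + y) * u = sA c (u * x + x * u) + (u * y + y * u)"
      by (simp add: distrib_left distrib_right scale_mult_left scale_mult_right scale_right_distrib add_ac)
    also have "\<dots> = sA (c * r + s) 1" by (simp add: r s scale_left_distrib)
    finally show ?case by blast
  qed
  have scalar_eq: "c = d" if "sA c 1 = sA d 1" for c d
    using that by (metis scale_right_imp_eq zero_neq_one)
  \<comment> \<open>\<open>v\<^sup>2\<close> is half of the anticommutator of \<open>v\<close> with itself.\<close>
  have quad: "v * v = sA (quad_form sA v) 1" if "v \<in> V" for v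
  proof -
    from anti2[OF that that] obtain r where "v * v + v * v = sA r 1" by blast
    then have "v * v = sA (1 / 2 * r) 1" using half_double[OF two, of "v * v"] by simp
    then show ?thesis unfolding quad_form_def by (rule theI) (metis scalar_eq \<open>v * v = _\<close>)
  qed
  obtain es where es: "is_orthogonal_basis sA V es" "z = prod_list es"
    using z by (auto simp: is_pseudoscalar_def)
  then have dist: "distinct es" and indep: "independent (set es)" and span_es: "span (set es) = V"
    and orth: "\<And>i j. i < length es \<Longrightarrow> j < length es \<Longrightarrow> i \<noteq> j \<Longrightarrow> polar_form sA (es ! i) (es ! j) = 0"
    by (auto simp: is_orthogonal_basis_def)
  have es_V: "e \<in> V" if "e \<in> set es" for e using span_base[OF that] span_es by simp
  have subV: "subspace V" by (simp add: V_C)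
  interpret clifford_generators sA es "quad_form sA"
  proof
    show "(2::'k) \<noteq> 0" "distinct es" by fact+
    show "e * e = sA (quad_form sA e) 1" if "e \<in> set es" for e
      using quad[OF es_V[OF that]] .
    show "e * f = - (f * e)" if ef: "e \<in> set es" "f \<in> set es" "e \<noteq> f" for e f
    proof -
      obtain i j where "i < length es" "j < length es" "es ! i = e" "es ! j = f" "i \<noteq> j"
        using ef by (metis in_set_conv_nth)
      with orth have "polar_form sA e f = 0" by blast
      then have "quad_form sA (e + f) = quad_form sA e + quad_form sA f"
        by (simp add: polar_form_def algebra_simps)
      moreover have "e + f \<in> V" using es_V ef subV by (simp add: subspace_add)
      ultimately have "(e + f) * (e + f) = e * e + f * f"
        using quad es_V ef by (simp add: scale_left_distrib)
      then have "e * f + f * e = 0" by (simp add: distrib_left distrib_right algebra_simps)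
      then show ?thesis by (simp add: add_eq_0_iff2)
    qed
    show "a \<in> U" if U: "1 \<in> U" "subspace U" "\<And>e a. e \<in> set es \<Longrightarrow> a \<in> U \<Longrightarrow> e * a \<in> U" for a U
    proof (rule gen_induct[of "\<lambda>a. a \<in> U"])
      fix v a assume "v \<in> C" "a \<in> U"
      then have "v \<in> span (set es)" using span_base[of v C] by (simp add: span_es V_C)
      then show "v * a \<in> U" using U(2) by (rule span_mult(2)) (use U(3) \<open>a \<in> U\<close> in blast)
    qed (use U in \<open>auto intro: subspace_add subspace_scale\<close>)
  qed

  \<comment> \<open>\<open>V\<close> has \<open>n + 1\<close> generators, while fewer than \<open>n + 1\<close> basis vectors would give too few monomials.\<close>
  have "length es \<le> n + 1"
  proof -
    have "card (set es) = dim V" using dim_span_eq_card_independent[OF indep] span_es by simp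
    also have "\<dots> \<le> card C"
      by (rule dim_le_card) (auto simp: V_C C_def)
    also have "\<dots> \<le> Suc (card (X ` {1..n}))" unfolding C_def by (rule card_insert_le_m1) simp_all
    also have "\<dots> \<le> n + 1" using card_image_le[of "{1..n}" X] by simp
    finally show ?thesis using distinct_card[OF dist] by simp
  qed
  moreover have "n + 1 \<le> length es"
  proof -
    have "2 ^ (n + 1) \<le> card (prod_list ` set (subseqs es))"
      unfolding dim_A[symmetric] by (rule dim_le_card) (auto simp: monomials_span)
    also have "\<dots> \<le> length (subseqs es)"
      using card_image_le[of "set (subseqs es)" prod_list] card_length[of "subseqs es"] by simp
    also have "\<dots> = 2 ^ length es" by (rule length_subseqs)
    finally have "(2::nat) ^ (n + 1) \<le> 2 ^ length es" .
    then show ?thesis by (rule power_le_imp_le_exp[rotated]) simp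
  qed
  ultimately have len: "length es = n + 1" by simp

  interpret nondegenerate_clifford sA es "quad_form sA"
  proof
    fix e assume e: "e \<in> set es"
    show "quad_form sA e \<noteq> 0"
    proof
      assume "quad_form sA e = 0"
      then have "e * a * e = 0" for a using zero_square_nilpotent e by blast
      then have "e = 0" using semisimple_no_nilpotent[OF semisimple] by blast
      then show False using e indep dependent_zero by blast
    qed
  qed

  obtain f where f: "algebra_hom sA sA f" "\<forall>a\<in>C. f a = - a"
    using clifford_grade_involution[OF A] unfolding C_def by blast
  note h = algebra_homD[OF f(1)]
  \<comment> \<open>\<open>f\<close> is the identity on even and the negation on odd products, so it is the main involution.\<close>
  have f_inv: "f (f a) = a" for a
    by (rule gen_induct[of "\<lambda>a. f (f a) = a"]) (simp_all add: h f(2))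
  have fV: "f v = - v" if "v \<in> V" for v
    using that unfolding V_C
    by (induction rule: span_induct_alt) (simp_all add: h f(2))
  have f_prod: "f (prod_list vs) = (if even (length vs) then prod_list vs else - prod_list vs)"
    if "set vs \<subseteq> V" for vs
    using that by (induction vs) (auto simp: h fV)
  define Ev where "Ev = even_part sA V"
  define Od where "Od = odd_part sA V"
  have f_ev: "f t = t" if "t \<in> Ev" for t
    using that unfolding Ev_def even_part_def
    by (induction rule: span_induct_alt) (auto simp: h f_prod)
  have f_od: "f t = - t" if "t \<in> Od" for t
    using that unfolding Od_def odd_part_def
    by (induction rule: span_induct_alt) (auto simp: h f_prod)
  have ev_od: "v * t \<in> Od" if "v \<in> V" "t \<in> Ev" for v t
    using that(2) unfolding Ev_def even_part_def
  proof (rule span_mult(1))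
    fix b assume "b \<in> {prod_list vs |vs. set vs \<subseteq> V \<and> even (length vs)}"
    then obtain vs where vs: "b = prod_list vs" "set vs \<subseteq> V" "even (length vs)" by blast
    show "v * b \<in> Od"
      unfolding Od_def odd_part_def
      by (rule span_base, intro CollectI exI[of _ "v # vs"]) (use vs that(1) in auto)
  qed (simp add: Od_def odd_part_def)
  have od_ev: "v * t \<in> Ev" if "v \<in> V" "t \<in> Od" for v t
    using that(2) unfolding Od_def odd_part_def
  proof (rule span_mult(1))
    fix b assume "b \<in> {prod_list vs |vs. set vs \<subseteq> V \<and> odd (length vs)}"
    then obtain vs where vs: "b = prod_list vs" "set vs \<subseteq> V" "odd (length vs)" by blast
    show "v * b \<in> Ev"
      unfolding Ev_def even_part_def
      by (rule span_base, intro CollectI exI[of _ "v # vs"]) (use vs that(1) in auto)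
  qed (simp add: Ev_def even_part_def)
  have sub: "subspace Ev" "subspace Od" by (simp_all add: Ev_def Od_def even_part_def odd_part_def)
  have decomp: "\<exists>t\<in>Ev. \<exists>s\<in>Od. a = t + s" for a
  proof (rule gen_induct[of "\<lambda>a. \<exists>t\<in>Ev. \<exists>s\<in>Od. a = t + s"])
    have "prod_list [] \<in> Ev" unfolding Ev_def even_part_def
      by (intro span_base) (auto intro!: exI[of _ "[]"])
    then show "\<exists>t\<in>Ev. \<exists>s\<in>Od. 1 = t + s" using subspace_0[OF sub(2)] by (intro bexI[of _ 1] bexI[of _ 0]) auto
  next
    fix a b assume "\<exists>t\<in>Ev. \<exists>s\<in>Od. a = t + s" "\<exists>t\<in>Ev. \<exists>s\<in>Od. b = t + s"
    then obtain t s t' s' where "t \<in> Ev" "s \<in> Od" "a = t + s" "t' \<in> Ev" "s' \<in> Od" "b = t' + s'" by blast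
    then show "\<exists>t\<in>Ev. \<exists>s\<in>Od. a + b = t + s"
      using sub by (intro bexI[of _ "t + t'"] bexI[of _ "s + s'"]) (auto simp: subspace_add)
  next
    fix c a assume "\<exists>t\<in>Ev. \<exists>s\<in>Od. a = t + s"
    then obtain t s where "t \<in> Ev" "s \<in> Od" "a = t + s" by blast
    then show "\<exists>t\<in>Ev. \<exists>s\<in>Od. sA c a = t + s"
      using sub by (intro bexI[of _ "sA c t"] bexI[of _ "sA c s"]) (auto simp: subspace_scale scale_right_distrib)
  next
    fix v a assume "v \<in> C" "\<exists>t\<in>Ev. \<exists>s\<in>Od. a = t + s"
    then obtain t s where "v \<in> V" "t \<in> Ev" "s \<in> Od" "a = t + s" using span_base[of v C] V_C by blast
    then show "\<exists>t\<in>Ev. \<exists>s\<in>Od. v * a = t + s"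
      by (intro bexI[of _ "v * s"] bexI[of _ "v * t"]) (auto simp: distrib_left add.commute intro: ev_od od_ev)
  qed
  have \<sigma>f: "\<sigma> a = f a" for a
    unfolding \<sigma> main_involution_def Ev_def[symmetric] Od_def[symmetric]
  proof (rule the_equality)
    show "\<exists>t\<in>Ev. \<exists>s\<in>Od. a = t + s \<and> f a = t - s"
    proof -
      obtain t s where ts: "t \<in> Ev" "s \<in> Od" "a = t + s" using decomp[of a] by blast
      then have "f a = t - s" by (simp add: h f_ev f_od)
      with ts show ?thesis by blast
    qed
    show "b = f a" if "\<exists>t\<in>Ev. \<exists>s\<in>Od. a = t + s \<and> b = t - s" for b
      using that by (auto simp: h f_ev f_od)
  qed
  then have \<sigma>_f: "\<sigma> = f" by blast
  have fz: "f z = - z"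
    using f_prod[of es] es_V len n by (auto simp: es(2))
  have "odd_clifford sA es (quad_form sA)"
  proof
    show "odd (length es)" using len n by simp
    show "prod_list es \<noteq> sA c 1" for c
    proof
      assume c: "prod_list es = sA c 1"
      then have "f z = z" by (simp add: es(2) h)
      with fz have "z + z = 0" by (metis add.left_inverse)
      then have "z = 0" using half_double[OF two, of z] by simp
      then show False using prod_list_invertible[OF order_refl] es(2) by auto
    qed
  qed
  then show ?thesis
    using es(2) f(1) f_inv fz unfolding \<sigma>_f by blast
qed

section \<open>Linear maps on tensor products\<close>

text \<open>Tensors are functionals, hence functions; with the rules for pointwise evaluation the simplifier
  would turn sums of tensors (and \<open>id\<close> as an argument of a tensor map) into abstractions.\<close>

declare plus_fun_apply [simp del] zero_fun_apply [simp del] id_apply [simp del]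

lemma linearD:
  assumes "Vector_Spaces.linear s1 s2 f"
  shows "f (x + y) = f x + f y" "f (s1 r x) = s2 r (f x)" "f 0 = 0" "f (- x) = - f x"
    "f (x - y) = f x - f y" "f (sum h I) = (\<Sum>i\<in>I. f (h i))"
proof -
  interpret Vector_Spaces.linear s1 s2 f by fact
  show "f (x + y) = f x + f y" "f (s1 r x) = s2 r (f x)" "f 0 = 0" "f (- x) = - f x"
    "f (x - y) = f x - f y" "f (sum h I) = (\<Sum>i\<in>I. f (h i))"
    by (simp_all add: add scale neg diff sum)
qed

lemma linearI:
  assumes "vector_space s1" "vector_space s2"
    and "\<And>x y. f (x + y) = f x + f y" "\<And>r x. f (s1 r x) = s2 r (f x)"
  shows "Vector_Spaces.linear s1 s2 f"
  using assms
  by (auto simp: Vector_Spaces.linear_def module_hom_def module_hom_axioms_def module_iff_vector_space)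

text \<open>These are the maps \<open>id \<otimes> f\<close>, \<open>f \<otimes> id\<close> and \<open>F \<otimes> F'\<close>.\<close>

definition slice ::
  "('k::field \<Rightarrow> 'a::ab_group_add \<Rightarrow> 'a) \<Rightarrow> ('k \<Rightarrow> 'b::ab_group_add \<Rightarrow> 'b) \<Rightarrow>
     ('b \<Rightarrow> 'k) \<Rightarrow> ('a, 'b, 'k) tensor \<Rightarrow> 'a" where
  "slice sA sB f = tensor_lift sA sB sA (\<lambda>a b. sA (f b) a)"

definition left_slice ::
  "('k::field \<Rightarrow> 'a::ab_group_add \<Rightarrow> 'a) \<Rightarrow> ('k \<Rightarrow> 'b::ab_group_add \<Rightarrow> 'b) \<Rightarrow>
     ('a \<Rightarrow> 'k) \<Rightarrow> ('a, 'b, 'k) tensor \<Rightarrow> 'b" where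
  "left_slice sA sB f = tensor_lift sA sB sB (\<lambda>a b. sB (f a) b)"

definition tensor_map ::
  "('k::field \<Rightarrow> 'a::ab_group_add \<Rightarrow> 'a) \<Rightarrow> ('k \<Rightarrow> 'b::ab_group_add \<Rightarrow> 'b) \<Rightarrow>
     ('a \<Rightarrow> 'a) \<Rightarrow> ('b \<Rightarrow> 'b) \<Rightarrow> ('a, 'b, 'k) tensor \<Rightarrow> ('a, 'b, 'k) tensor" where
  "tensor_map sA sB F F' = tensor_lift sA sB tensor_scale (\<lambda>a b. tensor sA sB (F a) (F' b))"

locale tensor_pair = A: vector_space sA + B: vector_space sB
  for sA :: "'k::field \<Rightarrow> 'a::ab_group_add \<Rightarrow> 'a" and sB :: "'k \<Rightarrow> 'b::ab_group_add \<Rightarrow> 'b"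
begin

abbreviation tens (infix "\<otimes>" 75) where "a \<otimes> b \<equiv> tensor sA sB a b"
abbreviation "space \<equiv> tensor_space sA sB"

sublocale T: vector_space "tensor_scale :: 'k \<Rightarrow> ('a, 'b, 'k) tensor \<Rightarrow> ('a, 'b, 'k) tensor"
  by (rule vector_space_tensor_scale)

lemmas vs = A.vector_space_axioms B.vector_space_axioms
lemmas bilinear_iff = is_bilinear_iff[OF vs]
lemmas tensor_simps = tensor_add_scale[OF vs]

lemma tensor_zero [simp]: "0 \<otimes> b = 0" "a \<otimes> 0 = 0"
  using tensor_simps(4)[of 0 0 b] tensor_simps(3)[of a 0 0] by simp_all

lemma tensor_minus: "(- a) \<otimes> b = - (a \<otimes> b)" "a \<otimes> (- b) = - (a \<otimes> b)"
  using tensor_simps(2)[of a "- a" b] tensor_simps(1)[of a b "- b"]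
  by (simp_all add: add_eq_0_iff)

lemma tensor_sum_right: "a \<otimes> sum f I = (\<Sum>i\<in>I. a \<otimes> f i)"
  by (induction I rule: infinite_finite_induct) (simp_all add: tensor_simps)

lemma tensor_in_space [simp]: "a \<otimes> b \<in> space"
  unfolding tensor_space_def by (rule T.span_base) blast

lemma space_add: "t \<in> space \<Longrightarrow> t' \<in> space \<Longrightarrow> t + t' \<in> space"
  unfolding tensor_space_def by (rule T.span_add)

lemma space_scale: "t \<in> space \<Longrightarrow> tensor_scale r t \<in> space"
  unfolding tensor_space_def by (rule T.span_scale)

lemma space_sum: "(\<And>i. i \<in> I \<Longrightarrow> f i \<in> space) \<Longrightarrow> sum f I \<in> space"
  unfolding tensor_space_def by (rule T.span_sum)

lemma space_induct [consumes 1, case_names tensor add]: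
  assumes "t \<in> space" and "\<And>a b. P (a \<otimes> b)"
    and "\<And>s t. s \<in> space \<Longrightarrow> t \<in> space \<Longrightarrow> P s \<Longrightarrow> P t \<Longrightarrow> P (s + t)"
  shows "P t"
proof -
  have "t \<in> space \<and> P t"
    using assms(1) unfolding tensor_space_def
  proof (induction rule: T.span_induct_alt)
    case base
    show ?case using assms(2)[of 0 0] by (simp add: T.span_zero)
  next
    case (step r x y)
    then obtain a b where x: "x = a \<otimes> b" by blast
    have "tensor_scale r x = sA r a \<otimes> b" by (simp add: x tensor_simps)
    with step x show ?case
      using assms(2,3) tensor_in_space by (simp add: tensor_space_def T.span_add)
  qed
  then show ?thesis ..
qed

lemma slice:
  assumes "Vector_Spaces.linear sB (*) f"
  shows "Vector_Spaces.linear tensor_scale sA (slice sA sB f)"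
    and "slice sA sB f (a \<otimes> b) = sA (f b) a"
proof -
  have bil: "is_bilinear sA sB sA (\<lambda>a b. sA (f b) a)"
    unfolding bilinear_iff[OF A.vector_space_axioms]
    by (simp add: linearD[OF assms] A.scale_left_distrib A.scale_right_distrib mult.commute)
  show "Vector_Spaces.linear tensor_scale sA (slice sA sB f)"
    "slice sA sB f (a \<otimes> b) = sA (f b) a"
    unfolding slice_def
    by (rule tensor_lift[OF vs A.vector_space_axioms bil])+
qed

lemma left_slice:
  assumes "Vector_Spaces.linear sA (*) f"
  shows "Vector_Spaces.linear tensor_scale sB (left_slice sA sB f)"
    and "left_slice sA sB f (a \<otimes> b) = sB (f a) b"
proof -
  have bil: "is_bilinear sA sB sB (\<lambda>a b. sB (f a) b)"
    unfolding bilinear_iff[OF B.vector_space_axioms]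
    by (simp add: linearD[OF assms] B.scale_left_distrib B.scale_right_distrib mult.commute)
  show "Vector_Spaces.linear tensor_scale sB (left_slice sA sB f)"
    "left_slice sA sB f (a \<otimes> b) = sB (f a) b"
    unfolding left_slice_def
    by (rule tensor_lift[OF vs B.vector_space_axioms bil])+
qed

lemma tensor_map:
  assumes "Vector_Spaces.linear sA sA F" "Vector_Spaces.linear sB sB F'"
  shows "Vector_Spaces.linear tensor_scale tensor_scale (tensor_map sA sB F F')"
    and "tensor_map sA sB F F' (a \<otimes> b) = F a \<otimes> F' b"
    and "t \<in> space \<Longrightarrow> tensor_map sA sB F F' t \<in> space"
proof -
  have bil: "is_bilinear sA sB tensor_scale (\<lambda>a b. F a \<otimes> F' b)"
    unfolding bilinear_iff[OF vector_space_tensor_scale]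
    by (simp add: linearD[OF assms(1)] linearD[OF assms(2)] tensor_simps)
  show lin: "Vector_Spaces.linear tensor_scale tensor_scale (tensor_map sA sB F F')"
    and tens: "tensor_map sA sB F F' (a \<otimes> b) = F a \<otimes> F' b" for a b
    unfolding tensor_map_def
    by (rule tensor_lift[OF vs vector_space_tensor_scale bil])+
  show "t \<in> space \<Longrightarrow> tensor_map sA sB F F' t \<in> space"
    by (induction t rule: space_induct) (simp_all add: tens linearD[OF lin] space_add)
qed

lemma tensor_map_comp:
  assumes "Vector_Spaces.linear sA sA F" "Vector_Spaces.linear sB sB F'"
    and "Vector_Spaces.linear sA sA H" "Vector_Spaces.linear sB sB H'" and "t \<in> space"
  shows "tensor_map sA sB F F' (tensor_map sA sB H H' t) =
    tensor_map sA sB (\<lambda>a. F (H a)) (\<lambda>b. F' (H' b)) t"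
proof -
  have lin: "Vector_Spaces.linear sA sA (\<lambda>a. F (H a))" "Vector_Spaces.linear sB sB (\<lambda>b. F' (H' b))"
    using Vector_Spaces.linear_compose[OF assms(3,1)] Vector_Spaces.linear_compose[OF assms(4,2)]
    by (simp_all add: comp_def)
  from assms(5) show ?thesis
    by (induction t rule: space_induct)
      (simp_all add: assms tensor_map[OF lin] tensor_map
        linearD[OF tensor_map(1)[OF assms(1,2)]] linearD[OF tensor_map(1)[OF assms(3,4)]]
        linearD[OF tensor_map(1)[OF lin]])
qed

lemma slice_tensor_map:
  assumes "Vector_Spaces.linear sA sA F" "Vector_Spaces.linear sB sB F'"
    and "Vector_Spaces.linear sB (*) f" and "t \<in> space"
  shows "slice sA sB f (tensor_map sA sB F F' t) = F (slice sA sB (\<lambda>b. f (F' b)) t)"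
proof -
  have lin: "Vector_Spaces.linear sB (*) (\<lambda>b. f (F' b))"
    using Vector_Spaces.linear_compose[OF assms(2,3)] by (simp add: comp_def)
  from assms(4) show ?thesis
    by (induction t rule: space_induct)
      (simp_all add: assms tensor_map slice lin linearD[OF assms(1)]
        linearD[OF tensor_map(1)[OF assms(1,2)]] linearD[OF slice(1)[OF assms(3)]]
        linearD[OF slice(1)[OF lin]])
qed

lemma slice_uminus:
  assumes "Vector_Spaces.linear sB (*) f" and "t \<in> space"
  shows "slice sA sB (\<lambda>b. - f b) t = - slice sA sB f t"
proof -
  have lin: "Vector_Spaces.linear sB (*) (\<lambda>b. - f b)"
    by (rule linearI[OF B.vector_space_axioms vector_space_mult])
      (simp_all add: linearD[OF assms(1)])
  from assms(2) show ?thesis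
    by (induction t rule: space_induct)
      (simp_all add: slice assms lin linearD[OF slice(1)[OF assms(1)]] linearD[OF slice(1)[OF lin]])
qed

end

locale algebra_pair = A: k_algebra sA + B: k_algebra sB
  for sA :: "'k::field \<Rightarrow> 'a::ring_1 \<Rightarrow> 'a" and sB :: "'k \<Rightarrow> 'b::ring_1 \<Rightarrow> 'b"
begin

sublocale tensor_pair sA sB ..

abbreviation tmult (infixl "\<bullet>" 70) where "s \<bullet> t \<equiv> tensor_mult sA sB s t"

lemmas algebras = A.k_algebra_axioms B.k_algebra_axioms

lemma mult_tensor [simp]: "(a \<otimes> b) \<bullet> (a' \<otimes> b') = (a * a') \<otimes> (b * b')"
  by (rule tensor_mult_tensor[OF algebras tensor_in_space[of 0 0]])

lemma mult_add_left: "t' \<in> space \<Longrightarrow> (s + t) \<bullet> t' = s \<bullet> t' + t \<bullet> t'"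
  using linearD(1)[OF linear_tensor_mult_left[OF algebras]] .

lemma mult_add_right:
  assumes "t \<in> space" "s \<in> space" "s' \<in> space"
  shows "t \<bullet> (s + s') = t \<bullet> s + t \<bullet> s'"
  using assms(1)
proof (induction t rule: space_induct)
  case (tensor a b)
  have bil: "is_bilinear sA sB tensor_scale (\<lambda>a' b'. (a * a') \<otimes> (b * b'))"
    unfolding bilinear_iff[OF vector_space_tensor_scale]
    by (simp add: distrib_left A.scale_mult_right B.scale_mult_right tensor_simps)
  show ?case
    using assms linearD(1)[OF tensor_lift(1)[OF vs vector_space_tensor_scale bil]]
    by (simp add: tensor_mult_tensor_left[OF algebras] space_add)
next
  case (add t t')
  then show ?case using assms by (simp add: mult_add_left space_add add_ac)
qed

lemma mult_in_space: "s \<in> space \<Longrightarrow> t \<in> space \<Longrightarrow> s \<bullet> t \<in> space"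
proof (induction s rule: space_induct)
  case (tensor a b)
  from \<open>t \<in> space\<close> show ?case
    by (induction t rule: space_induct) (simp_all add: mult_add_right space_add)
qed (simp add: mult_add_left space_add)

lemma biadditive_eq:
  assumes "s \<in> space" "t \<in> space" and "\<And>a b a' b'. F (a \<otimes> b) (a' \<otimes> b') = F' (a \<otimes> b) (a' \<otimes> b')"
    and "\<And>s s' t. s \<in> space \<Longrightarrow> s' \<in> space \<Longrightarrow> t \<in> space \<Longrightarrow> F (s + s') t = F s t + F s' t"
    and "\<And>s s' t. s \<in> space \<Longrightarrow> s' \<in> space \<Longrightarrow> t \<in> space \<Longrightarrow> F' (s + s') t = F' s t + F' s' t"
    and "\<And>s t t'. s \<in> space \<Longrightarrow> t \<in> space \<Longrightarrow> t' \<in> space \<Longrightarrow> F s (t + t') = F s t + F s t'"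
    and "\<And>s t t'. s \<in> space \<Longrightarrow> t \<in> space \<Longrightarrow> t' \<in> space \<Longrightarrow> F' s (t + t') = F' s t + F' s t'"
  shows "(F s t :: 'c::ab_group_add) = F' s t"
  using assms(1)
proof (induction s rule: space_induct)
  case (tensor a b)
  from assms(2) show ?case
    by (induction t rule: space_induct) (simp_all add: assms)
qed (simp add: assms)

lemma slice_mult_skew:
  assumes lin: "Vector_Spaces.linear sB (*) f" "Vector_Spaces.linear sB (*) p" "Vector_Spaces.linear sB (*) q"
    and f: "\<And>b b'. f (b * b') = f b * p b' + q b * f b'"
    and st: "s \<in> space" "t \<in> space"
  shows "slice sA sB f (s \<bullet> t) =
    slice sA sB f s * slice sA sB p t + slice sA sB q s * slice sA sB f t"
  using st
  by (rule biadditive_eq[where F = "\<lambda>s t. slice sA sB f (s \<bullet> t)"])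
    (simp_all add: slice lin linearD[OF slice(1)[OF lin(1)]] linearD[OF slice(1)[OF lin(2)]]
      linearD[OF slice(1)[OF lin(3)]] f mult_add_left mult_add_right distrib_left distrib_right
      A.scale_mult_left A.scale_mult_right A.scale_left_distrib mult.commute)

lemma slice_mult:
  assumes lin: "Vector_Spaces.linear sB (*) f"
    and f: "\<And>b b'. f (b * b') = f b * f b'"
    and st: "s \<in> space" "t \<in> space"
  shows "slice sA sB f (s \<bullet> t) = slice sA sB f s * slice sA sB f t"
  using st
  by (rule biadditive_eq[where F = "\<lambda>s t. slice sA sB f (s \<bullet> t)"])
    (simp_all add: slice lin linearD[OF slice(1)[OF lin(1)]] f mult_add_left mult_add_right
      distrib_left distrib_right A.scale_mult_left A.scale_mult_right mult.commute)

lemma left_slice_mult_skew: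
  assumes lin: "Vector_Spaces.linear sA (*) f" "Vector_Spaces.linear sA (*) p" "Vector_Spaces.linear sA (*) q"
    and f: "\<And>b b'. f (b * b') = f b * p b' + q b * f b'"
    and st: "s \<in> space" "t \<in> space"
  shows "left_slice sA sB f (s \<bullet> t) =
    left_slice sA sB f s * left_slice sA sB p t + left_slice sA sB q s * left_slice sA sB f t"
  using st
  by (rule biadditive_eq[where F = "\<lambda>s t. left_slice sA sB f (s \<bullet> t)"])
    (simp_all add: left_slice lin linearD[OF left_slice(1)[OF lin(1)]] linearD[OF left_slice(1)[OF lin(2)]]
      linearD[OF left_slice(1)[OF lin(3)]] f mult_add_left mult_add_right distrib_left distrib_right
      B.scale_mult_left B.scale_mult_right B.scale_left_distrib mult.commute)

lemma left_slice_mult: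
  assumes lin: "Vector_Spaces.linear sA (*) f"
    and f: "\<And>b b'. f (b * b') = f b * f b'"
    and st: "s \<in> space" "t \<in> space"
  shows "left_slice sA sB f (s \<bullet> t) = left_slice sA sB f s * left_slice sA sB f t"
  using st
  by (rule biadditive_eq[where F = "\<lambda>s t. left_slice sA sB f (s \<bullet> t)"])
    (simp_all add: left_slice lin linearD[OF left_slice(1)[OF lin(1)]] f mult_add_left mult_add_right
      distrib_left distrib_right B.scale_mult_left B.scale_mult_right mult.commute)

lemma tensor_map_mult:
  assumes lin: "Vector_Spaces.linear sA sA F" "Vector_Spaces.linear sB sB F'"
    and mult: "\<And>a a'. F (a * a') = F a * F a'" "\<And>b b'. F' (b * b') = F' b * F' b'"
    and st: "s \<in> space" "t \<in> space"
  shows "tensor_map sA sB F F' (s \<bullet> t) = tensor_map sA sB F F' s \<bullet> tensor_map sA sB F F' t"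
  using st
  by (rule biadditive_eq[where F = "\<lambda>s t. tensor_map sA sB F F' (s \<bullet> t)"])
    (simp_all add: tensor_map lin linearD[OF tensor_map(1)[OF lin]] mult mult_add_left mult_add_right)

lemma tensor_map_skew_right:
  assumes lin: "Vector_Spaces.linear sB sB R" "Vector_Spaces.linear sB sB \<Gamma>"
    and R: "\<And>b b'. R (b * b') = R b * b' + \<Gamma> b * R b'"
    and st: "s \<in> space" "t \<in> space"
  shows "tensor_map sA sB id R (s \<bullet> t) =
    tensor_map sA sB id R s \<bullet> t + tensor_map sA sB id \<Gamma> s \<bullet> tensor_map sA sB id R t"
proof -
  note l1 = A.linear_id lin(1) and l2 = A.linear_id lin(2)
  show ?thesis
    using st
    by (rule biadditive_eq[where F = "\<lambda>s t. tensor_map sA sB id R (s \<bullet> t)"])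
      (simp_all add: tensor_map[OF l1] tensor_map[OF l2] linearD[OF tensor_map(1)[OF l1]]
        linearD[OF tensor_map(1)[OF l2]] R mult_add_left mult_add_right tensor_simps space_add add_ac,
        simp add: id_apply)
qed

lemma tensor_map_skew_left:
  assumes lin: "Vector_Spaces.linear sA sA R" "Vector_Spaces.linear sA sA \<Gamma>"
    and R: "\<And>b b'. R (b * b') = R b * b' + \<Gamma> b * R b'"
    and st: "s \<in> space" "t \<in> space"
  shows "tensor_map sA sB R id (s \<bullet> t) =
    tensor_map sA sB R id s \<bullet> t + tensor_map sA sB \<Gamma> id s \<bullet> tensor_map sA sB R id t"
proof -
  note l1 = lin(1) B.linear_id and l2 = lin(2) B.linear_id
  show ?thesis
    using st
    by (rule biadditive_eq[where F = "\<lambda>s t. tensor_map sA sB R id (s \<bullet> t)"])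
      (simp_all add: tensor_map[OF l1] tensor_map[OF l2] linearD[OF tensor_map(1)[OF l1]]
        linearD[OF tensor_map(1)[OF l2]] R mult_add_left mult_add_right tensor_simps space_add add_ac,
        simp add: id_apply)
qed

end

declare id_apply [simp]

text \<open>Upper triangular matrices of size two.  A homomorphism into them with diagonal entries \<open>p, q\<close> is the
  same as two characters together with a \<open>(p, q)\<close>-skew derivation, the off-diagonal entry.  This
  yields the functionals \<open>\<xi>\<^sub>i\<close> from the universal property of \<open>E(n)\<close>.\<close>

datatype 'k triangular = Tri (corner: 'k) (off: 'k) (corner': 'k)

instantiation triangular :: (field) ring_1
begin
definition "0 = Tri 0 0 0"
definition "1 = Tri 1 0 1"
definition "s + t = Tri (corner s + corner t) (off s + off t) (corner' s + corner' t)"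
definition "- t = Tri (- corner t) (- off t) (- corner' t)"
definition "s - (t::'a triangular) = s + - t"
definition "s * t = Tri (corner s * corner t) (corner s * off t + off s * corner' t) (corner' s * corner' t)"
instance
  by standard
    (simp_all add: zero_triangular_def one_triangular_def plus_triangular_def uminus_triangular_def
      minus_triangular_def times_triangular_def algebra_simps triangular.expand)
end

section \<open>Anticommuting families of operators\<close>

text \<open>The sign of the permutation that moves \<open>i\<close> from the front to its place in a sorted list.\<close>

fun insort_sign :: "nat \<Rightarrow> nat list \<Rightarrow> 'k::field" where
  "insort_sign i [] = 1"
| "insort_sign i (j # L) = (if i \<le> j then 1 else - insort_sign i L)"

lemma foldr_anticommuting:
  assumes lin: "\<And>i. i \<in> N \<Longrightarrow> Vector_Spaces.linear s s (D i)"
    and anti: "\<And>i j a. i \<in> N \<Longrightarrow> j \<in> N \<Longrightarrow> D i (D j a) = - D j (D i a)"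
    and nil: "\<And>i a. i \<in> N \<Longrightarrow> D i (D i a) = 0"
    and L: "i \<in> N" "set L \<subseteq> N"
  shows "D i (foldr D L a) =
    (if i \<in> set L then 0 else s (insort_sign i L) (foldr D (insort i L) a))"
  using L(2)
proof (induction L)
  case Nil
  interpret Vector_Spaces.linear s s "D i" by (rule lin[OF L(1)])
  show ?case by simp
next
  case (Cons j L)
  interpret Vector_Spaces.linear s s "D j" using lin Cons.prems by simp
  have j: "j \<in> N" using Cons.prems by simp
  have anti_j: "D i (D j (foldr D L a)) = - D j (D i (foldr D L a))" by (rule anti[OF L(1) j])
  have IH: "D i (foldr D L a) = (if i \<in> set L then 0 else s (insort_sign i L) (foldr D (insort i L) a))"
    using Cons by simp
  consider "i = j" | "i \<noteq> j" "i \<in> set L" | "i \<noteq> j" "i \<notin> set L" "i \<le> j"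
    | "i \<noteq> j" "i \<notin> set L" "\<not> i \<le> j" by blast
  then show ?case
  proof cases
    case 1
    have "D j (D j (foldr D L a)) = 0" by (rule nil[OF j])
    with 1 show ?thesis by simp
  next
    case 2
    then show ?thesis using anti_j IH by (simp add: zero)
  next
    case 3
    then show ?thesis by simp
  next
    case 4
    then show ?thesis using anti_j IH by (simp add: scale)
  qed
qed

lemma sum_Pow_split:
  fixes f :: "nat set \<Rightarrow> 'b::comm_monoid_add"
  assumes "finite N" "i \<in> N"
  shows "(\<Sum>P\<in>Pow N. f P) = (\<Sum>P\<in>Pow (N - {i}). f P) + (\<Sum>P\<in>Pow (N - {i}). f (insert i P))"
proof -
  have "Pow N = Pow (N - {i}) \<union> insert i ` Pow (N - {i})"
    using assms(2) Pow_insert[of i "N - {i}"] by (simp add: insert_absorb)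
  moreover have inj: "inj_on (insert i) (Pow (N - {i}))"
    by (rule inj_onI) (auto simp: insert_eq_iff)
  moreover have "sum f (Pow (N - {i}) \<union> insert i ` Pow (N - {i})) =
      sum f (Pow (N - {i})) + sum f (insert i ` Pow (N - {i}))"
    by (rule sum.union_disjoint) (use assms(1) in auto)
  ultimately show ?thesis by (simp add: sum.reindex[OF inj] comp_def)
qed

text \<open>The sign \<open>(-1)^floor((m + 1) / 2)\<close> of the statement.\<close>

definition taylor_sign :: "nat \<Rightarrow> 'k::field" where
  "taylor_sign m = (- 1) ^ ((m + 1) div 2)"

text \<open>The recursion behind the sign: an iterated derivative of \<open>x\<^sub>P\<close> picks up a factor \<open>-g\<close> at each step,
  and this \<open>g\<close> anticommutes with the operators that are applied later.\<close>

lemma taylor_sign_Suc: "taylor_sign (Suc m) = - ((- 1) ^ m * taylor_sign m)"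
proof (cases "even m")
  case True
  then obtain k where "m = 2 * k" by (elim evenE)
  then show ?thesis by (simp add: taylor_sign_def)
next
  case False
  then obtain k where "m = 2 * k + 1" by (elim oddE)
  then show ?thesis by (simp add: taylor_sign_def)
qed

lemma taylor_sign_square [simp]: "taylor_sign m * taylor_sign m = 1"
  by (simp add: taylor_sign_def flip: power_mult_distrib)

lemma taylor_sign_sandwich [simp]: "taylor_sign m * (c * taylor_sign m) = c"
  by (metis mult.left_commute mult_1_right taylor_sign_square)

lemma (in k_algebra) neg_one_power_mult: "(- 1) ^ m * a = scale ((- 1) ^ m) a"
  by (induction m) simp_all

section \<open>The Hopf algebra E(n)\<close>

definition triangular_scale :: "'k::field \<Rightarrow> 'k triangular \<Rightarrow> 'k triangular" where
  "triangular_scale c t = Tri (c * corner t) (c * off t) (c * corner' t)"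

lemmas triangular_defs = triangular_scale_def zero_triangular_def one_triangular_def
  plus_triangular_def uminus_triangular_def minus_triangular_def times_triangular_def

lemma k_algebra_triangular: "k_algebra triangular_scale"
  by unfold_locales (simp_all add: triangular_defs algebra_simps)

locale E_hopf =
  fixes sH :: "'k::field \<Rightarrow> 'h::ring_1 \<Rightarrow> 'h" and n :: nat and g :: 'h and x :: "nat \<Rightarrow> 'h"
    and \<Delta> :: "'h \<Rightarrow> ('h, 'h, 'k) tensor" and \<epsilon> :: "'h \<Rightarrow> 'k" and S :: "'h \<Rightarrow> 'h"
  assumes two: "(2::'k) \<noteq> 0" and E: "is_E sH n g x \<Delta> \<epsilon> S"
begin

lemma presented: "presented_by sH (case_generator g x) (generators n) (E_relations n)"
  using E by (simp add: is_E_def)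

sublocale H: k_algebra sH
  using presented by (simp add: presented_by_def)

sublocale HH: algebra_pair sH sH ..

lemma coaction: "is_right_coaction sH sH \<Delta> \<epsilon> \<Delta>"
  using E by (simp add: is_E_def is_hopf_algebra_def)

lemma \<Delta>_linear: "Vector_Spaces.linear sH tensor_scale \<Delta>"
  and \<Delta>_coassoc: "is_coassociative sH sH \<Delta> \<Delta>"
  and \<Delta>_space [simp]: "\<Delta> h \<in> HH.space"
  and \<Delta>_counit_right: "slice sH sH \<epsilon> (\<Delta> h) = h"
  and \<Delta>_mult: "\<Delta> (h * h') = HH.tmult (\<Delta> h) (\<Delta> h')"
  and \<Delta>_one: "\<Delta> 1 = HH.tens 1 1"
  using coaction by (auto simp: is_right_coaction_def is_right_comodule_def slice_def)

lemma \<Delta>_counit_left: "left_slice sH sH \<epsilon> (\<Delta> h) = h"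
  and \<epsilon>_linear: "Vector_Spaces.linear sH (*) \<epsilon>"
  and \<epsilon>_mult: "\<epsilon> (h * h') = \<epsilon> h * \<epsilon> h'"
  and \<epsilon>_one: "\<epsilon> 1 = 1" and \<epsilon>_g: "\<epsilon> g = 1" and \<Delta>_g: "\<Delta> g = HH.tens g g"
  and \<Delta>_x: "i \<in> {1..n} \<Longrightarrow> \<Delta> (x i) = HH.tens (x i) g + HH.tens 1 (x i)"
  and \<epsilon>_x: "i \<in> {1..n} \<Longrightarrow> \<epsilon> (x i) = 0"
  using E by (auto simp: is_E_def is_hopf_algebra_def left_slice_def)

lemmas \<epsilon>_simps = linearD[OF \<epsilon>_linear] \<epsilon>_mult \<epsilon>_one \<epsilon>_g \<epsilon>_x

lemma relations:
  shows g_g: "g * g = 1"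
    and x_x: "i \<in> {1..n} \<Longrightarrow> x i * x i = 0"
    and x_g: "i \<in> {1..n} \<Longrightarrow> x i * g = - (g * x i)"
    and x_anti: "i \<in> {1..n} \<Longrightarrow> j \<in> {1..n} \<Longrightarrow> x i * x j = - (x j * x i)"
proof -
  note rel = presented_relations[OF presented]
  have "letter GenG * letter GenG - 1 \<in> E_relations n"
    unfolding E_relations_def Let_def by blast
  from rel[OF this] show "g * g = 1" by simp
  show "x i * x i = 0" if "i \<in> {1..n}" for i
  proof -
    have "letter (GenX i) * letter (GenX i) \<in> E_relations n"
      unfolding E_relations_def Let_def using that by blast
    from rel[OF this] show ?thesis by simp
  qed
  show "x i * g = - (g * x i)" if "i \<in> {1..n}" for i
  proof -
    have "letter GenG * letter (GenX i) + letter (GenX i) * letter GenG \<in> E_relations n"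
      unfolding E_relations_def Let_def using that by blast
    from rel[OF this] show ?thesis by (simp add: add_eq_0_iff)
  qed
  show "x i * x j = - (x j * x i)" if "i \<in> {1..n}" "j \<in> {1..n}" for i j
  proof -
    have "letter (GenX i) * letter (GenX j) + letter (GenX j) * letter (GenX i) \<in> E_relations n"
      unfolding E_relations_def Let_def using that by blast
    from rel[OF this] show ?thesis by (simp add: add_eq_0_iff2)
  qed
qed

lemma g_g_mult [simp]: "g * (g * h) = h"
  by (simp add: g_g flip: mult.assoc)

lemma induct [case_names one add scale g x]:
  assumes "P 1" "\<And>a b. P a \<Longrightarrow> P b \<Longrightarrow> P (a + b)" "\<And>c a. P a \<Longrightarrow> P (sH c a)"
    "\<And>a. P a \<Longrightarrow> P (g * a)" "\<And>i a. i \<in> {1..n} \<Longrightarrow> P a \<Longrightarrow> P (x i * a)"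
  shows "P h"
  by (rule presented_induct[OF presented]) (use assms in \<open>auto simp: generators_def\<close>)

text \<open>The representation with \<open>g \<mapsto> diag(-1, 1)\<close>, and \<open>x\<^sub>i\<close> strictly triangular and nonzero only for \<open>i = j\<close>.
  Its diagonal entries are \<open>\<gamma>\<close> and \<open>\<epsilon>\<close> for every \<open>j\<close>.  The index \<open>0\<close>, used to define \<open>\<gamma>\<close>, does not
  belong to any \<open>x\<^sub>i\<close>.\<close>

definition rep :: "nat \<Rightarrow> 'h \<Rightarrow> 'k triangular" where
  "rep j = (SOME f. algebra_hom sH triangular_scale f \<and> f g = Tri (- 1) 0 1 \<and>
     (\<forall>i\<in>{1..n}. f (x i) = Tri 0 (if i = j then - 1 else 0) 0))"

lemma rep:
  shows rep_hom: "algebra_hom sH triangular_scale (rep j)"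
    and rep_g: "rep j g = Tri (- 1) 0 1"
    and rep_x: "i \<in> {1..n} \<Longrightarrow> rep j (x i) = Tri 0 (if i = j then - 1 else 0) 0"
proof -
  interpret T: k_algebra "triangular_scale :: 'k \<Rightarrow> _" by (rule k_algebra_triangular)
  let ?gen = "case_generator (Tri (- 1) 0 1) (\<lambda>i. Tri 0 (if i = j then - 1 else (0::'k)) 0)"
  have "evaluate triangular_scale ?gen r = 0" if "r \<in> E_relations n" for r
    using that by (auto simp: E_relations_def Let_def triangular_defs)
  from presented_lift[OF presented k_algebra_triangular this]
  obtain f where f: "algebra_hom sH triangular_scale f"
    "\<forall>i\<in>generators n. f (case_generator g x i) = ?gen i" by blast
  have "f g = Tri (- 1) 0 1" using bspec[OF f(2), of GenG] by (simp add: generators_def)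
  moreover have "\<forall>i\<in>{1..n}. f (x i) = Tri 0 (if i = j then - 1 else 0) 0"
  proof
    fix i assume "i \<in> {1..n}"
    then show "f (x i) = Tri 0 (if i = j then - 1 else 0) 0"
      using bspec[OF f(2), of "GenX i"] by (simp add: generators_def)
  qed
  ultimately have "\<exists>f. algebra_hom sH triangular_scale f \<and> f g = Tri (- 1) 0 1 \<and>
     (\<forall>i\<in>{1..n}. f (x i) = Tri 0 (if i = j then - 1 else 0) 0)" using f(1) by blast
  from someI_ex[OF this]
  show "algebra_hom sH triangular_scale (rep j)" "rep j g = Tri (- 1) 0 1"
    "i \<in> {1..n} \<Longrightarrow> rep j (x i) = Tri 0 (if i = j then - 1 else 0) 0"
    unfolding rep_def by blast+
qed

definition \<gamma> :: "'h \<Rightarrow> 'k" where "\<gamma> h = corner (rep 0 h)"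
definition \<xi> :: "nat \<Rightarrow> 'h \<Rightarrow> 'k" where "\<xi> j h = off (rep j h)"

lemma rep_eq: "rep j h = Tri (\<gamma> h) (\<xi> j h) (\<epsilon> h)"
proof -
  note h = algebra_homD[OF rep_hom]
  have "corner (rep j h) = corner (rep 0 h) \<and> corner' (rep j h) = \<epsilon> h"
    by (induction h rule: induct) (simp_all add: h rep_g rep_x triangular_defs \<epsilon>_simps)
  then show ?thesis by (cases "rep j h") (simp add: \<gamma>_def \<xi>_def)
qed

lemma \<gamma>_linear: "Vector_Spaces.linear sH (*) \<gamma>"
  and \<xi>_linear: "Vector_Spaces.linear sH (*) (\<xi> j)"
  and \<gamma>_mult: "\<gamma> (h * h') = \<gamma> h * \<gamma> h'"
  and \<xi>_mult: "\<xi> j (h * h') = \<xi> j h * \<epsilon> h' + \<gamma> h * \<xi> j h'"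
  and \<gamma>_one: "\<gamma> 1 = 1" and \<gamma>_g: "\<gamma> g = - 1" and \<gamma>_x: "i \<in> {1..n} \<Longrightarrow> \<gamma> (x i) = 0"
  and \<xi>_one: "\<xi> j 1 = 0" and \<xi>_g: "\<xi> j g = 0"
  and \<xi>_x: "i \<in> {1..n} \<Longrightarrow> \<xi> j (x i) = (if i = j then - 1 else 0)"
proof -
  note h = algebra_homD[OF rep_hom]
  have eqs: "\<gamma> (a + b) = \<gamma> a + \<gamma> b" "\<xi> j (a + b) = \<xi> j a + \<xi> j b" "\<gamma> (sH r a) = r * \<gamma> a"
    "\<xi> j (sH r a) = r * \<xi> j a" "\<gamma> (a * b) = \<gamma> a * \<gamma> b"
    "\<xi> j (a * b) = \<xi> j a * \<epsilon> b + \<gamma> a * \<xi> j b" for a b r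
    using h(1)[of j a b] h(2)[of j r a] h(4)[of j a b]
    unfolding rep_eq by (simp_all add: triangular_defs)
  show "Vector_Spaces.linear sH (*) \<gamma>" "Vector_Spaces.linear sH (*) (\<xi> j)"
    by (rule linearI[OF H.vector_space_axioms vector_space_mult]; simp add: eqs)+
  show "\<gamma> (h * h') = \<gamma> h * \<gamma> h'" "\<xi> j (h * h') = \<xi> j h * \<epsilon> h' + \<gamma> h * \<xi> j h'"
    by (simp_all add: eqs)
  show "\<gamma> 1 = 1" "\<xi> j 1 = 0" using h(3)[of j] unfolding rep_eq by (simp_all add: triangular_defs)
  show "\<gamma> g = - 1" "\<xi> j g = 0" using rep_g[of j] unfolding rep_eq by simp_all
  show "i \<in> {1..n} \<Longrightarrow> \<gamma> (x i) = 0" "i \<in> {1..n} \<Longrightarrow> \<xi> j (x i) = (if i = j then - 1 else 0)"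
    using rep_x[of i j] unfolding rep_eq by simp_all
qed

definition \<Gamma> :: "'h \<Rightarrow> 'h" where "\<Gamma> h = left_slice sH sH \<gamma> (\<Delta> h)"
definition R :: "nat \<Rightarrow> 'h \<Rightarrow> 'h" where "R i h = left_slice sH sH (\<xi> i) (\<Delta> h)"

lemma left_slice_\<Delta>_linear:
  assumes "Vector_Spaces.linear sH (*) f"
  shows "Vector_Spaces.linear sH sH (\<lambda>h. left_slice sH sH f (\<Delta> h))"
  using Vector_Spaces.linear_compose[OF \<Delta>_linear HH.left_slice(1)[OF assms]] by (simp add: comp_def)

lemma slice_\<Delta>_linear:
  assumes "Vector_Spaces.linear sH (*) f"
  shows "Vector_Spaces.linear sH sH (\<lambda>h. slice sH sH f (\<Delta> h))"
  using Vector_Spaces.linear_compose[OF \<Delta>_linear HH.slice(1)[OF assms]] by (simp add: comp_def)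

lemma \<Gamma>_linear: "Vector_Spaces.linear sH sH \<Gamma>"
  and R_linear: "Vector_Spaces.linear sH sH (R i)"
  using left_slice_\<Delta>_linear[OF \<gamma>_linear] left_slice_\<Delta>_linear[OF \<xi>_linear]
  by (simp_all add: \<Gamma>_def[abs_def] R_def[abs_def])

lemma \<Gamma>_mult: "\<Gamma> (h * h') = \<Gamma> h * \<Gamma> h'"
  unfolding \<Gamma>_def \<Delta>_mult by (rule HH.left_slice_mult[OF \<gamma>_linear \<gamma>_mult]) simp_all

lemma R_mult: "R i (h * h') = R i h * h' + \<Gamma> h * R i h'"
proof -
  have "R i (h * h') = R i h * left_slice sH sH \<epsilon> (\<Delta> h') + \<Gamma> h * R i h'"
    unfolding R_def \<Gamma>_def \<Delta>_mult
    by (rule HH.left_slice_mult_skew[OF \<xi>_linear \<epsilon>_linear \<gamma>_linear \<xi>_mult]) simp_all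
  then show ?thesis by (simp add: \<Delta>_counit_left)
qed

lemma \<Gamma>_one: "\<Gamma> 1 = 1" and \<Gamma>_g: "\<Gamma> g = - g" and \<Gamma>_x: "i \<in> {1..n} \<Longrightarrow> \<Gamma> (x i) = x i"
  and R_one: "R j 1 = 0" and R_g: "R j g = 0"
  and R_x: "i \<in> {1..n} \<Longrightarrow> R j (x i) = (if i = j then - g else 0)"
  by (simp_all add: \<Gamma>_def R_def \<Delta>_one \<Delta>_g \<Delta>_x HH.left_slice \<gamma>_linear \<xi>_linear \<gamma>_one \<gamma>_g \<gamma>_x
      \<xi>_one \<xi>_g \<xi>_x linearD[OF HH.left_slice(1)[OF \<gamma>_linear]] linearD[OF HH.left_slice(1)[OF \<xi>_linear]])

lemmas \<Gamma>_simps = linearD[OF \<Gamma>_linear] \<Gamma>_mult \<Gamma>_one \<Gamma>_g \<Gamma>_x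
lemmas R_simps = linearD[OF R_linear] R_mult R_one R_g R_x

lemma \<Gamma>_\<Gamma>: "\<Gamma> (\<Gamma> h) = h"
  by (induction h rule: induct) (simp_all add: \<Gamma>_simps)

lemma R_\<Gamma>: "R i (\<Gamma> h) = - \<Gamma> (R i h)"
  by (induction h rule: induct) (simp_all add: \<Gamma>_simps R_simps)

text \<open>The sum \<open>R\<^sub>i R\<^sub>j + R\<^sub>j R\<^sub>i\<close> is an ordinary derivation, because the cross terms cancel by
  \<open>R_\<Gamma>\<close>, and it vanishes on the generators.\<close>

lemma R_R: "R i (R j h) = - R j (R i h)"
  by (induction h rule: induct) (simp_all add: \<Gamma>_simps R_simps R_\<Gamma> \<Gamma>_\<Gamma>)

lemma counit_left_slice:
  assumes f: "Vector_Spaces.linear sH (*) f"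
  shows "\<epsilon> (left_slice sH sH f (\<Delta> h)) = f h"
proof -
  have "\<epsilon> (left_slice sH sH f t) = f (slice sH sH \<epsilon> t)" if "t \<in> HH.space" for t
    using that
    by (induction t rule: HH.space_induct)
      (simp_all add: HH.left_slice HH.slice f \<epsilon>_linear \<epsilon>_simps linearD[OF f] mult.commute
        linearD[OF HH.left_slice(1)[OF f]] linearD[OF HH.slice(1)[OF \<epsilon>_linear]])
  from this[OF \<Delta>_space] show ?thesis by (simp add: \<Delta>_counit_right)
qed

lemma counit_slice:
  assumes f: "Vector_Spaces.linear sH (*) f"
  shows "\<epsilon> (slice sH sH f (\<Delta> h)) = f h"
proof -
  have "\<epsilon> (slice sH sH f t) = f (left_slice sH sH \<epsilon> t)" if "t \<in> HH.space" for t
    using that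
    by (induction t rule: HH.space_induct)
      (simp_all add: HH.left_slice HH.slice f \<epsilon>_linear \<epsilon>_simps linearD[OF f] mult.commute
        linearD[OF HH.slice(1)[OF f]] linearD[OF HH.left_slice(1)[OF \<epsilon>_linear]])
  from this[OF \<Delta>_space] show ?thesis by (simp add: \<Delta>_counit_left)
qed

lemma \<epsilon>_\<Gamma>: "\<epsilon> (\<Gamma> h) = \<gamma> h" and \<epsilon>_R: "\<epsilon> (R i h) = \<xi> i h"
  by (simp_all add: \<Gamma>_def R_def counit_left_slice \<gamma>_linear \<xi>_linear)

text \<open>Both sides are \<open>p(h\<^sub>1) h\<^sub>2 f(h\<^sub>3)\<close>: apply \<open>p \<otimes> id \<otimes> f\<close> to the two sides of coassociativity.\<close>

lemma left_slice_slice_commute: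
  assumes p: "Vector_Spaces.linear sH (*) p" and f: "Vector_Spaces.linear sH (*) f"
  shows "left_slice sH sH p (\<Delta> (slice sH sH f (\<Delta> h))) = slice sH sH f (\<Delta> (left_slice sH sH p (\<Delta> h)))"
proof -
  note T = vector_space_tensor_scale
  note VH = H.vector_space_axioms
  interpret TH: tensor_pair "tensor_scale :: 'k \<Rightarrow> ('h, 'h, 'k) tensor \<Rightarrow> ('h, 'h, 'k) tensor" sH
    by (intro tensor_pair.intro T VH)
  note lp = HH.left_slice[OF p] and lf = HH.slice[OF f]
  note lpD = linearD[OF lp(1)] and lfD = linearD[OF lf(1)]
  note LpD = linearD[OF left_slice_\<Delta>_linear[OF p]] and LfD = linearD[OF slice_\<Delta>_linear[OF f]]
  have bil: "is_bilinear tensor_scale sH sH (\<lambda>t h. sH (f h) (left_slice sH sH p t))"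
    unfolding is_bilinear_iff[OF T VH VH]
    by (simp add: linearD[OF f] lpD H.scale_left_distrib H.scale_right_distrib mult.commute)
  define \<Omega> where "\<Omega> = tensor_lift tensor_scale sH sH (\<lambda>t h. sH (f h) (left_slice sH sH p t))"
  note \<Omega> = tensor_lift[OF T VH VH bil, folded \<Omega>_def]
  note \<Omega>D = linearD[OF \<Omega>(1)]
  have bil1: "is_bilinear sH sH tensor_scale (\<lambda>b h. tensor tensor_scale sH (\<Delta> b) h)"
    unfolding is_bilinear_iff[OF VH VH T] by (simp add: TH.tensor_simps linearD[OF \<Delta>_linear])
  note l1 = tensor_lift[OF VH VH T bil1]
  have bil2: "is_bilinear sH sH tensor_scale (\<lambda>b h. tensor_assoc sH sH sH b (\<Delta> h))"
    unfolding is_bilinear_iff[OF VH VH T]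
    using linearD[OF linear_tensor_assoc_right[OF VH VH VH]] linearD[OF \<Delta>_linear]
      linearD[OF linear_tensor_assoc_left[OF VH VH VH \<Delta>_space]]
    by simp
  note l2 = tensor_lift[OF VH VH T bil2]
  have eq1: "\<Omega> (tensor_lift sH sH tensor_scale (\<lambda>b h. tensor tensor_scale sH (\<Delta> b) h) t) =
      left_slice sH sH p (\<Delta> (slice sH sH f t))" if "t \<in> HH.space" for t
    using that by (induction t rule: HH.space_induct)
      (simp_all add: l1(2) linearD[OF l1(1)] \<Omega>(2) \<Omega>D lf lfD LpD)
  have eq2: "\<Omega> (tensor_assoc sH sH sH b s) = sH (p b) (slice sH sH f s)" if "s \<in> HH.space" for b s
    using that by (induction s rule: HH.space_induct)
      (simp_all add: tensor_assoc_tensor[OF VH VH VH] linearD[OF linear_tensor_assoc_right[OF VH VH VH]]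
        \<Omega>(2) \<Omega>D lf lfD lp H.scale_right_distrib mult.commute)
  have eq3: "\<Omega> (tensor_lift sH sH tensor_scale (\<lambda>b h. tensor_assoc sH sH sH b (\<Delta> h)) t) =
      slice sH sH f (\<Delta> (left_slice sH sH p t))" if "t \<in> HH.space" for t
    using that by (induction t rule: HH.space_induct)
      (simp_all add: l2(2) linearD[OF l2(1)] eq2 \<Omega>D lp lpD LfD)
  show ?thesis
    using \<Delta>_coassoc eq1[OF \<Delta>_space[of h]] eq3[OF \<Delta>_space[of h]] by (simp add: is_coassociative_def)
qed

subsection \<open>The monomial basis and the Taylor expansion\<close>

abbreviation "xl L \<equiv> prod_list (map x L)"

lemma x_xl:
  assumes "i \<in> {1..n}" "set L \<subseteq> {1..n}"
  shows "x i * xl L = (if i \<in> set L then 0 else sH (insort_sign i L) (xl (insort i L)))"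
proof -
  have xl: "xl L = foldr (\<lambda>i y. x i * y) L 1" for L by (induction L) simp_all
  have lin: "Vector_Spaces.linear sH sH (\<lambda>y. x i * y)" for i
    by (rule linearI[OF H.vector_space_axioms H.vector_space_axioms])
      (simp_all add: distrib_left H.scale_mult_right)
  have anti: "x i * (x j * a) = - (x j * (x i * a))" if "i \<in> {1..n}" "j \<in> {1..n}" for i j a
    using x_anti[OF that] by (simp flip: mult.assoc)
  have nil: "x i * (x i * a) = 0" if "i \<in> {1..n}" for i a
    using x_x[OF that] by (simp flip: mult.assoc)
  show ?thesis
    unfolding xl
    by (rule foldr_anticommuting[where D = "\<lambda>i y. x i * y", OF lin anti nil assms])
qed

lemma \<Gamma>_xl: "set L \<subseteq> {1..n} \<Longrightarrow> \<Gamma> (xl L) = xl L"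
  by (induction L) (auto simp: \<Gamma>_simps)

lemma R_g_mult: "R i (g * h) = - (g * R i h)"
  by (simp add: R_simps \<Gamma>_simps)

lemma R_xl_notin: "set L \<subseteq> {1..n} \<Longrightarrow> i \<notin> set L \<Longrightarrow> R i (xl L) = 0"
  by (induction L) (auto simp: R_simps)

lemma R_xl_insort:
  assumes "i \<in> {1..n}" "set L \<subseteq> {1..n}" "i \<notin> set L"
  shows "R i (xl (insort i L)) = sH (- insort_sign i L) (g * xl L)"
  using assms(2,3)
proof (induction L)
  case Nil
  then show ?case using assms(1) by (simp add: R_simps)
next
  case (Cons j L)
  show ?case
  proof (cases "i \<le> j")
    case True
    have "R i (xl (j # L)) = 0" using Cons.prems by (intro R_xl_notin) auto
    then show ?thesis using True assms(1) Cons.prems by (simp add: R_simps)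
  next
    case False
    have "x j * (g * xl L) = - (g * (x j * xl L))"
      using x_g[of j] Cons.prems by (simp flip: mult.assoc)
    then show ?thesis using False Cons by (simp add: R_simps \<Gamma>_x H.scale_mult_right)
  qed
qed

lemma fold_R_linear: "Vector_Spaces.linear sH sH (fold R L)"
proof (induction L)
  case Nil
  show ?case by (rule linearI[OF H.vector_space_axioms H.vector_space_axioms]) simp_all
next
  case (Cons i L)
  from Vector_Spaces.linear_compose[OF R_linear Cons] show ?case by (simp add: comp_def)
qed

lemma fold_R_g_mult: "fold R L (g * h) = sH ((- 1) ^ length L) (g * fold R L h)"
  by (induction L arbitrary: h) (simp_all add: R_g_mult linearD[OF fold_R_linear])

text \<open>Applying \<open>R\<^sub>i\<close> removes \<open>x\<^sub>i\<close> from a monomial or kills it, and the counit kills what is not a power of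
  \<open>g\<close>; so only \<open>L = Q\<close> survives.  For the smallest index \<open>i\<close> no \<open>x\<^sub>j\<close> has to be passed, whence no
  further sign.\<close>

lemma \<epsilon>_fold_R_xl:
  assumes "sorted L" "distinct L" "set L \<subseteq> {1..n}" "sorted Q" "distinct Q" "set Q \<subseteq> {1..n}"
  shows "\<epsilon> (fold R L (xl Q)) = (if L = Q then taylor_sign (length L) else 0)"
  using assms
proof (induction L arbitrary: Q)
  case Nil
  then show ?case by (cases Q) (simp_all add: \<epsilon>_simps taylor_sign_def)
next
  case (Cons i L)
  show ?case
  proof (cases "i \<in> set Q")
    case False
    then have "R i (xl Q) = 0" using Cons.prems by (intro R_xl_notin) auto
    then show ?thesis using False by (auto simp: linearD[OF fold_R_linear] \<epsilon>_simps)
  next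
    case True
    define Q' where "Q' = remove1 i Q"
    have Q: "Q = insort i Q'" using True Cons.prems by (simp add: Q'_def insort_remove1)
    have Q': "sorted Q'" "distinct Q'" "set Q' \<subseteq> {1..n}" "i \<notin> set Q'"
      using Cons.prems set_remove1_subset[of i Q] by (auto simp: Q'_def sorted_remove1)
    have i: "i \<in> {1..n}" using Cons.prems by simp
    have "\<epsilon> (fold R (i # L) (xl Q)) =
        - insort_sign i Q' * ((- 1) ^ length L * \<epsilon> (fold R L (xl Q')))"
      unfolding Q using R_xl_insort[OF i Q'(3,4)]
      by (simp add: linearD[OF fold_R_linear] fold_R_g_mult \<epsilon>_simps)
    also have "\<epsilon> (fold R L (xl Q')) = (if L = Q' then taylor_sign (length L) else 0)"
      using Cons Q' by simp
    finally have eq: "\<epsilon> (fold R (i # L) (xl Q)) =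
        - insort_sign i Q' * ((- 1) ^ length L * (if L = Q' then taylor_sign (length L) else 0))" .
    show ?thesis
    proof (cases "L = Q'")
      case True
      then have "insort i Q' = i # L" "insort_sign i Q' = (1::'k)"
        using Cons.prems by (cases L; auto)+
      then show ?thesis using eq True Q by (simp add: taylor_sign_Suc)
    next
      case False
      then have "i # L \<noteq> Q" by (auto simp: Q'_def)
      with eq False show ?thesis by simp
    qed
  qed
qed

definition xp :: "nat set \<Rightarrow> 'h" where "xp P = ordered_prod x P"

lemma xp_eq: "xp P = xl (sorted_list_of_set P)"
  by (simp add: xp_def ordered_prod_def)

text \<open>The elements \<open>(x\<^sub>P \<plusminus> g x\<^sub>P) / 2\<close> of the statement, with sign \<open>(-1)^|P|\<close> for \<open>ep\<close>; up to \<open>taylor_sign\<close>,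
  they form the basis dual to the functionals \<open>\<epsilon> (RP P h)\<close> and \<open>\<epsilon> (RP P (\<Gamma> h))\<close>.\<close>

definition ep :: "nat set \<Rightarrow> 'h" where "ep P = sH (1 / 2) (xp P + (- 1) ^ card P * (g * xp P))"
definition em :: "nat set \<Rightarrow> 'h" where "em P = sH (1 / 2) (xp P + (- 1) ^ (card P + 1) * (g * xp P))"

definition RP :: "nat set \<Rightarrow> 'h \<Rightarrow> 'h" where "RP P = fold R (sorted_list_of_set P)"

lemma RP_linear: "Vector_Spaces.linear sH sH (RP P)"
  unfolding RP_def by (rule fold_R_linear)

lemma \<epsilon>_RP_linear: "Vector_Spaces.linear sH (*) (\<lambda>h. \<epsilon> (RP P h))"
  using Vector_Spaces.linear_compose[OF RP_linear \<epsilon>_linear] by (simp add: comp_def)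

lemma \<epsilon>_RP_\<Gamma>_linear: "Vector_Spaces.linear sH (*) (\<lambda>h. \<epsilon> (RP P (\<Gamma> h)))"
  using Vector_Spaces.linear_compose[OF \<Gamma>_linear \<epsilon>_RP_linear] by (simp add: comp_def)

lemma monomial_induct [case_names add scale xp gxp]:
  assumes add: "\<And>a b. P a \<Longrightarrow> P b \<Longrightarrow> P (a + b)" and sc: "\<And>c a. P a \<Longrightarrow> P (sH c a)"
    and xp: "\<And>Q. Q \<subseteq> {1..n} \<Longrightarrow> P (xp Q)" and gxp: "\<And>Q. Q \<subseteq> {1..n} \<Longrightarrow> P (g * xp Q)"
  shows "P h"
proof -
  define M where "M = H.span ((xp ` Pow {1..n}) \<union> ((\<lambda>Q. g * xp Q) ` Pow {1..n}))"
  have P0: "P 0" using sc[OF xp[of "{}"], of 0] by simp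
  have base: "xp Q \<in> M" "g * xp Q \<in> M" if "Q \<subseteq> {1..n}" for Q
    using that unfolding M_def by (auto intro!: H.span_base)
  have x: "x i * xp Q \<in> M" "g * (x i * xp Q) \<in> M" if "i \<in> {1..n}" "Q \<subseteq> {1..n}" for i Q
  proof -
    have fin: "finite Q" using that(2) finite_subset by blast
    have "x i * xp Q = (if i \<in> Q then 0 else sH (insort_sign i (sorted_list_of_set Q)) (xp (insert i Q)))"
      using x_xl[of i "sorted_list_of_set Q"] that fin by (simp add: xp_eq sorted_list_of_set_insert)
    then show "x i * xp Q \<in> M" "g * (x i * xp Q) \<in> M"
      using base[of "insert i Q"] that
      by (auto simp: M_def H.span_zero H.span_scale H.scale_mult_right)
  qed
  have mult: "a * h \<in> M" if "h \<in> M" "\<And>Q. Q \<subseteq> {1..n} \<Longrightarrow> a * xp Q \<in> M"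
    "\<And>Q. Q \<subseteq> {1..n} \<Longrightarrow> a * (g * xp Q) \<in> M" for a h
    by (rule H.span_mult(1)[OF that(1)[unfolded M_def]]) (use that(2,3) in \<open>auto simp: M_def\<close>)
  have "h \<in> M"
  proof (induction h rule: induct)
    case one
    show ?case using base(1)[of "{}"] by (simp add: xp_eq)
  next
    case (g h)
    then show ?case by (rule mult) (simp_all add: base)
  next
    case (x i h)
    from x(2) show ?case
    proof (rule mult)
      fix Q assume Q: "Q \<subseteq> {1..n}"
      show "x i * xp Q \<in> M" by (rule \<open>\<And>i Q. _ \<Longrightarrow> _ \<Longrightarrow> x i * xp Q \<in> M\<close>[OF x(1) Q])
      have "x i * (g * xp Q) = - (g * (x i * xp Q))" using x_g[OF x(1)] by (simp flip: mult.assoc)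
      then show "x i * (g * xp Q) \<in> M"
        using \<open>\<And>i Q. _ \<Longrightarrow> _ \<Longrightarrow> g * (x i * xp Q) \<in> M\<close>[OF x(1) Q] unfolding M_def by (simp add: H.span_neg)
    qed
  qed (auto simp: M_def H.span_add H.span_scale)
  then show ?thesis
    unfolding M_def
    by (induction rule: H.span_induct_alt) (auto simp: P0 intro!: add sc xp gxp)
qed

lemma \<epsilon>_RP_xp:
  assumes "P \<subseteq> {1..n}" "Q \<subseteq> {1..n}"
  shows "\<epsilon> (RP P (xp Q)) = (if P = Q then taylor_sign (card P) else 0)"
proof -
  have fin: "finite P" "finite Q" using assms finite_subset by blast+
  then have "sorted_list_of_set P = sorted_list_of_set Q \<longleftrightarrow> P = Q"
    by (metis sorted_list_of_set.set_sorted_key_list_of_set)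
  then show ?thesis
    using \<epsilon>_fold_R_xl[of "sorted_list_of_set P" "sorted_list_of_set Q"] assms fin
    by (simp add: RP_def xp_eq)
qed

lemma \<epsilon>_RP_gxp:
  assumes "P \<subseteq> {1..n}" "Q \<subseteq> {1..n}"
  shows "\<epsilon> (RP P (g * xp Q)) = (if P = Q then (- 1) ^ card P * taylor_sign (card P) else 0)"
  using \<epsilon>_RP_xp[OF assms] finite_subset[OF assms(1)]
  by (simp add: RP_def fold_R_g_mult \<epsilon>_simps)

lemma ep_em_sum: "ep P + em P = xp P" "ep P - em P = sH ((- 1) ^ card P) (g * xp P)"
proof -
  have half: "sH (1 / 2) (y + y) = y" for y by (rule H.half_double[OF two])
  show "ep P + em P = xp P"
    unfolding ep_def em_def H.neg_one_power_mult H.scale_right_distrib[symmetric]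
    using half[of "xp P"] by simp
  show "ep P - em P = sH ((- 1) ^ card P) (g * xp P)"
    unfolding ep_def em_def H.neg_one_power_mult H.scale_right_diff_distrib[symmetric]
    using half[of "sH ((- 1) ^ card P) (g * xp P)"] by simp
qed

text \<open>Both sides are linear in \<open>h\<close>, and on a monomial only the summand for that monomial survives.\<close>

lemma taylor_expansion:
  "h = (\<Sum>P\<in>Pow {1..n}. sH (taylor_sign (card P))
      (sH (\<epsilon> (RP P h)) (ep P) + sH (\<epsilon> (RP P (\<Gamma> h))) (em P)))" (is "h = ?F h")
proof (induction h rule: monomial_induct)
  case (add a b)
  have "?F (a + b) = ?F a + ?F b"
    by (simp add: \<epsilon>_simps linearD[OF RP_linear] \<Gamma>_simps H.scale_left_distrib H.scale_right_distrib
        sum.distrib[symmetric] add_ac)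
  with add show ?case by simp
next
  case (scale c a)
  have "?F (sH c a) = sH c (?F a)"
    by (simp add: \<epsilon>_simps linearD[OF RP_linear] \<Gamma>_simps H.scale_right_distrib H.scale_sum_right
        mult.left_commute)
  with scale show ?case by simp
next
  case (xp Q)
  have \<Gamma>: "\<Gamma> (xp Q) = xp Q"
    using xp finite_subset[OF xp] by (simp add: xp_eq \<Gamma>_xl)
  have "?F (xp Q) = (\<Sum>P\<in>Pow {1..n}. if P = Q then ep Q + em Q else 0)"
  proof (rule sum.cong)
    fix P assume "P \<in> Pow {1..n}"
    then have "\<epsilon> (RP P (xp Q)) = (if P = Q then taylor_sign (card P) else 0)"
      using \<epsilon>_RP_xp xp by simp
    then show "sH (taylor_sign (card P)) (sH (\<epsilon> (RP P (xp Q))) (ep P) + sH (\<epsilon> (RP P (\<Gamma> (xp Q)))) (em P)) =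
        (if P = Q then ep Q + em Q else 0)"
      unfolding \<Gamma> by (cases "P = Q") (simp_all add: H.scale_right_distrib)
  qed simp
  also have "\<dots> = xp Q" using xp by (simp add: sum.delta' ep_em_sum)
  finally show ?case by simp
next
  case (gxp Q)
  have \<Gamma>: "\<Gamma> (g * xp Q) = - (g * xp Q)"
    using gxp finite_subset[OF gxp] by (simp add: xp_eq \<Gamma>_xl \<Gamma>_simps)
  have "?F (g * xp Q) = (\<Sum>P\<in>Pow {1..n}. if P = Q then sH ((- 1) ^ card Q) (ep Q - em Q) else 0)"
  proof (rule sum.cong)
    fix P assume "P \<in> Pow {1..n}"
    then have "\<epsilon> (RP P (g * xp Q)) = (if P = Q then (- 1) ^ card P * taylor_sign (card P) else 0)"
      using \<epsilon>_RP_gxp gxp by simp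
    then show "sH (taylor_sign (card P))
          (sH (\<epsilon> (RP P (g * xp Q))) (ep P) + sH (\<epsilon> (RP P (\<Gamma> (g * xp Q)))) (em P)) =
        (if P = Q then sH ((- 1) ^ card Q) (ep Q - em Q) else 0)"
      unfolding \<Gamma>
      by (cases "P = Q") (simp_all add: linearD[OF RP_linear] \<epsilon>_simps
        H.scale_right_distrib H.scale_right_diff_distrib)
  qed simp
  also have "\<dots> = g * xp Q" using gxp by (simp add: sum.delta' ep_em_sum flip: power_mult_distrib)
  finally show ?case by simp
qed

lemma ep_em_operators:
  assumes "P \<subseteq> {1..n}" and s: "s = insort_sign i (sorted_list_of_set P)"
  shows "\<Gamma> (ep P) = em P" "\<Gamma> (em P) = ep P"
    and "i \<notin> P \<Longrightarrow> R i (ep P) = 0" "i \<notin> P \<Longrightarrow> R i (em P) = 0"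
    and "i \<in> {1..n} \<Longrightarrow> i \<notin> P \<Longrightarrow> R i (ep (insert i P)) = sH (- ((- 1) ^ card P) * s) (ep P)"
    and "i \<in> {1..n} \<Longrightarrow> i \<notin> P \<Longrightarrow> R i (em (insert i P)) = sH ((- 1) ^ card P * s) (em P)"
proof -
  have fin: "finite P" using assms finite_subset by blast
  have \<Gamma>: "\<Gamma> (xp P) = xp P" using assms(1) fin by (simp add: xp_eq \<Gamma>_xl)
  show "\<Gamma> (ep P) = em P" "\<Gamma> (em P) = ep P"
    unfolding ep_def em_def H.neg_one_power_mult by (simp_all add: \<Gamma>_simps \<Gamma>)
  show "R i (ep P) = 0" "R i (em P) = 0" if "i \<notin> P"
    unfolding ep_def em_def H.neg_one_power_mult
    using R_xl_notin[of "sorted_list_of_set P" i] assms(1) fin that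
    by (simp_all add: linearD[OF R_linear] R_g_mult xp_eq)
  show "R i (ep (insert i P)) = sH (- ((- 1) ^ card P) * s) (ep P)"
    "R i (em (insert i P)) = sH ((- 1) ^ card P * s) (em P)" if i: "i \<in> {1..n}" "i \<notin> P"
  proof -
    have R: "R i (xp (insert i P)) = sH (- s) (g * xp P)"
      using R_xl_insort[of i "sorted_list_of_set P"] assms(1) fin i
      by (simp add: xp_eq sorted_list_of_set_insert s)
    have c: "card (insert i P) = Suc (card P)" using fin i by simp
    show "R i (ep (insert i P)) = sH (- ((- 1) ^ card P) * s) (ep P)"
      "R i (em (insert i P)) = sH ((- 1) ^ card P * s) (em P)"
      unfolding ep_def em_def H.neg_one_power_mult c
      by (cases "even (card P)";
        simp add: linearD[OF R_linear] R_g_mult R H.scale_right_distrib H.scale_right_diff_distrib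
          H.scale_mult_right algebra_simps)+
  qed
qed

end

section \<open>Coactions of E(n) as skew actions\<close>

lemma (in E_hopf) tensor_taylor:
  fixes sB :: "'k \<Rightarrow> 'b::ab_group_add \<Rightarrow> 'b"
  assumes B: "vector_space sB" and t: "t \<in> tensor_space sB sH"
  shows "t = (\<Sum>P\<in>Pow {1..n}. tensor_scale (taylor_sign (card P))
    (tensor sB sH (slice sB sH (\<lambda>h. \<epsilon> (RP P h)) t) (ep P) +
     tensor sB sH (slice sB sH (\<lambda>h. \<epsilon> (RP P (\<Gamma> h))) t) (em P)))" (is "t = ?F t")
proof -
  interpret BH: tensor_pair sB sH by (intro tensor_pair.intro B H.vector_space_axioms)
  note l1 = \<epsilon>_RP_linear and l2 = \<epsilon>_RP_\<Gamma>_linear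
  from t show ?thesis
  proof (induction t rule: BH.space_induct)
    case (tensor b h)
    have "tensor sB sH b h = tensor sB sH b (\<Sum>P\<in>Pow {1..n}. sH (taylor_sign (card P))
      (sH (\<epsilon> (RP P h)) (ep P) + sH (\<epsilon> (RP P (\<Gamma> h))) (em P)))"
      using taylor_expansion[of h] by simp
    also have "\<dots> = ?F (tensor sB sH b h)"
      unfolding BH.tensor_sum_right
      by (rule sum.cong) (simp_all only: BH.slice[OF l1] BH.slice[OF l2] BH.tensor_simps)
    finally show ?case .
  next
    case (add s t)
    have "?F (s + t) = ?F s + ?F t"
      unfolding sum.distrib[symmetric]
      by (rule sum.cong)
        (simp_all only: linearD[OF BH.slice(1)[OF l1]] linearD[OF BH.slice(1)[OF l2]]
          BH.tensor_simps BH.T.scale_right_distrib add_ac)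
    with add show ?case by simp
  qed
qed

text \<open>By the Taylor formula the functionals on \<open>H\<close> separate the points of any tensor product with \<open>H\<close>.\<close>

lemma (in E_hopf) tensor_eqI:
  fixes sB :: "'k \<Rightarrow> 'b::ab_group_add \<Rightarrow> 'b"
  assumes B: "vector_space sB" and st: "s \<in> tensor_space sB sH" "t \<in> tensor_space sB sH"
    and eq: "\<And>f. Vector_Spaces.linear sH (*) f \<Longrightarrow> slice sB sH f s = slice sB sH f t"
  shows "s = t"
proof -
  show ?thesis
    by (subst tensor_taylor[OF B st(1)], subst tensor_taylor[OF B st(2)])
      (simp only: eq[OF \<epsilon>_RP_linear] eq[OF \<epsilon>_RP_\<Gamma>_linear])
qed

locale E_comodule = E_hopf sH n g x \<Delta> \<epsilon> S + A: k_algebra sA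
  for sA :: "'k::field \<Rightarrow> 'a::ring_1 \<Rightarrow> 'a"
    and sH :: "'k \<Rightarrow> 'h::ring_1 \<Rightarrow> 'h" and n :: nat and g :: 'h and x :: "nat \<Rightarrow> 'h"
    and \<Delta> :: "'h \<Rightarrow> ('h, 'h, 'k) tensor" and \<epsilon> :: "'h \<Rightarrow> 'k" and S :: "'h \<Rightarrow> 'h"
begin

sublocale AH: algebra_pair sA sH ..

abbreviation "tmap \<equiv> tensor_map sA sH"
abbreviation "L f h \<equiv> slice sH sH f (\<Delta> h)"

lemmas VA = A.vector_space_axioms and VH = H.vector_space_axioms

text \<open>Both sides are \<open>p(h\<^sub>1) f(h\<^sub>2)\<close>.\<close>

lemma slice_left_slice:
  assumes "Vector_Spaces.linear sH (*) p" "Vector_Spaces.linear sH (*) f"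
  shows "p (L f h) = f (left_slice sH sH p (\<Delta> h))"
proof -
  have "p (slice sH sH f t) = f (left_slice sH sH p t)" if "t \<in> HH.space" for t
    using that
    by (induction t rule: HH.space_induct)
      (simp_all add: HH.slice HH.left_slice assms linearD[OF assms(1)] linearD[OF assms(2)] mult.commute
        linearD[OF HH.slice(1)[OF assms(2)]] linearD[OF HH.left_slice(1)[OF assms(1)]])
  then show ?thesis by simp
qed

text \<open>The two sides of coassociativity are compared by applying \<open>id \<otimes> f\<close> to the last tensor factor.\<close>

lemma coassociative_iff:
  assumes \<rho>: "Vector_Spaces.linear sA tensor_scale \<rho>" and range: "\<And>a. \<rho> a \<in> AH.space"
  shows "is_coassociative sA sH \<Delta> \<rho> \<longleftrightarrow>
    (\<forall>f a. Vector_Spaces.linear sH (*) f \<longrightarrow> \<rho> (slice sA sH f (\<rho> a)) = tmap id (L f) (\<rho> a))"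
proof -
  note T = vector_space_tensor_scale
  interpret TH: tensor_pair "tensor_scale :: 'k \<Rightarrow> ('a, 'h, 'k) tensor \<Rightarrow> ('a, 'h, 'k) tensor" sH
    by (intro tensor_pair.intro T VH)
  have bil1: "is_bilinear sA sH tensor_scale (\<lambda>b h. tensor tensor_scale sH (\<rho> b) h)"
    unfolding is_bilinear_iff[OF VA VH T] by (simp add: TH.tensor_simps linearD[OF \<rho>])
  note l1 = tensor_lift[OF VA VH T bil1]
  have bil2: "is_bilinear sA sH tensor_scale (\<lambda>b h. tensor_assoc sA sH sH b (\<Delta> h))"
    unfolding is_bilinear_iff[OF VA VH T]
    using linearD[OF linear_tensor_assoc_right[OF VA VH VH]] linearD[OF \<Delta>_linear]
      linearD[OF linear_tensor_assoc_left[OF VA VH VH \<Delta>_space]]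
    by simp
  note l2 = tensor_lift[OF VA VH T bil2]
  define X where "X = tensor_lift sA sH tensor_scale (\<lambda>b h. tensor tensor_scale sH (\<rho> b) h)"
  define Y where "Y = tensor_lift sA sH tensor_scale (\<lambda>b h. tensor_assoc sA sH sH b (\<Delta> h))"
  have X: "X t \<in> TH.space" if "t \<in> AH.space" for t
    using that unfolding X_def
    by (induction t rule: AH.space_induct) (simp_all add: l1(2) linearD[OF l1(1)] TH.space_add)
  have assoc: "tensor_assoc sA sH sH b s \<in> TH.space" if "s \<in> HH.space" for b s
    using that
    by (induction s rule: HH.space_induct)
      (simp_all add: tensor_assoc_tensor[OF VA VH VH] linearD[OF linear_tensor_assoc_right[OF VA VH VH]]
        TH.space_add)
  have Y: "Y t \<in> TH.space" if "t \<in> AH.space" for t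
    using that unfolding Y_def
    by (induction t rule: AH.space_induct) (simp_all add: l2(2) linearD[OF l2(1)] TH.space_add assoc)
  have slice_X: "slice tensor_scale sH f (X t) = \<rho> (slice sA sH f t)"
    if f: "Vector_Spaces.linear sH (*) f" and t: "t \<in> AH.space" for f t
    using t unfolding X_def
    by (induction t rule: AH.space_induct)
      (simp_all add: l1(2) linearD[OF l1(1)] TH.slice AH.slice f linearD[OF TH.slice(1)[OF f]]
        linearD[OF AH.slice(1)[OF f]] linearD[OF \<rho>])
  have slice_Y: "slice tensor_scale sH f (Y t) = tmap id (L f) t"
    if f: "Vector_Spaces.linear sH (*) f" and t: "t \<in> AH.space" for f t
  proof -
    have s: "slice tensor_scale sH f (tensor_assoc sA sH sH b s) = tensor sA sH b (slice sH sH f s)"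
      if "s \<in> HH.space" for b s
      using that
      by (induction s rule: HH.space_induct)
        (simp_all add: tensor_assoc_tensor[OF VA VH VH] linearD[OF linear_tensor_assoc_right[OF VA VH VH]]
          TH.slice HH.slice f linearD[OF TH.slice(1)[OF f]] linearD[OF HH.slice(1)[OF f]] AH.tensor_simps)
    note m = AH.tensor_map[OF A.linear_id slice_\<Delta>_linear[OF f]]
    show ?thesis
      using t unfolding Y_def
      by (induction t rule: AH.space_induct)
        (simp_all del: id_apply
          add: l2(2) linearD[OF l2(1)] s linearD[OF TH.slice(1)[OF f]] m linearD[OF m(1)], simp)
  qed
  have "X (\<rho> a) = Y (\<rho> a) \<longleftrightarrow>
      (\<forall>f. Vector_Spaces.linear sH (*) f \<longrightarrow> \<rho> (slice sA sH f (\<rho> a)) = tmap id (L f) (\<rho> a))" for a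
  proof
    assume "X (\<rho> a) = Y (\<rho> a)"
    then show "\<forall>f. Vector_Spaces.linear sH (*) f \<longrightarrow> \<rho> (slice sA sH f (\<rho> a)) = tmap id (L f) (\<rho> a)"
      using slice_X[OF _ range] slice_Y[OF _ range] by metis
  next
    assume "\<forall>f. Vector_Spaces.linear sH (*) f \<longrightarrow> \<rho> (slice sA sH f (\<rho> a)) = tmap id (L f) (\<rho> a)"
    then show "X (\<rho> a) = Y (\<rho> a)"
      by (intro tensor_eqI[OF T X[OF range] Y[OF range]]) (simp add: slice_X slice_Y range)
  qed
  then show ?thesis unfolding is_coassociative_def X_def[symmetric] Y_def[symmetric] by blast
qed

text \<open>Invariant tensors are the elements of the cotensor product of \<open>A\<close> and \<open>H\<close>: on the left \<open>A\<close> carries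
  \<open>\<phi>, d\<close>, on the right \<open>H\<close> carries \<open>\<Gamma>, R\<close>.\<close>

definition invariant :: "('a \<Rightarrow> 'a) \<Rightarrow> (nat \<Rightarrow> 'a \<Rightarrow> 'a) \<Rightarrow> ('a, 'h, 'k) tensor \<Rightarrow> bool" where
  "invariant \<phi> d t \<longleftrightarrow> t \<in> AH.space \<and> tmap \<phi> id t = tmap id \<Gamma> t \<and>
     (\<forall>i\<in>{1..n}. tmap (d i) id t = tmap id (R i) t)"

definition taylor :: "('a \<Rightarrow> 'a) \<Rightarrow> (nat \<Rightarrow> 'a \<Rightarrow> 'a) \<Rightarrow> 'a \<Rightarrow> ('a, 'h, 'k) tensor" where
  "taylor \<phi> d a = (\<Sum>P\<in>Pow {1..n}. tensor_scale (taylor_sign (card P))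
     (tensor sA sH (ordered_comp d P a) (ep P) + tensor sA sH (\<phi> (ordered_comp d P a)) (em P)))"

definition skew_action :: "('a \<Rightarrow> 'a) \<Rightarrow> (nat \<Rightarrow> 'a \<Rightarrow> 'a) \<Rightarrow> bool" where
  "skew_action \<phi> d \<longleftrightarrow> algebra_hom sA sA \<phi> \<and> (\<forall>a. \<phi> (\<phi> a) = a) \<and>
     (\<forall>i\<in>{1..n}. Vector_Spaces.linear sA sA (d i) \<and>
        (\<forall>a b. d i (a * b) = d i a * b + \<phi> a * d i b) \<and>
        (\<forall>a. d i (\<phi> a) = - \<phi> (d i a)) \<and>
        (\<forall>j\<in>{1..n}. \<forall>a. d i (d j a) = - d j (d i a)))"

lemma skew_actionD:
  assumes "skew_action \<phi> d"
  shows "algebra_hom sA sA \<phi>" "\<phi> (\<phi> a) = a"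
    and "i \<in> {1..n} \<Longrightarrow> Vector_Spaces.linear sA sA (d i)"
    and "i \<in> {1..n} \<Longrightarrow> d i (a * b) = d i a * b + \<phi> a * d i b"
    and "i \<in> {1..n} \<Longrightarrow> d i (\<phi> a) = - \<phi> (d i a)"
    and "i \<in> {1..n} \<Longrightarrow> j \<in> {1..n} \<Longrightarrow> d i (d j a) = - d j (d i a)"
  using assms unfolding skew_action_def by blast+

lemma ordered_comp_foldr: "ordered_comp d P a = foldr d (sorted_list_of_set P) a"
proof -
  have "foldr (\<lambda>i f. d i \<circ> f) L id a = foldr d L a" for L by (induction L) simp_all
  then show ?thesis by (simp add: ordered_comp_def)
qed

lemma algebra_hom_linear: "algebra_hom sA sA \<phi> \<Longrightarrow> Vector_Spaces.linear sA sA \<phi>"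
  by (rule linearI[OF VA VA]) (simp_all add: algebra_homD)

lemma foldr_linear:
  assumes "\<And>i. i \<in> set K \<Longrightarrow> Vector_Spaces.linear sA sA (d i)"
  shows "Vector_Spaces.linear sA sA (foldr d K)"
  using assms
proof (induction K)
  case Nil
  show ?case by (rule linearI[OF VA VA]) simp_all
next
  case (Cons i K)
  then have "Vector_Spaces.linear sA sA (foldr d K)" "Vector_Spaces.linear sA sA (d i)" by auto
  from Vector_Spaces.linear_compose[OF this] show ?case by (simp add: comp_def)
qed

text \<open>In the Taylor formula for \<open>t\<close> every operator \<open>R\<^sub>i\<close> or \<open>\<Gamma>\<close> on the right factor can be traded for \<open>d\<^sub>i\<close> or
  \<open>\<phi>\<close> on the left factor.  The operators on different factors commute, so the traded operators end up
  in reversed order: \<open>fold\<close> on the right becomes \<open>foldr\<close> on the left.\<close>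

lemma invariant_eq_taylor:
  assumes sk: "skew_action \<phi> d" and inv: "invariant \<phi> d t"
  shows "t = taylor \<phi> d (slice sA sH \<epsilon> t)"
proof -
  have t: "t \<in> AH.space" and t\<phi>: "tmap \<phi> id t = tmap id \<Gamma> t"
    and td: "\<And>i. i \<in> {1..n} \<Longrightarrow> tmap (d i) id t = tmap id (R i) t"
    using inv by (auto simp: invariant_def)
  note d = skew_actionD(3)[OF sk]
  have \<phi>: "Vector_Spaces.linear sA sA \<phi>" by (rule algebra_hom_linear[OF skew_actionD(1)[OF sk]])
  note idA = A.linear_id and idH = H.linear_id
  note comp = AH.tensor_map_comp[OF _ _ _ _ t]
  have "tmap id (fold R K) t = tmap (foldr d K) id t" if "set K \<subseteq> {1..n}" for K
    using that
  proof (induction K)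
    case Nil
    show ?case by simp
  next
    case (Cons i K)
    then have i: "i \<in> {1..n}" and K: "\<And>j. j \<in> set K \<Longrightarrow> j \<in> {1..n}" by auto
    note f = foldr_linear[OF d[OF K]]
    have "tmap id (fold R (i # K)) t = tmap id (fold R K) (tmap id (R i) t)"
      using comp[OF idA fold_R_linear idA R_linear] by (simp add: comp_def id_def)
    also have "\<dots> = tmap id (fold R K) (tmap (d i) id t)" by (simp only: td[OF i])
    also have "\<dots> = tmap (d i) id (tmap id (fold R K) t)"
      using comp[OF idA fold_R_linear d[OF i] idH] comp[OF d[OF i] idH idA fold_R_linear]
      by (simp add: comp_def id_def)
    also have "\<dots> = tmap (d i) id (tmap (foldr d K) id t)"
      using Cons by (simp del: id_apply)
    also have "\<dots> = tmap (foldr d (i # K)) id t"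
      using comp[OF d[OF i] idH f idH] by (simp add: comp_def id_def)
    finally show ?case .
  qed
  note fold = this
  have RP: "tmap id (RP P) t = tmap (ordered_comp d P) id t" and d_lin: "Vector_Spaces.linear sA sA (ordered_comp d P)"
    if "P \<in> Pow {1..n}" for P
  proof -
    have P: "set (sorted_list_of_set P) \<subseteq> {1..n}"
      using that finite_subset[of P "{1..n}"] by auto
    have eq: "ordered_comp d P = foldr d (sorted_list_of_set P)" by (rule ext) (rule ordered_comp_foldr)
    show "tmap id (RP P) t = tmap (ordered_comp d P) id t"
      using fold[OF P] by (simp add: RP_def eq)
    show "Vector_Spaces.linear sA sA (ordered_comp d P)"
      unfolding eq by (rule foldr_linear) (use P d in blast)
  qed
  have s1: "slice sA sH (\<lambda>h. \<epsilon> (RP P h)) t = ordered_comp d P (slice sA sH \<epsilon> t)" if P: "P \<in> Pow {1..n}" for P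
  proof -
    have "slice sA sH (\<lambda>h. \<epsilon> (RP P h)) t = slice sA sH \<epsilon> (tmap id (RP P) t)"
      using AH.slice_tensor_map[OF idA RP_linear \<epsilon>_linear t] by simp
    also have "\<dots> = ordered_comp d P (slice sA sH \<epsilon> t)"
      unfolding RP[OF P] using AH.slice_tensor_map[OF d_lin[OF P] idH \<epsilon>_linear t] by simp
    finally show ?thesis .
  qed
  have s2: "slice sA sH (\<lambda>h. \<epsilon> (RP P (\<Gamma> h))) t = \<phi> (ordered_comp d P (slice sA sH \<epsilon> t))"
    if P: "P \<in> Pow {1..n}" for P
  proof -
    have "tmap id (\<lambda>h. RP P (\<Gamma> h)) t = tmap id (RP P) (tmap id \<Gamma> t)"
      using comp[OF idA RP_linear idA \<Gamma>_linear] by (simp add: id_def)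
    also have "\<dots> = tmap id (RP P) (tmap \<phi> id t)" by (simp only: t\<phi>)
    also have "\<dots> = tmap \<phi> (RP P) t" using comp[OF idA RP_linear \<phi> idH] by (simp add: id_def)
    finally have eq: "tmap id (\<lambda>h. RP P (\<Gamma> h)) t = tmap \<phi> (RP P) t" .
    have "Vector_Spaces.linear sH sH (\<lambda>h. RP P (\<Gamma> h))"
      using Vector_Spaces.linear_compose[OF \<Gamma>_linear RP_linear] by (simp add: comp_def)
    then have "slice sA sH (\<lambda>h. \<epsilon> (RP P (\<Gamma> h))) t = slice sA sH \<epsilon> (tmap id (\<lambda>h. RP P (\<Gamma> h)) t)"
      using AH.slice_tensor_map[OF idA _ \<epsilon>_linear t] by simp
    also have "\<dots> = \<phi> (slice sA sH (\<lambda>h. \<epsilon> (RP P h)) t)"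
      unfolding eq by (rule AH.slice_tensor_map[OF \<phi> RP_linear \<epsilon>_linear t])
    finally show ?thesis by (simp only: s1[OF P])
  qed
  have "t = (\<Sum>P\<in>Pow {1..n}. tensor_scale (taylor_sign (card P))
    (tensor sA sH (slice sA sH (\<lambda>h. \<epsilon> (RP P h)) t) (ep P) +
     tensor sA sH (slice sA sH (\<lambda>h. \<epsilon> (RP P (\<Gamma> h))) t) (em P)))"
    by (rule tensor_taylor[OF VA t])
  also have "\<dots> = taylor \<phi> d (slice sA sH \<epsilon> t)"
    unfolding taylor_def by (rule sum.cong) (simp_all only: s1 s2)
  finally show ?thesis .
qed

lemma taylor_space: "taylor \<phi> d a \<in> AH.space"
  unfolding taylor_def by (intro AH.space_sum AH.space_scale AH.space_add AH.tensor_in_space)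

text \<open>\<open>\<Gamma>\<close> swaps \<open>ep P\<close> and \<open>em P\<close>, as \<open>\<phi>\<close> does with their coefficients.  For \<open>d\<^sub>i\<close> the sum is split
  according to whether \<open>i\<close> belongs to \<open>P\<close>: on the left \<open>d\<^sub>i\<close> kills the terms containing \<open>i\<close> and adds
  \<open>i\<close> to the others, on the right \<open>R\<^sub>i\<close> kills the terms without \<open>i\<close> and removes \<open>i\<close> from the others.
  The remaining terms match by \<open>taylor_sign_Suc\<close>.\<close>

lemma taylor_invariant:
  assumes sk: "skew_action \<phi> d"
  shows "invariant \<phi> d (taylor \<phi> d a)"
  unfolding invariant_def
proof (intro conjI ballI taylor_space)
  note \<phi>h = skew_actionD(1)[OF sk] and inv = skew_actionD(2)[OF sk] and d = skew_actionD(3)[OF sk]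
    and d\<phi> = skew_actionD(5)[OF sk] and dd = skew_actionD(6)[OF sk]
  note \<phi>D = algebra_homD[OF \<phi>h]
  have \<phi>: "Vector_Spaces.linear sA sA \<phi>" by (rule algebra_hom_linear[OF \<phi>h])
  note idA = A.linear_id and idH = H.linear_id
  note m1 = AH.tensor_map[OF \<phi> idH] and m2 = AH.tensor_map[OF idA \<Gamma>_linear]
  note m1D = linearD[OF m1(1)] and m2D = linearD[OF m2(1)]
  show "tmap \<phi> id (taylor \<phi> d a) = tmap id \<Gamma> (taylor \<phi> d a)"
    unfolding taylor_def m1D m2D m1(2) m2(2)
    by (rule sum.cong) (auto simp: inv ep_em_operators add.commute)
  fix i assume i: "i \<in> {1..n}"
  note m3 = AH.tensor_map[OF d[OF i] idH] and m4 = AH.tensor_map[OF idA R_linear[of i]]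
  note m3D = linearD[OF m3(1)] and m4D = linearD[OF m4(1)]
  have d2: "d i (d i a) = 0" if "i \<in> {1..n}" for i a
  proof -
    have "d i (d i a) + d i (d i a) = 0" using dd[OF that that, of a] by (simp add: add_eq_0_iff)
    then show ?thesis using A.half_double[OF two, of "d i (d i a)"] by simp
  qed
  define s where "s P = (insort_sign i (sorted_list_of_set P) :: 'k)" for P
  let ?N = "Pow ({1..n} - {i})"
  have di: "d i (ordered_comp d P a) = sA (s P) (ordered_comp d (insert i P) a)"
    "d i (ordered_comp d (insert i P) a) = 0" if "P \<in> ?N" for P
  proof -
    have P: "P \<subseteq> {1..n}" "i \<notin> P" "finite P" using that finite_subset[of P "{1..n}"] by auto
    show "d i (ordered_comp d P a) = sA (s P) (ordered_comp d (insert i P) a)"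
      using foldr_anticommuting[where D = d and s = sA, OF d dd d2 i, of "sorted_list_of_set P"] P
      by (simp add: ordered_comp_foldr s_def sorted_list_of_set_insert)
    show "d i (ordered_comp d (insert i P) a) = 0"
    proof -
      have "d i (foldr d K a) = 0" if "set K \<subseteq> {1..n}" "i \<in> set K" for K
        using foldr_anticommuting[where D = d and s = sA, OF d dd d2 i that(1)] that(2) by simp
      then show ?thesis unfolding ordered_comp_foldr using P i by (auto simp: set_insort_key)
    qed
  qed
  have fin: "finite {1..n}" by simp
  let ?d = "\<lambda>P. ordered_comp d P a"
  have "tmap (d i) id (taylor \<phi> d a) =
      (\<Sum>P\<in>Pow {1..n}. tensor_scale (taylor_sign (card P))
        (tensor sA sH (d i (?d P)) (ep P) - tensor sA sH (\<phi> (d i (?d P))) (em P)))"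
    unfolding taylor_def m3D m3(2) by (simp add: d\<phi>[OF i] AH.tensor_minus)
  also have "\<dots> = (\<Sum>P\<in>?N. tensor_scale (taylor_sign (card P) * s P)
        (tensor sA sH (?d (insert i P)) (ep P) - tensor sA sH (\<phi> (?d (insert i P))) (em P)))"
    unfolding sum_Pow_split[OF fin i]
    by (simp add: di \<phi>D AH.tensor_simps AH.T.scale_right_diff_distrib)
  finally have lhs: "tmap (d i) id (taylor \<phi> d a) = \<dots>" .
  have "tmap id (R i) (taylor \<phi> d a) =
      (\<Sum>P\<in>Pow {1..n}. tensor_scale (taylor_sign (card P))
        (tensor sA sH (?d P) (R i (ep P)) + tensor sA sH (\<phi> (?d P)) (R i (em P))))"
    unfolding taylor_def m4D m4(2) by simp
  also have "\<dots> = (\<Sum>P\<in>?N. tensor_scale (taylor_sign (card (insert i P)))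
        (tensor sA sH (?d (insert i P)) (R i (ep (insert i P))) +
         tensor sA sH (\<phi> (?d (insert i P))) (R i (em (insert i P)))))"
  proof -
    have "(\<Sum>P\<in>?N. tensor_scale (taylor_sign (card P))
        (tensor sA sH (?d P) (R i (ep P)) + tensor sA sH (\<phi> (?d P)) (R i (em P)))) = 0"
    proof (rule sum.neutral, rule ballI)
      fix P assume "P \<in> ?N"
      then have "P \<subseteq> {1..n}" "i \<notin> P" by auto
      then show "tensor_scale (taylor_sign (card P))
        (tensor sA sH (?d P) (R i (ep P)) + tensor sA sH (\<phi> (?d P)) (R i (em P))) = 0"
        by (simp add: ep_em_operators(3,4)[OF _ refl])
    qed
    then show ?thesis unfolding sum_Pow_split[OF fin i] by simp
  qed
  also have "\<dots> = (\<Sum>P\<in>?N. tensor_scale (taylor_sign (card P) * s P)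
        (tensor sA sH (?d (insert i P)) (ep P) - tensor sA sH (\<phi> (?d (insert i P))) (em P)))"
  proof (rule sum.cong)
    fix P assume "P \<in> ?N"
    then have P: "P \<subseteq> {1..n}" "i \<notin> P" "finite P" using finite_subset[of P "{1..n}"] by auto
    have c: "taylor_sign (card (insert i P)) = - ((- 1) ^ card P * (taylor_sign (card P) :: 'k))"
      using P by (simp add: taylor_sign_Suc)
    have sq: "(- 1) ^ card P * ((- 1) ^ card P * y) = (y::'k)" for y
      by (simp flip: mult.assoc power_mult_distrib)
    have R: "R i (ep (insert i P)) = sH (- ((- 1) ^ card P) * s P) (ep P)"
      "R i (em (insert i P)) = sH ((- 1) ^ card P * s P) (em P)"
      using ep_em_operators(5,6)[OF P(1) s_def i P(2)] by simp_all
    have k: "- ((- 1) ^ card P * taylor_sign (card P)) * (- ((- 1) ^ card P) * s P) = taylor_sign (card P) * s P"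
      "- ((- 1) ^ card P * taylor_sign (card P)) * ((- 1) ^ card P * s P) = - (taylor_sign (card P) * s P)"
      using sq by (simp_all add: mult.assoc mult.left_commute[of "taylor_sign (card P)"])
    show "tensor_scale (taylor_sign (card (insert i P)))
        (tensor sA sH (?d (insert i P)) (R i (ep (insert i P))) +
         tensor sA sH (\<phi> (?d (insert i P))) (R i (em (insert i P)))) =
      tensor_scale (taylor_sign (card P) * s P)
        (tensor sA sH (?d (insert i P)) (ep P) - tensor sA sH (\<phi> (?d (insert i P))) (em P))"
      unfolding R c AH.tensor_simps AH.T.scale_right_distrib AH.T.scale_scale k
      by (simp add: AH.T.scale_right_diff_distrib)
  qed simp
  finally show "tmap (d i) id (taylor \<phi> d a) = tmap id (R i) (taylor \<phi> d a)" using lhs by simp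
qed

lemma slice_counit_taylor:
  "slice sA sH \<epsilon> (taylor \<phi> d a) = a"
proof -
  note s = AH.slice[OF \<epsilon>_linear] and sD = linearD[OF AH.slice(1)[OF \<epsilon>_linear]]
  have xp: "\<epsilon> (xp P) = (if P = {} then 1 else 0)" if "P \<subseteq> {1..n}" for P
    using \<epsilon>_RP_xp[of "{}" P] that by (auto simp: RP_def taylor_sign_def)
  have e: "\<epsilon> (ep P) = (if P = {} then 1 else 0)" "\<epsilon> (em P) = 0" if "P \<subseteq> {1..n}" for P
    unfolding ep_def em_def H.neg_one_power_mult using xp[OF that] two by (auto simp: \<epsilon>_simps)
  have "slice sA sH \<epsilon> (taylor \<phi> d a) = (\<Sum>P\<in>Pow {1..n}. if P = {} then a else 0)"
    unfolding taylor_def sD s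
    by (rule sum.cong) (auto simp: e taylor_sign_def ordered_comp_def)
  then show ?thesis by (simp add: sum.delta')
qed

text \<open>Linearity, the unit axiom, multiplicativity and coassociativity each ask that some explicit tensor
  \<open>t\<close> be \<open>taylor \<phi> d\<close> of \<open>(id \<otimes> \<epsilon>)t\<close>.  By \<open>invariant_eq_taylor\<close> it is enough that \<open>t\<close> is invariant.  For
  coassociativity this uses that the right coaction of \<open>H\<close> on itself commutes with \<open>\<Gamma>\<close> and \<open>R\<^sub>i\<close>.\<close>

theorem skew_action_coaction:
  assumes sk: "skew_action \<phi> d"
  shows "is_right_coaction sA sH \<Delta> \<epsilon> (taylor \<phi> d)"
proof -
  note \<phi>h = skew_actionD(1)[OF sk] and d = skew_actionD(3)[OF sk] and der = skew_actionD(4)[OF sk]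
  note \<phi>D = algebra_homD[OF \<phi>h]
  have \<phi>: "Vector_Spaces.linear sA sA \<phi>" by (rule algebra_hom_linear[OF \<phi>h])
  note idA = A.linear_id and idH = H.linear_id
  note m1 = AH.tensor_map[OF \<phi> idH] and m2 = AH.tensor_map[OF idA \<Gamma>_linear]
  note m3 = AH.tensor_map[OF d idH] and m4 = AH.tensor_map[OF idA R_linear]
  note sD = linearD[OF AH.slice(1)[OF \<epsilon>_linear]] and s = AH.slice[OF \<epsilon>_linear]
  note inv = taylor_invariant[OF sk]
  note uniq = invariant_eq_taylor[OF sk]
  have add: "taylor \<phi> d (a + b) = taylor \<phi> d a + taylor \<phi> d b" for a b
  proof -
    have "invariant \<phi> d (taylor \<phi> d a + taylor \<phi> d b)"
      using inv[of a] inv[of b]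
      by (simp add: invariant_def AH.space_add linearD[OF m1(1)] linearD[OF m2(1)] linearD[OF m3(1)]
          linearD[OF m4(1)])
    from uniq[OF this] show ?thesis by (simp add: sD slice_counit_taylor)
  qed
  have scale: "taylor \<phi> d (sA r a) = tensor_scale r (taylor \<phi> d a)" for r a
  proof -
    have "invariant \<phi> d (tensor_scale r (taylor \<phi> d a))"
      using inv[of a]
      by (simp add: invariant_def AH.space_scale linearD[OF m1(1)] linearD[OF m2(1)] linearD[OF m3(1)]
          linearD[OF m4(1)])
    from uniq[OF this] show ?thesis by (simp add: sD slice_counit_taylor)
  qed
  have lin: "Vector_Spaces.linear sA tensor_scale (taylor \<phi> d)"
    by (rule linearI[OF VA vector_space_tensor_scale add scale])
  have one: "taylor \<phi> d 1 = tensor sA sH 1 1"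
  proof -
    have "d i 1 = 0" if "i \<in> {1..n}" for i using der[OF that, of 1 1] \<phi>D by simp
    then have "invariant \<phi> d (tensor sA sH 1 1)"
      by (simp add: invariant_def m1(2) m2(2) m3(2) m4(2) \<phi>D \<Gamma>_one R_one)
    from uniq[OF this] show ?thesis by (simp add: s \<epsilon>_one)
  qed
  have mult: "taylor \<phi> d (a * b) = tensor_mult sA sH (taylor \<phi> d a) (taylor \<phi> d b)" for a b
  proof -
    let ?s = "taylor \<phi> d a" and ?t = "taylor \<phi> d b"
    note sp = taylor_space[of \<phi> d a] taylor_space[of \<phi> d b]
    have "tmap \<phi> id (tensor_mult sA sH ?s ?t) = tmap id \<Gamma> (tensor_mult sA sH ?s ?t)"
      using AH.tensor_map_mult[OF \<phi> idH \<phi>D(4) _ sp] AH.tensor_map_mult[OF idA \<Gamma>_linear _ \<Gamma>_mult sp]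
        inv[of a] inv[of b] by (simp add: invariant_def)
    moreover have "tmap (d i) id (tensor_mult sA sH ?s ?t) = tmap id (R i) (tensor_mult sA sH ?s ?t)"
      if "i \<in> {1..n}" for i
      using AH.tensor_map_skew_left[OF d[OF that] \<phi> der[OF that] sp]
        AH.tensor_map_skew_right[OF R_linear \<Gamma>_linear R_mult sp]
        inv[of a] inv[of b] that by (simp add: invariant_def)
    ultimately have "invariant \<phi> d (tensor_mult sA sH ?s ?t)"
      using AH.mult_in_space[OF sp] by (simp add: invariant_def)
    from uniq[OF this] show ?thesis
      using AH.slice_mult[OF \<epsilon>_linear \<epsilon>_mult sp] by (simp add: slice_counit_taylor)
  qed
  have "is_coassociative sA sH \<Delta> (taylor \<phi> d)"
    unfolding coassociative_iff[OF lin taylor_space]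
  proof (intro allI impI)
    fix f a assume f: "Vector_Spaces.linear sH (*) f"
    let ?t = "taylor \<phi> d a"
    note t = taylor_space[of \<phi> d a]
    note Lf = slice_\<Delta>_linear[OF f]
    note m5 = AH.tensor_map[OF idA Lf]
    note comp = AH.tensor_map_comp[OF _ _ _ _ t]
    have L\<Gamma>: "L f (\<Gamma> h) = \<Gamma> (L f h)" and LR: "L f (R i h) = R i (L f h)" for h i
      unfolding \<Gamma>_def R_def
      using left_slice_slice_commute[OF \<gamma>_linear f] left_slice_slice_commute[OF \<xi>_linear f] by simp_all
    have "tmap \<phi> id (tmap id (L f) ?t) = tmap id (L f) (tmap \<phi> id ?t)"
      using comp[OF \<phi> idH idA Lf] comp[OF idA Lf \<phi> idH] by (simp add: id_def)
    also have "\<dots> = tmap id (L f) (tmap id \<Gamma> ?t)" using inv[of a] by (simp add: invariant_def)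
    also have "\<dots> = tmap id \<Gamma> (tmap id (L f) ?t)"
      using comp[OF idA Lf idA \<Gamma>_linear] comp[OF idA \<Gamma>_linear idA Lf] by (simp add: id_def L\<Gamma>)
    finally have 1: "tmap \<phi> id (tmap id (L f) ?t) = tmap id \<Gamma> (tmap id (L f) ?t)" .
    have 2: "tmap (d i) id (tmap id (L f) ?t) = tmap id (R i) (tmap id (L f) ?t)" if i: "i \<in> {1..n}" for i
    proof -
      have "tmap (d i) id (tmap id (L f) ?t) = tmap id (L f) (tmap (d i) id ?t)"
        using comp[OF d[OF i] idH idA Lf] comp[OF idA Lf d[OF i] idH] by (simp add: id_def)
      also have "\<dots> = tmap id (L f) (tmap id (R i) ?t)" using inv[of a] i by (simp add: invariant_def)
      also have "\<dots> = tmap id (R i) (tmap id (L f) ?t)"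
        using comp[OF idA Lf idA R_linear] comp[OF idA R_linear idA Lf] by (simp add: id_def LR)
      finally show ?thesis .
    qed
    have "invariant \<phi> d (tmap id (L f) ?t)"
      using 1 2 m5(3)[OF t] by (simp add: invariant_def)
    from uniq[OF this] have "tmap id (L f) ?t = taylor \<phi> d (slice sA sH \<epsilon> (tmap id (L f) ?t))" .
    also have "slice sA sH \<epsilon> (tmap id (L f) ?t) = slice sA sH f ?t"
      using AH.slice_tensor_map[OF idA Lf \<epsilon>_linear t] by (simp add: counit_slice[OF f])
    finally show "taylor \<phi> d (slice sA sH f ?t) = tmap id (L f) ?t"
      by (simp del: id_apply)
  qed
  then show ?thesis
    unfolding is_right_coaction_def is_right_comodule_def
    using lin one mult taylor_space slice_counit_taylor by (auto simp: slice_def)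
qed

text \<open>The relations among \<open>\<gamma>\<close> and the \<open>\<xi>\<^sub>i\<close> under convolution are those among \<open>\<Gamma>\<close> and the \<open>R\<^sub>i\<close>, followed by
  the counit.\<close>

theorem coaction_skew_action:
  assumes co: "is_right_coaction sA sH \<Delta> \<epsilon> \<rho>"
  shows "\<exists>\<phi> d. skew_action \<phi> d \<and> \<rho> = taylor \<phi> d"
proof -
  have lin: "Vector_Spaces.linear sA tensor_scale \<rho>" and space: "\<And>a. \<rho> a \<in> AH.space"
    and coassoc: "is_coassociative sA sH \<Delta> \<rho>" and counit: "\<And>a. slice sA sH \<epsilon> (\<rho> a) = a"
    and mult: "\<And>a b. \<rho> (a * b) = tensor_mult sA sH (\<rho> a) (\<rho> b)" and one: "\<rho> 1 = tensor sA sH 1 1"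
    using co by (auto simp: is_right_coaction_def is_right_comodule_def slice_def)
  have co: "\<rho> (slice sA sH f (\<rho> a)) = tmap id (L f) (\<rho> a)" if "Vector_Spaces.linear sH (*) f" for f a
    using coassoc that unfolding coassociative_iff[OF lin space] by blast
  note idA = A.linear_id and idH = H.linear_id
  have act_linear: "Vector_Spaces.linear sA sA (\<lambda>a. slice sA sH f (\<rho> a))"
    if "Vector_Spaces.linear sH (*) f" for f
    using Vector_Spaces.linear_compose[OF lin AH.slice(1)[OF that]] by (simp add: comp_def)
  have act_act: "slice sA sH p (\<rho> (slice sA sH f (\<rho> a))) =
      slice sA sH (\<lambda>h. f (left_slice sH sH p (\<Delta> h))) (\<rho> a)"
    if p: "Vector_Spaces.linear sH (*) p" and f: "Vector_Spaces.linear sH (*) f" for p f a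
    using AH.slice_tensor_map[OF idA slice_\<Delta>_linear[OF f] p space]
    by (simp add: co[OF f] slice_left_slice[OF p f])
  define \<phi> where "\<phi> a = slice sA sH \<gamma> (\<rho> a)" for a
  define d where "d i a = slice sA sH (\<xi> i) (\<rho> a)" for i a
  have \<phi>_linear: "Vector_Spaces.linear sA sA \<phi>" and d_linear: "\<And>i. Vector_Spaces.linear sA sA (d i)"
    using act_linear[OF \<gamma>_linear] act_linear[OF \<xi>_linear] by (simp_all add: \<phi>_def[abs_def] d_def[abs_def])
  have "algebra_hom sA sA \<phi>"
    unfolding algebra_hom_def
    using linearD[OF \<phi>_linear] AH.slice_mult[OF \<gamma>_linear \<gamma>_mult space space]
    by (simp add: \<phi>_def mult one AH.slice \<gamma>_linear \<gamma>_one)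
  moreover have "\<phi> (\<phi> a) = a" for a
    using act_act[OF \<gamma>_linear \<gamma>_linear, of a] counit[of a]
    by (simp add: \<phi>_def \<Gamma>_\<Gamma> flip: \<Gamma>_def \<epsilon>_\<Gamma>)
  moreover have "d i (a * b) = d i a * b + \<phi> a * d i b" for i a b
    using AH.slice_mult_skew[OF \<xi>_linear \<epsilon>_linear \<gamma>_linear \<xi>_mult space space]
    by (simp add: d_def \<phi>_def mult counit)
  moreover have "d i (\<phi> a) = - \<phi> (d i a)" for i a
  proof -
    have lin: "Vector_Spaces.linear sH (*) (\<lambda>h. \<epsilon> (\<Gamma> (R i h)))"
      using Vector_Spaces.linear_compose[OF Vector_Spaces.linear_compose[OF R_linear \<Gamma>_linear] \<epsilon>_linear]
      by (simp add: comp_def)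
    have "d i (\<phi> a) = slice sA sH (\<lambda>h. \<epsilon> (\<Gamma> (R i h))) (\<rho> a)"
      unfolding d_def \<phi>_def act_act[OF \<xi>_linear \<gamma>_linear] R_def[symmetric] by (simp add: \<epsilon>_\<Gamma>)
    moreover have "\<phi> (d i a) = slice sA sH (\<lambda>h. - \<epsilon> (\<Gamma> (R i h))) (\<rho> a)"
      unfolding d_def \<phi>_def act_act[OF \<gamma>_linear \<xi>_linear] \<Gamma>_def[symmetric]
      by (simp add: R_\<Gamma> \<epsilon>_simps flip: \<epsilon>_R)
    ultimately show ?thesis using AH.slice_uminus[OF lin space] by simp
  qed
  moreover have "d i (d j a) = - d j (d i a)" for i j a
  proof -
    have lin: "Vector_Spaces.linear sH (*) (\<lambda>h. \<epsilon> (R j (R i h)))"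
      using Vector_Spaces.linear_compose[OF Vector_Spaces.linear_compose[OF R_linear R_linear] \<epsilon>_linear]
      by (simp add: comp_def)
    have "d i (d j a) = slice sA sH (\<lambda>h. \<epsilon> (R j (R i h))) (\<rho> a)"
      unfolding d_def act_act[OF \<xi>_linear \<xi>_linear] R_def[symmetric] by (simp add: \<epsilon>_R)
    moreover have "d j (d i a) = slice sA sH (\<lambda>h. - \<epsilon> (R j (R i h))) (\<rho> a)"
    proof -
      have "\<xi> i (R j h) = - \<epsilon> (R j (R i h))" for h
        using R_R[of i j h] by (simp add: \<epsilon>_simps flip: \<epsilon>_R)
      then show ?thesis unfolding d_def act_act[OF \<xi>_linear \<xi>_linear] R_def[symmetric] by simp
    qed
    ultimately show ?thesis using AH.slice_uminus[OF lin space] by simp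
  qed
  ultimately have sk: "skew_action \<phi> d"
    unfolding skew_action_def using d_linear by blast
  have act_map: "tmap (\<lambda>a. slice sA sH p (\<rho> a)) id (\<rho> a) = tmap id (\<lambda>h. left_slice sH sH p (\<Delta> h)) (\<rho> a)"
    if p: "Vector_Spaces.linear sH (*) p" for p a
  proof (rule tensor_eqI[OF VA])
    note m1 = AH.tensor_map[OF act_linear[OF p] idH] and m2 = AH.tensor_map[OF idA left_slice_\<Delta>_linear[OF p]]
    show "tmap (\<lambda>a. slice sA sH p (\<rho> a)) id (\<rho> a) \<in> AH.space"
      "tmap id (\<lambda>h. left_slice sH sH p (\<Delta> h)) (\<rho> a) \<in> AH.space"
      by (rule m1(3)[OF space], rule m2(3)[OF space])
    fix f assume f: "Vector_Spaces.linear sH (*) f"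
    show "slice sA sH f (tmap (\<lambda>a. slice sA sH p (\<rho> a)) id (\<rho> a)) =
      slice sA sH f (tmap id (\<lambda>h. left_slice sH sH p (\<Delta> h)) (\<rho> a))"
      using AH.slice_tensor_map[OF act_linear[OF p] idH f space[of a]]
        AH.slice_tensor_map[OF idA left_slice_\<Delta>_linear[OF p] f space[of a]]
      by (simp add: act_act[OF p f])
  qed
  have "invariant \<phi> d (\<rho> a)" for a
    unfolding invariant_def
    using space[of a] act_map[OF \<gamma>_linear, of a] act_map[OF \<xi>_linear, of _ a]
    by (simp flip: \<phi>_def d_def \<Gamma>_def R_def)
  from invariant_eq_taylor[OF sk this] have "\<rho> a = taylor \<phi> d a" for a by (simp add: counit)
  with sk show ?thesis by blast
qed

text \<open>For \<open>\<phi>(u\<^sub>i) = -u\<^sub>i\<close> the operator \<open>d\<^sub>i d\<^sub>j + d\<^sub>j d\<^sub>i\<close> is the commutator with \<open>u\<^sub>i u\<^sub>j + u\<^sub>j u\<^sub>i\<close>.\<close>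

lemma inner_skew_action:
  assumes \<phi>h: "algebra_hom sA sA \<phi>" and inv: "\<And>a. \<phi> (\<phi> a) = a"
    and u: "\<And>i. i \<in> {1..n} \<Longrightarrow> \<phi> (u i) = - u i"
  shows "skew_action \<phi> (\<lambda>i b. u i * b - \<phi> b * u i) \<longleftrightarrow>
    (\<forall>i\<in>{1..n}. \<forall>j\<in>{1..n}. A.central (u i * u j + u j * u i))"
proof -
  note \<phi>D = algebra_homD[OF \<phi>h]
  let ?d = "\<lambda>i b. u i * b - \<phi> b * u i"
  have lin: "Vector_Spaces.linear sA sA (?d i)" for i
    by (rule linearI[OF VA VA])
      (simp_all add: \<phi>D algebra_simps A.scale_mult_left A.scale_mult_right A.scale_right_diff_distrib)
  have der: "?d i (a * b) = ?d i a * b + \<phi> a * ?d i b" for i a b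
    by (simp add: \<phi>D algebra_simps)
  have d\<phi>: "?d i (\<phi> a) = - \<phi> (?d i a)" if "i \<in> {1..n}" for i a
    using u[OF that] by (simp add: \<phi>D inv)
  have dd: "?d i (?d j a) + ?d j (?d i a) = (u i * u j + u j * u i) * a - a * (u i * u j + u j * u i)"
    if "i \<in> {1..n}" "j \<in> {1..n}" for i j a
    using u that by (simp add: \<phi>D inv algebra_simps)
  have "?d i (?d j a) = - ?d j (?d i a) \<longleftrightarrow> (u i * u j + u j * u i) * a = a * (u i * u j + u j * u i)"
    if "i \<in> {1..n}" "j \<in> {1..n}" for i j a
    using dd[OF that, of a] by (metis add_eq_0_iff2 right_minus_eq)
  then show ?thesis
    unfolding skew_action_def A.central_def using lin der d\<phi> \<phi>h inv by simp
qed

lemma taylor_cong: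
  assumes "\<And>i a. i \<in> {1..n} \<Longrightarrow> d i a = d' i a"
  shows "taylor \<phi> d = taylor \<phi> d'"
proof
  fix a
  have "ordered_comp d P a = ordered_comp d' P a" if "P \<in> Pow {1..n}" for P
  proof -
    have P: "set (sorted_list_of_set P) \<subseteq> {1..n}" using that finite_subset[of P "{1..n}"] by auto
    have "foldr d K a = foldr d' K a" if "set K \<subseteq> {1..n}" for K
      using that by (induction K) (simp_all add: assms)
    with P show ?thesis by (simp add: ordered_comp_foldr)
  qed
  then show "taylor \<phi> d a = taylor \<phi> d' a" unfolding taylor_def by (intro sum.cong) simp_all
qed

lemma skew_action_cong:
  assumes "\<And>i. i \<in> {1..n} \<Longrightarrow> d i = d' i"
  shows "skew_action \<phi> d \<longleftrightarrow> skew_action \<phi> d'"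
  unfolding skew_action_def using assms by simp

lemma E_coaction_map_taylor:
  "E_coaction_map sA sH n g x \<phi> u = taylor \<phi> (\<lambda>i b. u i * b - \<phi> b * u i)"
  by (rule ext) (simp add: E_coaction_map_def taylor_def taylor_sign_def ep_def em_def xp_def Let_def)

end

section \<open>The classification\<close>

text \<open>If \<open>v\<close> implements \<open>d\<close>, then \<open>w = v + \<phi>(v)\<close> satisfies \<open>w a = \<phi>(a) w\<close>, because \<open>d\<close> anticommutes with
  \<open>\<phi>\<close>.  Subtracting \<open>w / 2\<close> from \<open>v\<close> does not change the skew derivation.\<close>

lemma (in odd_clifford) skew_derivation_inner_antiinvariant:
  assumes \<phi>h: "algebra_hom scale scale \<phi>" and inv: "\<And>a. \<phi> (\<phi> a) = a"
    and add: "\<And>a b. d (a + b) = d a + d b" and sc: "\<And>r a. d (scale r a) = scale r (d a)"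
    and der: "\<And>a b. d (a * b) = d a * b + \<phi> a * d b"
    and d\<phi>: "\<And>a. d (\<phi> a) = - \<phi> (d a)"
  shows "\<exists>u. \<phi> u = - u \<and> (\<forall>a. d a = u * a - \<phi> a * u)"
proof -
  note \<phi>D = algebra_homD[OF \<phi>h]
  obtain v where v: "\<And>a. d a = v * a - \<phi> a * v"
    using skew_derivation_inner[OF \<phi>h add sc der] by blast
  define w where "w = v + \<phi> v"
  have w\<phi>: "w * \<phi> a = a * w" for a
    using d\<phi>[of a] by (simp add: v \<phi>D inv w_def algebra_simps)
  have w: "w * a = \<phi> a * w" for a using w\<phi>[of "\<phi> a"] by (simp add: inv)
  have \<phi>w: "\<phi> w = w" by (simp add: w_def \<phi>D inv add.commute)
  define u where "u = v - scale (1 / 2) w"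
  have half: "scale (1 / 2) w + scale (1 / 2) w = w"
    using half_double[OF two, of w] by (simp add: scale_right_distrib)
  have "\<phi> u + u = (v + \<phi> v) - (scale (1 / 2) w + scale (1 / 2) w)"
    by (simp add: u_def \<phi>D \<phi>w)
  also have "\<dots> = 0" by (simp only: half w_def[symmetric] diff_self)
  finally have "\<phi> u = - u" by (simp add: add_eq_0_iff2)
  moreover have "d a = u * a - \<phi> a * u" for a
    by (simp add: v u_def left_diff_distrib right_diff_distrib scale_mult_left scale_mult_right w)
  ultimately show ?thesis by blast
qed

text \<open>The case where \<open>\<tau>\<close> is the identity is ordinary conjugation; the other case of interest is \<open>\<tau> = \<sigma>\<close>.\<close>

lemma (in k_algebra) twisted_conjugation:
  assumes \<tau>: "algebra_hom scale scale \<tau>" and inv: "\<And>a. \<tau> (\<tau> a) = a"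
    and c: "c * c_inv = 1" "c_inv * c = 1"
  shows "algebra_hom scale scale (\<lambda>a. \<tau> (c_inv * a * c))"
    and "(\<forall>a. \<tau> (c_inv * \<tau> (c_inv * a * c) * c) = a) \<longleftrightarrow> central (c * \<tau> c)"
    and "\<tau> (c_inv * v * c) = - v \<longleftrightarrow> v * c + c * \<tau> v = 0"
proof -
  note \<tau>D = algebra_homD[OF \<tau>]
  have \<tau>c: "\<tau> c * \<tau> c_inv = 1" "\<tau> c_inv * \<tau> c = 1" using c by (simp_all add: \<tau>D flip: \<tau>D(4))
  have cancel: "c_inv * (c * y) = y" "c * (c_inv * y) = y"
    "\<tau> c_inv * (\<tau> c * y) = y" "\<tau> c * (\<tau> c_inv * y) = y" for y
    using c \<tau>c by (simp_all flip: mult.assoc)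
  show "algebra_hom scale scale (\<lambda>a. \<tau> (c_inv * a * c))"
    unfolding algebra_hom_def
    by (simp add: \<tau>D distrib_left distrib_right scale_mult_left scale_mult_right mult.assoc cancel \<tau>c)
  have "\<tau> (c_inv * \<tau> (c_inv * a * c) * c) = a \<longleftrightarrow> c * \<tau> c * a = a * (c * \<tau> c)" for a
  proof -
    have eq: "\<tau> (c_inv * \<tau> (c_inv * a * c) * c) = \<tau> c_inv * (c_inv * a * c) * \<tau> c"
      by (simp add: \<tau>D inv)
    show ?thesis
      unfolding eq
    proof
      assume "\<tau> c_inv * (c_inv * a * c) * \<tau> c = a"
      then have "c * (\<tau> c * (\<tau> c_inv * (c_inv * a * c) * \<tau> c)) = c * (\<tau> c * a)" by simp
      then show "c * \<tau> c * a = a * (c * \<tau> c)" by (simp add: mult.assoc cancel)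
    next
      assume "c * \<tau> c * a = a * (c * \<tau> c)"
      then have "\<tau> c_inv * (c_inv * (c * \<tau> c * a)) = \<tau> c_inv * (c_inv * (a * (c * \<tau> c)))" by simp
      then show "\<tau> c_inv * (c_inv * a * c) * \<tau> c = a" by (simp add: mult.assoc cancel)
    qed
  qed
  then show "(\<forall>a. \<tau> (c_inv * \<tau> (c_inv * a * c) * c) = a) \<longleftrightarrow> central (c * \<tau> c)"
    by (auto simp: central_def)
  show "\<tau> (c_inv * v * c) = - v \<longleftrightarrow> v * c + c * \<tau> v = 0"
  proof
    assume "\<tau> (c_inv * v * c) = - v"
    then have "c * \<tau> (\<tau> (c_inv * v * c)) = c * \<tau> (- v)" by (simp only:)
    then have "v * c = - (c * \<tau> v)" by (simp only: inv \<tau>D(6)) (simp add: mult.assoc cancel)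
    then show "v * c + c * \<tau> v = 0" by simp
  next
    assume "v * c + c * \<tau> v = 0"
    then have "c_inv * (v * c) = c_inv * (- (c * \<tau> v))" by (simp add: add_eq_0_iff2)
    then have "c_inv * v * c = - \<tau> v" by (simp add: mult.assoc cancel)
    then show "\<tau> (c_inv * v * c) = - v" by (simp only: inv \<tau>D(6))
  qed
qed

theorem theorem5p6:
  fixes sA :: "'k::field \<Rightarrow> 'a::ring_1 \<Rightarrow> 'a"
    and sH :: "'k \<Rightarrow> 'h::ring_1 \<Rightarrow> 'h"
    and n :: nat
    and \<alpha> :: 'k and \<beta> \<gamma> :: "nat \<Rightarrow> 'k" and lam :: "nat \<Rightarrow> nat \<Rightarrow> 'k"
    and G :: 'a and X :: "nat \<Rightarrow> 'a"
    and V :: "'a set" and z :: 'a and \<sigma> :: "'a \<Rightarrow> 'a"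
    and g :: 'h and x :: "nat \<Rightarrow> 'h"
    and \<Delta> :: "'h \<Rightarrow> ('h, 'h, 'k) tensor" and \<epsilon> :: "'h \<Rightarrow> 'k" and S :: "'h \<Rightarrow> 'h"
    and \<rho> :: "'a \<Rightarrow> ('a, 'h, 'k) tensor"
  assumes char_k: "CHAR('k) \<noteq> 2"
    and n: "even n"
    and A: "is_clifford_algebra sA n \<alpha> \<beta> \<gamma> lam G X"
    and dim_A: "vector_space.dim sA (UNIV :: 'a set) = 2 ^ (n + 1)"
    and semisimple: "semisimple_ring TYPE('a)"
    and V: "V = generating_space sA n G X"
    and z: "is_pseudoscalar sA V z"
    and \<sigma>: "\<sigma> = main_involution sA V"
    and E: "is_E sH n g x \<Delta> \<epsilon> S"
  shows "is_right_coaction sA sH \<Delta> \<epsilon> \<rho> \<longleftrightarrow>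
    (\<exists>c c_inv u.
        c * c_inv = 1 \<and> c_inv * c = 1 \<and>
        c * c \<in> module.span sA {1, z} \<and>
        (\<forall>i\<in>{1..n}. u i * c + c * u i = 0 \<and> u i * u i \<in> module.span sA {1, z}) \<and>
        (\<forall>i\<in>{1..n}. \<forall>j\<in>{1..n}. u i * u j + u j * u i \<in> module.span sA {1, z}) \<and>
        \<rho> = E_coaction_map sA sH n g x (\<lambda>a. c_inv * a * c) u) \<or>
    (\<exists>c c_inv u.
        c * c_inv = 1 \<and> c_inv * c = 1 \<and>
        c * \<sigma> c \<in> module.span sA {1, z} \<and>
        (\<forall>i\<in>{1..n}. u i * c + c * \<sigma> (u i) = 0 \<and> u i * u i \<in> module.span sA {1, z}) \<and>
        (\<forall>i\<in>{1..n}. \<forall>j\<in>{1..n}. u i * u j + u j * u i \<in> module.span sA {1, z}) \<and>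
        \<rho> = E_coaction_map sA sH n g x (\<lambda>a. \<sigma> (c_inv * a * c)) u)"
proof -
  have two: "(2::'k) \<noteq> 0"
  proof
    assume "(2::'k) = 0"
    then have "of_nat 2 = (0::'k)" by simp
    then have "CHAR('k) dvd 2" by (simp only: of_nat_eq_0_iff_char_dvd)
    moreover from this have "CHAR('k) \<le> 2" by (rule dvd_imp_le) simp
    moreover from calculation have "CHAR('k) \<noteq> 0" by (metis dvd_0_left_iff zero_neq_numeral)
    ultimately have "CHAR('k) = 1 \<or> CHAR('k) = 2" by linarith
    then show False using char_k CHAR_not_1 by auto
  qed
  obtain es q where cl: "odd_clifford sA es q" and z_es: "z = prod_list es"
    and \<sigma>h: "algebra_hom sA sA \<sigma>" and \<sigma>\<sigma>: "\<And>a. \<sigma> (\<sigma> a) = a" and \<sigma>z: "\<sigma> z = - z"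
    using clifford_structure[OF two n A dim_A semisimple V z \<sigma>] by blast
  interpret C: odd_clifford sA es q by (rule cl)
  interpret E_hopf sH n g x \<Delta> \<epsilon> S using two E by unfold_locales
  interpret E_comodule sA sH n g x \<Delta> \<epsilon> S ..
  note \<sigma>D = algebra_homD[OF \<sigma>h]
  have central: "a \<in> C.span {1, z} \<longleftrightarrow> C.central a" for a by (simp add: C.central_iff z_es)
  let ?P = "\<lambda>\<phi> u. (\<forall>i\<in>{1..n}. \<phi> (u i) = - u i) \<and>
    (\<forall>i\<in>{1..n}. \<forall>j\<in>{1..n}. C.central (u i * u j + u j * u i)) \<and> \<rho> = E_coaction_map sA sH n g x \<phi> u"
  have main: "is_right_coaction sA sH \<Delta> \<epsilon> \<rho> \<longleftrightarrow>
    (\<exists>\<phi> u. algebra_hom sA sA \<phi> \<and> (\<forall>a. \<phi> (\<phi> a) = a) \<and> ?P \<phi> u)"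
  proof
    assume "is_right_coaction sA sH \<Delta> \<epsilon> \<rho>"
    then obtain \<phi> d where sk: "skew_action \<phi> d" and \<rho>: "\<rho> = taylor \<phi> d"
      using coaction_skew_action by blast
    note \<phi>h = skew_actionD(1)[OF sk] and inv = skew_actionD(2)[OF sk]
    have "\<exists>u. \<phi> u = - u \<and> (\<forall>a. d i a = u * a - \<phi> a * u)" if i: "i \<in> {1..n}" for i
    proof -
      note d = skew_actionD(3)[OF sk i] and der = skew_actionD(4)[OF sk i] and d\<phi> = skew_actionD(5)[OF sk i]
      show ?thesis
        by (rule C.skew_derivation_inner_antiinvariant[OF \<phi>h inv linearD(1)[OF d] linearD(2)[OF d] der d\<phi>])
    qed
    then obtain u where u: "\<And>i. i \<in> {1..n} \<Longrightarrow> \<phi> (u i) = - u i"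
      "\<And>i a. i \<in> {1..n} \<Longrightarrow> d i a = u i * a - \<phi> a * u i" by metis
    have "skew_action \<phi> d \<longleftrightarrow> skew_action \<phi> (\<lambda>i b. u i * b - \<phi> b * u i)"
      by (rule skew_action_cong) (rule ext, rule u(2))
    with sk have "skew_action \<phi> (\<lambda>i b. u i * b - \<phi> b * u i)" by blast
    then have "\<forall>i\<in>{1..n}. \<forall>j\<in>{1..n}. C.central (u i * u j + u j * u i)"
      using inner_skew_action[of \<phi> u, OF \<phi>h inv u(1)] by blast
    moreover have "\<rho> = E_coaction_map sA sH n g x \<phi> u"
      unfolding E_coaction_map_taylor \<rho> by (rule taylor_cong) (rule u(2))
    ultimately show "\<exists>\<phi> u. algebra_hom sA sA \<phi> \<and> (\<forall>a. \<phi> (\<phi> a) = a) \<and> ?P \<phi> u"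
      using \<phi>h inv u(1) by blast
  next
    assume "\<exists>\<phi> u. algebra_hom sA sA \<phi> \<and> (\<forall>a. \<phi> (\<phi> a) = a) \<and> ?P \<phi> u"
    then obtain \<phi> u where \<phi>: "algebra_hom sA sA \<phi>" "\<And>a. \<phi> (\<phi> a) = a" and P: "?P \<phi> u" by blast
    have "skew_action \<phi> (\<lambda>i b. u i * b - \<phi> b * u i)"
      using inner_skew_action[of \<phi> u, OF \<phi>] P by blast
    from skew_action_coaction[OF this] show "is_right_coaction sA sH \<Delta> \<epsilon> \<rho>"
      using P by (simp add: E_coaction_map_taylor)
  qed
  \<comment> \<open>The two forms of the statement are \<open>Q id\<close> and \<open>Q \<sigma>\<close>.\<close>
  define Q where "Q \<tau> \<longleftrightarrow> (\<exists>c c_inv u.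
        c * c_inv = 1 \<and> c_inv * c = 1 \<and>
        c * \<tau> c \<in> C.span {1, z} \<and>
        (\<forall>i\<in>{1..n}. u i * c + c * \<tau> (u i) = 0 \<and> u i * u i \<in> C.span {1, z}) \<and>
        (\<forall>i\<in>{1..n}. \<forall>j\<in>{1..n}. u i * u j + u j * u i \<in> C.span {1, z}) \<and>
        \<rho> = E_coaction_map sA sH n g x (\<lambda>a. \<tau> (c_inv * a * c)) u)" for \<tau>
  have half: "u i * u i \<in> C.span {1, z}" if "C.central (u i * u i + u i * u i)" for u :: "nat \<Rightarrow> 'a" and i
    using C.central_closed(3)[OF that, of "1 / 2"] C.half_double[OF two, of "u i * u i"]
    by (simp add: central)
  have Q_intro: "Q \<tau>"
    if \<tau>: "algebra_hom sA sA \<tau>" "\<And>a. \<tau> (\<tau> a) = a" and \<phi>: "algebra_hom sA sA \<phi>"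
      and inv: "\<And>a. \<phi> (\<phi> a) = a" and P: "?P \<phi> u" and fix_z: "\<tau> (\<phi> (prod_list es)) = prod_list es"
    for \<tau> \<phi> u
  proof -
    have hom: "algebra_hom sA sA (\<lambda>a. \<tau> (\<phi> a))"
      using algebra_homD[OF \<phi>] algebra_homD[OF \<tau>(1)] by (simp add: algebra_hom_def)
    have "surj (\<lambda>a. \<tau> (\<phi> a))" by (rule surjI[of _ "\<lambda>a. \<phi> (\<tau> a)"]) (simp add: inv \<tau>(2))
    from C.skolem_noether[OF hom this fix_z] obtain c c_inv
      where c: "c * c_inv = 1" "c_inv * c = 1" and eq: "\<And>a. \<tau> (\<phi> a) = c_inv * a * c" by blast
    have \<phi>_eq: "\<phi> = (\<lambda>a. \<tau> (c_inv * a * c))" by (rule ext) (simp add: \<tau>(2) flip: eq)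
    note conj = C.twisted_conjugation[OF \<tau> c]
    have "C.central (c * \<tau> c)" using inv conj(2) unfolding \<phi>_eq by blast
    then show ?thesis
      using c P conj(3) half unfolding \<phi>_eq Q_def
      by (intro exI[of _ c] exI[of _ c_inv] exI[of _ u]) (auto simp: central)
  qed
  have Q_elim: "\<exists>\<phi> u. algebra_hom sA sA \<phi> \<and> (\<forall>a. \<phi> (\<phi> a) = a) \<and> ?P \<phi> u"
    if \<tau>: "algebra_hom sA sA \<tau>" "\<And>a. \<tau> (\<tau> a) = a" and Q: "Q \<tau>" for \<tau>
  proof -
    obtain c c_inv u where c: "c * c_inv = 1" "c_inv * c = 1" and cc: "C.central (c * \<tau> c)"
      and u: "\<And>i. i \<in> {1..n} \<Longrightarrow> u i * c + c * \<tau> (u i) = 0"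
      and uu: "\<forall>i\<in>{1..n}. \<forall>j\<in>{1..n}. C.central (u i * u j + u j * u i)"
      and \<rho>: "\<rho> = E_coaction_map sA sH n g x (\<lambda>a. \<tau> (c_inv * a * c)) u"
      using Q unfolding Q_def central by blast
    show ?thesis
      by (rule exI[of _ "\<lambda>a. \<tau> (c_inv * a * c)"], rule exI[of _ u])
        (use C.twisted_conjugation[OF \<tau> c] cc u uu \<rho> in blast)
  qed
  have id_hom: "algebra_hom sA sA (\<lambda>a. a)" by (simp add: algebra_hom_def)
  have "(\<exists>\<phi> u. algebra_hom sA sA \<phi> \<and> (\<forall>a. \<phi> (\<phi> a) = a) \<and> ?P \<phi> u) \<longleftrightarrow> Q (\<lambda>a. a) \<or> Q \<sigma>"
  proof
    assume "\<exists>\<phi> u. algebra_hom sA sA \<phi> \<and> (\<forall>a. \<phi> (\<phi> a) = a) \<and> ?P \<phi> u"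
    then obtain \<phi> u where \<phi>: "algebra_hom sA sA \<phi>" and inv: "\<And>a. \<phi> (\<phi> a) = a" and P: "?P \<phi> u" by blast
    from C.involution_pseudoscalar[OF \<phi> inv] show "Q (\<lambda>a. a) \<or> Q \<sigma>"
    proof
      assume "\<phi> (prod_list es) = prod_list es"
      then show ?thesis using Q_intro[OF id_hom refl \<phi> inv P] by blast
    next
      assume "\<phi> (prod_list es) = - prod_list es"
      then have "\<sigma> (\<phi> (prod_list es)) = prod_list es" using \<sigma>z by (simp add: z_es \<sigma>D)
      then show ?thesis using Q_intro[OF \<sigma>h \<sigma>\<sigma> \<phi> inv P] by blast
    qed
  next
    assume "Q (\<lambda>a. a) \<or> Q \<sigma>"
    then show "\<exists>\<phi> u. algebra_hom sA sA \<phi> \<and> (\<forall>a. \<phi> (\<phi> a) = a) \<and> ?P \<phi> u"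
      using Q_elim[OF id_hom refl] Q_elim[OF \<sigma>h \<sigma>\<sigma>] by blast
  qed
  then show ?thesis unfolding main Q_def .
qed

end
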